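(* Let $X=\mathbb R^\ell$, $Y=\mathbb R^m$, $Z=\mathbb R^n$, and let $(f,\psi,p):X\to Y$ and $(g,\chi,q):Y\to Z$ be composable morphisms in $\mathsf{GaussEx}$. Let $(X\times Y,\mathcal E,P)$ and $(Y\times Z,\mathcal F,Q)$ be the Gaussian systems given by the names of $(f,\psi,p)$ and $(g,\chi,q)$, respectively, and weaken them to systems $(X\times Y\times Z,\mathcal E',P')$ and $(X\times Y\times Z,\mathcal F',Q')$ by $$\mathcal E'=\{E\times Z : E\in\mathcal E\},\quad P'(E\times Z)=P(E),\qquad \mathcal F'=\{X\times F: F\in\mathcal F\},\quad Q'(X\times F)=Q(F).$$ These systems have fibres $$\mathbb D_{P'}=\{(x,y,z): f(x)=p(y)\},\qquad \mathbb D_{Q'}=\{(x,y,z): g(y)=q(z)\}.$$ Then these two systems are complementary, and their interconnection is equal to the name of the composite $f;\mathsf{copy}_Y;(\mathsf{id}_Y\otimes g): X\to Y\otimes Z$ (where $f$ and $g$ here abbreviate the $\mathsf{GaussEx}$ morphisms $(f,\psi,p)$ and $(g,\chi,q)$, and $;$ is composition in diagrammatic order). In particular, the composite $f;g$ is obtained by interconnecting and then marginalizing out the middle wire: the system obtained from the interconnection by eliminating the variable $y\in Y$ is equal to the name of $f;g$.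
   Context: **Gaussian distributions.** A Gaussian distribution on $\mathbb R^k$ is a multivariate normal distribution $\mathcal N(\mu,\Sigma)$ on the Borel sets, with $\Sigma$ positive semidefinite and possibly singular (so Dirac measures $\delta_\mu=\mathcal N(\mu,0)$ are included). $M_*\psi$ denotes pushforward under a linear map $M$, $\psi\otimes\psi'$ the product measure, and $\psi+\psi'$ convolution. **The category $\mathsf{GaussEx}$.** Objects are the spaces $\mathbb R^n$, $n\ge 0$. A morphism $\mathbb R^m\to\mathbb R^n$ is an equivalence class of triples $(f,\psi,p)$ where $f:\mathbb R^m\to\mathbb R^k$ is linear, $p:\mathbb R^n\to\mathbb R^k$ is linear and surjective (for some $k$), and $\psi$ is a Gaussian distribution on $\mathbb R^k$. The triples $(f,\psi,p)$ and $(\tau f,\tau_*\psi,\tau p)$ are identified for every linear isomorphism $\tau$. The identity is $(\mathsf{id},\delta_0,\mathsf{id})$. The composite of $(f,\psi,p):X\to Y$ (with apex $P$) followed by $(g,\chi,q):Y\to Z$ (with apex $Q$) is $(i_1f,\ (i_1)_*\psi+(i_2)_*\chi,\ i_2q)$, where $P\xrightarrow{i_1}W\xleftarrow{i_2}Q$ is the pushout, in finite-dimensional vector spaces, of $P\xleftarrow{p}Y\xrightarrow{g}Q$. The tensor product is $\mathbb R^m\otimes\mathbb R^n=\mathbb R^m\times\mathbb R^n$ and $(f,\psi,p)\otimes(f',\psi',p')=(f\times f',\psi\otimes\psi',p\times p')$. Every linear map $h$ is regarded as the morphism $(h,\delta_0,\mathsf{id})$, and $\mathsf{copy}_Y:Y\to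 Y\otimes Y$ is the morphism given by the linear map $y\mapsto(y,y)$. **Systems.** A (stochastic) system is a probability space $(S,\mathcal E,P)$. For a subspace $\mathbb D\subseteq\mathbb R^n$, let $\mathcal B_{\mathbb D}(\mathbb R^n)=\{A\subseteq\mathbb R^n \text{ Borel}: A+\mathbb D\subseteq A\}$. A system is linear with fibre $\mathbb D$ if its underlying measurable space is $(\mathbb R^n,\mathcal B_{\mathbb D}(\mathbb R^n))$. It is a Gaussian system if moreover its measure is the restriction to $\mathcal B_{\mathbb D}(\mathbb R^n)$ of a Gaussian distribution on $\mathbb R^n$. **Name.** The name of a morphism $(f,\psi,p):\mathbb R^m\to\mathbb R^n$ is the Gaussian system $(\mathbb R^m\times\mathbb R^n,\mathcal E,P)$ whose events are exactly the sets $E_A=\{(x,y): p(y)-f(x)\in A\}$ with $A$ Borel, and $P(E_A)=\psi(A)$. Its fibre is $\{(x,y): f(x)=p(y)\}$. **Complementarity and interconnection.** Systems $(S,\mathcal E_1,P_1)$ and $(S,\mathcal E_2,P_2)$ on the same set are complementary if for all $E_1,E_1'\in\mathcal E_1$ and $E_2,E_2'\in\mathcal E_2$, $E_1\cap E_2=E_1'\cap E_2'$ implies $E_1=E_1'$ and $E_2=E_2'$. Their interconnection is then the system $(S,\mathcal G,R)$ where $\mathcal G$ is the $\sigma$-algebra generated by all $E_1\cap E_2$ with $E_i\in\mathcal E_i$, and $R$ is the probability measure determined by $R(E_1\cap E_2)=P_1(E_1)P_2(E_2)$. **Elimination (marginalizing out the middle wire).** From a system $(X\times Y\times Z,\mathcal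 G,R)$, eliminating $y$ yields the system $(X\times Z,\mathcal H,S)$ with $\mathcal H=\{H\subseteq X\times Z:\{(x,y,z):(x,z)\in H\}\in\mathcal G\}$ and $S(H)=R(\{(x,y,z):(x,z)\in H\})$.
   Formalization: Complementarity is required only for nonempty events E₁, E₁', E₂, E₂': with empty events allowed, ∅∩S = ∅∩∅ would make the stated condition fail on every nonempty S. *)

theory Defs
  imports
    "HOL-Probability.Probability"
    "Jordan_Normal_Form.VS_Connect"
begin

unbundle no vec_syntax
unbundle no inner_syntax

text \<open>
  \<open>\<real>\<^sup>n\<close> is the set \<open>carrier_vec n\<close>, for every natural number \<open>n \<ge> 0\<close>, and a linear map
  \<open>\<real>\<^sup>m \<rightarrow> \<real>\<^sup>k\<close> is a \<open>k \<times> m\<close> matrix \<open>A\<close>, acting by \<open>x \<mapsto> A *\<^sub>v x\<close>. The product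
  \<open>\<real>\<^sup>m \<times> \<real>\<^sup>n\<close> is \<open>\<real>\<^sup>m\<^sup>+\<^sup>n\<close>, the pair \<open>(x, y)\<close> being the concatenation \<open>x @\<^sub>v y\<close>.
\<close>

type_synonym rvec = "real Matrix.vec"
type_synonym rmat = "real Matrix.mat"

section \<open>Gaussian distributions\<close>

text \<open>The Borel sets of \<open>\<real>\<^sup>n\<close>, obtained from the \<open>n\<close>-fold product of the Borel sets of
  \<open>\<real>\<close> along the bijection sending a vector to its family of coordinates.\<close>

definition borel_vec :: "nat \<Rightarrow> rvec measure" where
  "borel_vec n = vimage_algebra (carrier_vec n)
     (\<lambda>v. restrict (vec_index v) {..<n}) (Pi\<^sub>M {..<n} (\<lambda>_. borel))"

lemma space_borel_vec [simp]: "space (borel_vec n) = carrier_vec n"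
  by (simp add: borel_vec_def)

lemma measurable_borel_vec_iff:
  "h \<in> measurable M (borel_vec n) \<longleftrightarrow>
     h \<in> space M \<rightarrow> carrier_vec n \<and> (\<forall>i<n. (\<lambda>x. vec_index (h x) i) \<in> borel_measurable M)"
proof
  assume h: "h \<in> measurable M (borel_vec n)"
  have "(\<lambda>v. vec_index v i) \<in> borel_measurable (borel_vec n)" if "i < n" for i
  proof -
    have "(\<lambda>v. (restrict (vec_index v) {..<n}) i) \<in> borel_measurable (borel_vec n)"
      unfolding borel_vec_def
      by (rule measurable_compose[OF measurable_vimage_algebra1 measurable_component_singleton])
         (use that in \<open>auto simp: space_PiM split: if_splits\<close>)
    then show ?thesis using that by simp
  qed
  then show "h \<in> space M \<rightarrow> carrier_vec n \<and>
      (\<forall>i<n. (\<lambda>x. vec_index (h x) i) \<in> borel_measurable M)"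
    using measurable_space[OF h] measurable_compose[OF h] by auto
next
  assume "h \<in> space M \<rightarrow> carrier_vec n \<and>
      (\<forall>i<n. (\<lambda>x. vec_index (h x) i) \<in> borel_measurable M)"
  then show "h \<in> measurable M (borel_vec n)"
    unfolding borel_vec_def
    by (intro measurable_vimage_algebra2 measurable_restrict) auto
qed

lemma measurable_mult_mat_vec:
  assumes M: "M \<in> carrier_mat k n"
  shows "(\<lambda>x. M *\<^sub>v x) \<in> measurable (borel_vec n) (borel_vec k)"
  unfolding measurable_borel_vec_iff
proof (intro conjI allI impI)
  show "(\<lambda>x. M *\<^sub>v x) \<in> space (borel_vec n) \<rightarrow> carrier_vec k" using M by auto
  fix i assume i: "i < k"
  have c: "(\<lambda>x. vec_index x j) \<in> borel_measurable (borel_vec n)" if "j < n" for j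
    using measurable_ident[of "borel_vec n"] that
    unfolding measurable_borel_vec_iff[of id] by simp
  have "(\<lambda>x. \<Sum>j<n. M $$ (i, j) * vec_index x j) \<in> borel_measurable (borel_vec n)"
    by (intro borel_measurable_sum borel_measurable_times c) auto
  then show "(\<lambda>x. vec_index (M *\<^sub>v x) i) \<in> borel_measurable (borel_vec n)"
    by (rule measurable_cong[THEN iffD1, rotated])
       (use M i in \<open>auto simp: scalar_prod_def atLeast0LessThan intro!: sum.cong\<close>)
qed

text \<open>Since \<open>\<Sigma>\<close> may be singular, \<open>\<N>(\<mu>, \<Sigma>)\<close> need not have a density; it is the probability
  measure with characteristic function \<open>t \<mapsto> exp (i t\<^sup>T\<mu> - t\<^sup>T\<Sigma>t / 2)\<close>.\<close>

definition gaussian_with :: "nat \<Rightarrow> rvec \<Rightarrow> rmat \<Rightarrow> rvec measure \<Rightarrow> bool" where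
  "gaussian_with k \<mu> \<Sigma> \<psi> \<longleftrightarrow>
     prob_space \<psi> \<and> space \<psi> = carrier_vec k \<and> sets \<psi> = sets (borel_vec k) \<and>
     (\<forall>t\<in>carrier_vec k.
        (CLINT x|\<psi>. iexp (t \<bullet> x)) =
        exp (\<i> * complex_of_real (t \<bullet> \<mu>) - complex_of_real (t \<bullet> (\<Sigma> *\<^sub>v t)) / 2))"

definition positive_semidefinite :: "nat \<Rightarrow> rmat \<Rightarrow> bool" where
  "positive_semidefinite k \<Sigma> \<longleftrightarrow>
     \<Sigma> \<in> carrier_mat k k \<and> transpose_mat \<Sigma> = \<Sigma> \<and> (\<forall>t\<in>carrier_vec k. 0 \<le> t \<bullet> (\<Sigma> *\<^sub>v t))"

definition gaussian :: "nat \<Rightarrow> rvec measure \<Rightarrow> bool" where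
  "gaussian k \<psi> \<longleftrightarrow>
     (\<exists>\<mu>\<in>carrier_vec k. \<exists>\<Sigma>. positive_semidefinite k \<Sigma> \<and> gaussian_with k \<mu> \<Sigma> \<psi>)"

definition dirac :: "nat \<Rightarrow> rvec \<Rightarrow> rvec measure" where
  "dirac k \<mu> = return (borel_vec k) \<mu>"

definition push :: "rmat \<Rightarrow> rvec measure \<Rightarrow> rvec measure" where
  "push M \<psi> = distr \<psi> (borel_vec (dim_row M)) (\<lambda>x. M *\<^sub>v x)"

definition product_dist :: "nat \<Rightarrow> nat \<Rightarrow> rvec measure \<Rightarrow> rvec measure \<Rightarrow> rvec measure" where
  "product_dist k k' \<psi> \<psi>' =
     distr (\<psi> \<Otimes>\<^sub>M \<psi>') (borel_vec (k + k')) (\<lambda>(u, v). u @\<^sub>v v)"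

definition conv_dist :: "nat \<Rightarrow> rvec measure \<Rightarrow> rvec measure \<Rightarrow> rvec measure" where
  "conv_dist k \<psi> \<psi>' = distr (\<psi> \<Otimes>\<^sub>M \<psi>') (borel_vec k) (\<lambda>(u, v). u + v)"


section \<open>The category GaussEx\<close>

type_synonym gx_triple = "rmat \<times> rvec measure \<times> rmat"

definition surj_mat :: "rmat \<Rightarrow> bool" where
  "surj_mat p \<longleftrightarrow> (\<lambda>y. p *\<^sub>v y) ` carrier_vec (dim_col p) = carrier_vec (dim_row p)"

definition gx_triples :: "nat \<Rightarrow> nat \<Rightarrow> gx_triple set" where
  "gx_triples m n = {(f, \<psi>, p). \<exists>k. f \<in> carrier_mat k m \<and> p \<in> carrier_mat k n \<and>
     surj_mat p \<and> gaussian k \<psi>}"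

definition gx_rel :: "(gx_triple \<times> gx_triple) set" where
  "gx_rel = {((f, \<psi>, p), (\<tau> * f, push \<tau> \<psi>, \<tau> * p)) | f \<psi> p \<tau>.
     \<tau> \<in> carrier_mat (dim_row p) (dim_row p) \<and> invertible_mat \<tau>}"

definition gx_class :: "gx_triple \<Rightarrow> gx_triple set" where
  "gx_class t = gx_rel `` {t}"

definition gx_hom :: "nat \<Rightarrow> nat \<Rightarrow> gx_triple set set" where
  "gx_hom m n = gx_triples m n // gx_rel"

text \<open>\<open>i\<^sub>1\<close> and \<open>i\<^sub>2\<close> form the pushout of \<open>P \<leftarrow> Y \<rightarrow> Q\<close>, where the legs of the span are \<open>p\<close> and
  \<open>g\<close>. Every finite-dimensional real vector space being isomorphic to some \<open>\<real>\<^sup>w\<close>, apex and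
  test objects range over these spaces.\<close>

definition is_pushout :: "rmat \<Rightarrow> rmat \<Rightarrow> rmat \<Rightarrow> rmat \<Rightarrow> bool" where
  "is_pushout p g i\<^sub>1 i\<^sub>2 \<longleftrightarrow>
     (\<exists>w. i\<^sub>1 \<in> carrier_mat w (dim_row p) \<and> i\<^sub>2 \<in> carrier_mat w (dim_row g) \<and>
        i\<^sub>1 * p = i\<^sub>2 * g \<and>
        (\<forall>v. \<forall>a\<in>carrier_mat v (dim_row p). \<forall>b\<in>carrier_mat v (dim_row g).
           a * p = b * g \<longrightarrow>
           (\<exists>!u. u \<in> carrier_mat v w \<and> u * i\<^sub>1 = a \<and> u * i\<^sub>2 = b)))"

fun gx_comp_along :: "rmat \<Rightarrow> rmat \<Rightarrow> gx_triple \<Rightarrow> gx_triple \<Rightarrow> gx_triple" where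
  "gx_comp_along i\<^sub>1 i\<^sub>2 (f, \<psi>, p) (g, \<chi>, q) =
     (i\<^sub>1 * f, conv_dist (dim_row i\<^sub>1) (push i\<^sub>1 \<psi>) (push i\<^sub>2 \<chi>), i\<^sub>2 * q)"

text \<open>Composition in diagrammatic order. Neither the representatives nor the pushout are chosen:
  all choices give the same equivalence class, and the union is that class.\<close>

definition gx_comp :: "gx_triple set \<Rightarrow> gx_triple set \<Rightarrow> gx_triple set" (infixl \<open>;;\<close> 60) where
  "F ;; G = \<Union> {gx_class (gx_comp_along i\<^sub>1 i\<^sub>2 (f, \<psi>, p) (g, \<chi>, q)) | f \<psi> p g \<chi> q i\<^sub>1 i\<^sub>2.
     (f, \<psi>, p) \<in> F \<and> (g, \<chi>, q) \<in> G \<and> is_pushout p g i\<^sub>1 i\<^sub>2}"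

definition prod_mat :: "rmat \<Rightarrow> rmat \<Rightarrow> rmat" where
  "prod_mat A B = four_block_mat A (0\<^sub>m (dim_row A) (dim_col B)) (0\<^sub>m (dim_row B) (dim_col A)) B"

fun gx_tensor_triple :: "gx_triple \<Rightarrow> gx_triple \<Rightarrow> gx_triple" where
  "gx_tensor_triple (f, \<psi>, p) (f', \<psi>', p') =
     (prod_mat f f', product_dist (dim_row p) (dim_row p') \<psi> \<psi>', prod_mat p p')"

text \<open>As for composition, the union is over representatives of a single class.\<close>

definition gx_tensor :: "gx_triple set \<Rightarrow> gx_triple set \<Rightarrow> gx_triple set" (infixr \<open>\<otimes>\<^sub>g\<close> 70) where
  "F \<otimes>\<^sub>g G = \<Union> {gx_class (gx_tensor_triple s t) | s t. s \<in> F \<and> t \<in> G}"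

definition gx_linear :: "rmat \<Rightarrow> gx_triple set" where
  "gx_linear h = gx_class (h, dirac (dim_row h) (0\<^sub>v (dim_row h)), 1\<^sub>m (dim_row h))"

definition gx_id :: "nat \<Rightarrow> gx_triple set" where
  "gx_id m = gx_linear (1\<^sub>m m)"

definition gx_copy :: "nat \<Rightarrow> gx_triple set" where
  "gx_copy m = gx_linear (1\<^sub>m m @\<^sub>r 1\<^sub>m m)"

lemma prod_mat_mult_vec:
  assumes "x \<in> carrier_vec (dim_col A)" "y \<in> carrier_vec (dim_col B)"
  shows "prod_mat A B *\<^sub>v (x @\<^sub>v y) = (A *\<^sub>v x) @\<^sub>v (B *\<^sub>v y)"
  unfolding prod_mat_def
  by (subst four_block_mat_mult_vec[of _ "dim_row A" "dim_col A" _ "dim_col B" _ "dim_row B"])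
     (use assms in auto)

lemma copy_mult_vec:
  fixes y :: rvec
  assumes "y \<in> carrier_vec m"
  shows "(1\<^sub>m m @\<^sub>r 1\<^sub>m m) *\<^sub>v y = y @\<^sub>v y"
  using assms by (subst mat_mult_append[of _ m m _ m]) auto


section \<open>Systems\<close>

text \<open>A system \<open>(S, \<E>, P)\<close> is a probability space, i.e. a term of type \<open>rvec measure\<close>
  satisfying \<open>prob_space\<close>, with \<open>S\<close>, \<open>\<E>\<close>, \<open>P\<close> its \<open>space\<close>, \<open>sets\<close>, \<open>emeasure\<close>.\<close>

definition invariant_borel :: "nat \<Rightarrow> rvec set \<Rightarrow> rvec set set" where
  "invariant_borel n D = {A \<in> sets (borel_vec n). {a + d | a d. a \<in> A \<and> d \<in> D} \<subseteq> A}"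

definition linear_system :: "nat \<Rightarrow> rvec set \<Rightarrow> rvec measure \<Rightarrow> bool" where
  "linear_system n D M \<longleftrightarrow> prob_space M \<and>
     VectorSpace.subspace class_ring D (module_vec TYPE(real) n) \<and>
     space M = carrier_vec n \<and> sets M = invariant_borel n D"

definition gaussian_system :: "nat \<Rightarrow> rvec set \<Rightarrow> rvec measure \<Rightarrow> bool" where
  "gaussian_system n D M \<longleftrightarrow> linear_system n D M \<and>
     (\<exists>N. gaussian n N \<and> (\<forall>A\<in>sets M. emeasure M A = emeasure N A))"

text \<open>The system on \<open>S\<close> whose events are exactly the sets \<open>\<phi> A\<close> for the events \<open>A\<close> of \<open>M\<close>, the
  probability of \<open>\<phi> A\<close> being that of \<open>A\<close>. This needs \<open>\<phi>\<close> to be injective on events and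
  compatible with the set operations, as in \<open>carry_system\<close> below.\<close>

definition carry_system :: "'b set \<Rightarrow> ('a set \<Rightarrow> 'b set) \<Rightarrow> 'a measure \<Rightarrow> 'b measure" where
  "carry_system S \<phi> M =
     measure_of S (\<phi> ` sets M) (\<lambda>E. emeasure M (the_inv_into (sets M) \<phi> E))"

lemma carry_system:
  assumes h: "h ` S = space M" and \<phi>: "\<And>A. A \<in> sets M \<Longrightarrow> \<phi> A = h -` A \<inter> S"
  shows space_carry_system: "space (carry_system S \<phi> M) = S"
    and sets_carry_system: "sets (carry_system S \<phi> M) = \<phi> ` sets M"
    and emeasure_carry_system:
      "A \<in> sets M \<Longrightarrow> emeasure (carry_system S \<phi> M) (\<phi> A) = emeasure M A"
proof -
  have inv: "h ` \<phi> A = A" if "A \<in> sets M" for A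
    using sets.sets_into_space[OF that] unfolding \<phi>[OF that] h[symmetric] by blast
  have inj: "inj_on \<phi> (sets M)"
    by (rule inj_on_inverseI[of _ "(`) h"]) (rule inv)
  have img: "\<phi> ` sets M = sets (vimage_algebra S h M)"
    using h by (subst sets_vimage_algebra2) (auto simp: \<phi>)
  have sa: "sigma_algebra S (\<phi> ` sets M)"
    unfolding img using sets.sigma_algebra_axioms[of "vimage_algebra S h M"] by simp
  have sub: "\<phi> ` sets M \<subseteq> Pow S" by (auto simp: \<phi>)
  show "space (carry_system S \<phi> M) = S"
    unfolding carry_system_def by (rule space_measure_of[OF sub])
  show sets_eq: "sets (carry_system S \<phi> M) = \<phi> ` sets M"
    unfolding carry_system_def using sa
    by (simp add: sub sigma_algebra.sigma_sets_eq)
  have the_inv: "the_inv_into (sets M) \<phi> (\<phi> A) = A" if "A \<in> sets M" for A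
    by (rule the_inv_into_f_f[OF inj that])
  let ?\<mu> = "\<lambda>E. emeasure M (the_inv_into (sets M) \<phi> E)"
  have empty: "\<phi> {} = {}" by (simp add: \<phi>)
  have pos: "positive (\<phi> ` sets M) ?\<mu>"
    unfolding positive_def using the_inv[of "{}"] by (simp add: empty)
  have ca: "countably_additive (\<phi> ` sets M) ?\<mu>"
  proof (rule countably_additiveI)
    fix E :: "nat \<Rightarrow> 'b set"
    assume E: "range E \<subseteq> \<phi> ` sets M" and disj: "disjoint_family E"
    define A where "A i = the_inv_into (sets M) \<phi> (E i)" for i
    have A: "A i \<in> sets M" "\<phi> (A i) = E i" for i
    proof -
      obtain B where B: "B \<in> sets M" "E i = \<phi> B" using E by blast
      show "A i \<in> sets M" "\<phi> (A i) = E i"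
        unfolding A_def B(2) the_inv[OF B(1)] using B(1) by simp_all
    qed
    have Ed: "E i = h -` A i \<inter> S" for i using \<phi>[OF A(1)] unfolding A(2) .
    have dA: "disjoint_family A"
      unfolding disjoint_family_on_def
    proof (intro ballI impI)
      fix i j :: nat assume "i \<noteq> j"
      then have "E i \<inter> E j = {}" using disj by (auto simp: disjoint_family_on_def)
      then have "h -` (A i \<inter> A j) \<inter> S = {}" unfolding Ed by auto
      moreover have "A i \<inter> A j \<subseteq> h ` S"
        using sets.sets_into_space[OF A(1)] h by blast
      ultimately show "A i \<inter> A j = {}" by blast
    qed
    have un: "(\<Union>i. E i) = \<phi> (\<Union>i. A i)"
      using A(1) by (subst \<phi>) (auto simp: Ed)
    have "(\<Sum>i. ?\<mu> (E i)) = (\<Sum>i. emeasure M (A i))" by (simp add: A_def)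
    also have "\<dots> = emeasure M (\<Union>i. A i)"
      using A(1) dA by (intro suminf_emeasure) auto
    also have "\<dots> = ?\<mu> (\<Union>i. E i)"
      unfolding un by (subst the_inv) (use A(1) in auto)
    finally show "(\<Sum>i. ?\<mu> (E i)) = ?\<mu> (\<Union>i. E i)" .
  qed
  show "emeasure (carry_system S \<phi> M) (\<phi> A) = emeasure M A" if "A \<in> sets M"
    unfolding carry_system_def
    by (subst emeasure_measure_of_sigma[OF sa pos ca]) (use that the_inv in auto)
qed

definition name_event :: "rmat \<Rightarrow> rmat \<Rightarrow> rvec set \<Rightarrow> rvec set" where
  "name_event f p A = {x @\<^sub>v y | x y. x \<in> carrier_vec (dim_col f) \<and> y \<in> carrier_vec (dim_col p) \<and>
     p *\<^sub>v y - f *\<^sub>v x \<in> A}"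

fun gx_triple_name :: "gx_triple \<Rightarrow> rvec measure" where
  "gx_triple_name (f, \<psi>, p) =
     carry_system (carrier_vec (dim_col f + dim_col p)) (name_event f p) \<psi>"

text \<open>The name does not depend on the representative, see \<open>gx_name_eq\<close> below.\<close>

definition gx_name :: "gx_triple set \<Rightarrow> rvec measure" where
  "gx_name F = gx_triple_name (SOME t. t \<in> F)"

definition name_map :: "rmat \<Rightarrow> rmat \<Rightarrow> rvec \<Rightarrow> rvec" where
  "name_map f p v = p *\<^sub>v vec_last v (dim_col p) - f *\<^sub>v vec_first v (dim_col f)"

lemma vec_first_append:
  assumes "x \<in> carrier_vec n"
  shows "vec_first (x @\<^sub>v y) n = x"
  using carrier_vecD[OF assms] by (intro eq_vecI) (auto simp: vec_first_def)

lemma vec_last_append: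
  assumes "y \<in> carrier_vec n"
  shows "vec_last (x @\<^sub>v y) n = y"
  using carrier_vecD[OF assms] by (intro eq_vecI) (auto simp: vec_last_def)

lemma append_vec_assoc: "(x @\<^sub>v y) @\<^sub>v z = x @\<^sub>v y @\<^sub>v z"
  by (intro eq_vecI) auto

lemma name_map_append:
  assumes "x \<in> carrier_vec (dim_col f)" "y \<in> carrier_vec (dim_col p)"
  shows "name_map f p (x @\<^sub>v y) = p *\<^sub>v y - f *\<^sub>v x"
  unfolding name_map_def vec_first_append[OF assms(1)] vec_last_append[OF assms(2)] ..

lemma name_event_eq: "name_event f p A = name_map f p -` A \<inter> carrier_vec (dim_col f + dim_col p)"
proof (intro Set.set_eqI iffI)
  fix v assume "v \<in> name_event f p A"
  then show "v \<in> name_map f p -` A \<inter> carrier_vec (dim_col f + dim_col p)"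
    unfolding name_event_def by (auto simp: name_map_append)
next
  fix v assume v: "v \<in> name_map f p -` A \<inter> carrier_vec (dim_col f + dim_col p)"
  then have "v = vec_first v (dim_col f) @\<^sub>v vec_last v (dim_col p)" by simp
  moreover have "p *\<^sub>v vec_last v (dim_col p) - f *\<^sub>v vec_first v (dim_col f) \<in> A"
    using v by (simp add: name_map_def)
  ultimately show "v \<in> name_event f p A"
    unfolding name_event_def using vec_first_carrier vec_last_carrier by blast
qed

lemma name_map_surj:
  assumes f: "f \<in> carrier_mat k m" and p: "p \<in> carrier_mat k n" and s: "surj_mat p"
  shows "name_map f p ` carrier_vec (m + n) = carrier_vec k"
proof (intro Set.set_eqI iffI)
  fix a assume "a \<in> name_map f p ` carrier_vec (m + n)"
  then show "a \<in> carrier_vec k" using f p by (auto simp: name_map_def)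
next
  fix a :: rvec assume a: "a \<in> carrier_vec k"
  then obtain y where y: "y \<in> carrier_vec n" "p *\<^sub>v y = a"
    using s p unfolding surj_mat_def by (metis carrier_matD image_iff)
  have "name_map f p (0\<^sub>v m @\<^sub>v y) = a"
    using f p y a by (subst name_map_append) auto
  then show "a \<in> name_map f p ` carrier_vec (m + n)"
    using y by (metis append_carrier_vec image_eqI zero_carrier_vec)
qed

lemma gx_triple_name:
  assumes "(f, \<psi>, p) \<in> gx_triples m n"
  shows space_gx_triple_name: "space (gx_triple_name (f, \<psi>, p)) = carrier_vec (m + n)"
    and sets_gx_triple_name: "sets (gx_triple_name (f, \<psi>, p)) = name_event f p ` sets \<psi>"
    and emeasure_gx_triple_name: "A \<in> sets \<psi> \<Longrightarrow>
      emeasure (gx_triple_name (f, \<psi>, p)) (name_event f p A) = emeasure \<psi> A"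
proof -
  obtain k where k: "f \<in> carrier_mat k m" "p \<in> carrier_mat k n" "surj_mat p" "space \<psi> = carrier_vec k"
    using assms by (auto simp: gx_triples_def gaussian_def gaussian_with_def)
  have d: "dim_col f = m" "dim_col p = n" using k by auto
  have h: "name_map f p ` carrier_vec (dim_col f + dim_col p) = space \<psi>"
    unfolding d k(4) by (rule name_map_surj[OF k(1-3)])
  note * = carry_system[OF h, of "name_event f p", OF name_event_eq]
  show "space (gx_triple_name (f, \<psi>, p)) = carrier_vec (m + n)"
    "sets (gx_triple_name (f, \<psi>, p)) = name_event f p ` sets \<psi>"
    "A \<in> sets \<psi> \<Longrightarrow> emeasure (gx_triple_name (f, \<psi>, p)) (name_event f p A) = emeasure \<psi> A"
    using * by (auto simp: d)
qed

lemma surj_mat_mult_invertible: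
  assumes \<tau>: "\<tau> \<in> carrier_mat k k" "\<tau>' \<in> carrier_mat k k" "\<tau> * \<tau>' = 1\<^sub>m k"
    and p: "p \<in> carrier_mat k n" "surj_mat p"
  shows "surj_mat (\<tau> * p)"
proof -
  have "\<exists>y\<in>carrier_vec n. (\<tau> * p) *\<^sub>v y = a" if a: "a \<in> carrier_vec k" for a
  proof -
    have "\<tau>' *\<^sub>v a \<in> carrier_vec k" using \<tau> a by auto
    then obtain y where y: "y \<in> carrier_vec n" "p *\<^sub>v y = \<tau>' *\<^sub>v a"
      using p unfolding surj_mat_def by (metis carrier_matD image_iff)
    have "(\<tau> * p) *\<^sub>v y = \<tau> *\<^sub>v (\<tau>' *\<^sub>v a)"
      using \<tau> p y by (simp add: assoc_mult_mat_vec[of _ k k _ n])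
    also have "\<dots> = a"
      using \<tau> a by (simp add: assoc_mult_mat_vec[symmetric, of _ k k _ k])
    finally show ?thesis using y by blast
  qed
  then have "carrier_vec k \<subseteq> (\<lambda>y. (\<tau> * p) *\<^sub>v y) ` carrier_vec n"
    by (metis image_eqI subsetI)
  moreover have "(\<lambda>y. (\<tau> * p) *\<^sub>v y) ` carrier_vec n \<subseteq> carrier_vec k"
    using \<tau> p by auto
  ultimately show ?thesis using \<tau> p unfolding surj_mat_def by auto
qed

lemma gx_triple_name_transport:
  assumes t: "(f, \<psi>, p) \<in> gx_triples m n"
    and \<tau>: "\<tau> \<in> carrier_mat (dim_row p) (dim_row p)" "invertible_mat \<tau>"
  shows "gx_triple_name (\<tau> * f, push \<tau> \<psi>, \<tau> * p) = gx_triple_name (f, \<psi>, p)"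
proof -
  obtain k where k: "f \<in> carrier_mat k m" "p \<in> carrier_mat k n" "surj_mat p"
    and sp: "space \<psi> = carrier_vec k" and se: "sets \<psi> = sets (borel_vec k)"
    using t by (auto simp: gx_triples_def gaussian_def gaussian_with_def)
  have dr: "dim_row p = k" using k by auto
  have \<tau>k: "\<tau> \<in> carrier_mat k k" using \<tau> dr by simp
  obtain \<tau>' where \<tau>': "\<tau>' \<in> carrier_mat k k" "\<tau> * \<tau>' = 1\<^sub>m k" "\<tau>' * \<tau> = 1\<^sub>m k"
  proof -
    obtain B where B: "\<tau> * B = 1\<^sub>m k" "B * \<tau> = 1\<^sub>m (dim_row B)"
      using \<tau>(2) \<tau>k unfolding invertible_mat_def inverts_mat_def by auto
    have "dim_col B = k" using arg_cong[OF B(1), of dim_col] by simp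
    moreover have "dim_row B = k" using arg_cong[OF B(2), of dim_col] \<tau>k by simp
    ultimately show ?thesis using that[of B] B by auto
  qed
  let ?T = "\<lambda>v. \<tau> *\<^sub>v v" and ?T' = "\<lambda>v. \<tau>' *\<^sub>v v"
  have mT: "?T \<in> measurable \<psi> (borel_vec k)"
    using measurable_mult_mat_vec[OF \<tau>k] se by (metis measurable_cong_sets)
  have mT': "?T' \<in> measurable (borel_vec k) (borel_vec k)"
    by (rule measurable_mult_mat_vec[OF \<tau>'(1)])
  have TT': "?T (?T' v) = v" "?T' (?T v) = v" if "v \<in> carrier_vec k" for v
    using that \<tau>k \<tau>' by (simp_all add: assoc_mult_mat_vec[symmetric, of _ k k _ k])
  have pu: "push \<tau> \<psi> = distr \<psi> (borel_vec k) ?T" using \<tau>k by (simp add: push_def)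
  have ev: "name_event (\<tau> * f) (\<tau> * p) A = name_event f p (?T -` A \<inter> space \<psi>)" for A
  proof -
    have "(\<tau> * p) *\<^sub>v y - (\<tau> * f) *\<^sub>v x = ?T (p *\<^sub>v y - f *\<^sub>v x)"
      if "x \<in> carrier_vec m" "y \<in> carrier_vec n" for x y
      using that k \<tau>k
      by (simp add: assoc_mult_mat_vec[of _ k k _ m] assoc_mult_mat_vec[of _ k k _ n]
          mult_minus_distrib_mat_vec[of _ k k])
    then have *: "(\<tau> * p) *\<^sub>v y - (\<tau> * f) *\<^sub>v x \<in> A \<longleftrightarrow>
        p *\<^sub>v y - f *\<^sub>v x \<in> ?T -` A \<inter> space \<psi>"
      if "x \<in> carrier_vec m" "y \<in> carrier_vec n" for x y
      using that k by (simp add: sp)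
    have d: "dim_col f = m" "dim_col p = n" "dim_col (\<tau> * f) = m" "dim_col (\<tau> * p) = n"
      using k by auto
    show ?thesis unfolding name_event_def d using * by blast
  qed
  have h: "name_map (\<tau> * f) (\<tau> * p) ` carrier_vec (dim_col (\<tau> * f) + dim_col (\<tau> * p)) =
      space (push \<tau> \<psi>)"
    unfolding pu using name_map_surj[of "\<tau> * f" k m "\<tau> * p" n] k \<tau>k
      surj_mat_mult_invertible[OF \<tau>k \<tau>'(1,2) k(2,3)] by simp
  note C = carry_system[OF h, of "name_event (\<tau> * f) (\<tau> * p)", OF name_event_eq,
      folded gx_triple_name.simps]
  note D = gx_triple_name[OF t]
  have img: "(\<lambda>A. ?T -` A \<inter> space \<psi>) ` sets (borel_vec k) = sets \<psi>"
  proof (intro equalityI subsetI)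
    fix B assume B: "B \<in> sets \<psi>"
    then have Bs: "B \<subseteq> carrier_vec k" using sets.sets_into_space sp by blast
    have "?T' -` B \<inter> carrier_vec k \<in> sets (borel_vec k)"
      using measurable_sets[OF mT'] B se by simp
    moreover have "?T -` (?T' -` B \<inter> carrier_vec k) \<inter> space \<psi> = B"
      using Bs TT' \<tau>k by (auto simp: sp)
    ultimately show "B \<in> (\<lambda>A. ?T -` A \<inter> space \<psi>) ` sets (borel_vec k)" by (metis imageI)
  qed (use measurable_sets[OF mT] in auto)
  show ?thesis
  proof (rule measure_eqI)
    show S: "sets (gx_triple_name (\<tau> * f, push \<tau> \<psi>, \<tau> * p)) = sets (gx_triple_name (f, \<psi>, p))"
      unfolding C(2) D(2) img[symmetric] by (auto simp: pu ev image_image)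
    fix E assume "E \<in> sets (gx_triple_name (\<tau> * f, push \<tau> \<psi>, \<tau> * p))"
    then obtain A where A: "A \<in> sets (borel_vec k)" "E = name_event (\<tau> * f) (\<tau> * p) A"
      unfolding C(2) by (auto simp: pu)
    have "emeasure (gx_triple_name (\<tau> * f, push \<tau> \<psi>, \<tau> * p)) E = emeasure (push \<tau> \<psi>) A"
      unfolding A(2) by (rule C(3)) (simp add: pu A)
    also have "\<dots> = emeasure \<psi> (?T -` A \<inter> space \<psi>)"
      unfolding pu by (rule emeasure_distr[OF mT A(1)])
    also have "\<dots> = emeasure (gx_triple_name (f, \<psi>, p)) E"
      unfolding A(2) ev by (rule D(3)[symmetric]) (rule measurable_sets[OF mT A(1)])
    finally show "emeasure (gx_triple_name (\<tau> * f, push \<tau> \<psi>, \<tau> * p)) E =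
      emeasure (gx_triple_name (f, \<psi>, p)) E" .
  qed
qed

lemma gx_name_eq:
  assumes F: "F \<in> gx_hom m n" and t: "t \<in> F"
  shows "gx_name F = gx_triple_name t"
proof -
  obtain f \<psi> p where 0: "(f, \<psi>, p) \<in> gx_triples m n" and F': "F = gx_rel `` {(f, \<psi>, p)}"
    using F unfolding gx_hom_def quotient_def by auto
  have "gx_triple_name s = gx_triple_name (f, \<psi>, p)" if "s \<in> F" for s
    using that gx_triple_name_transport[OF 0] unfolding F' gx_rel_def by auto
  then show ?thesis
    unfolding gx_name_def using t someI[of "\<lambda>t. t \<in> F"] by metis
qed

definition vec_times :: "rvec set \<Rightarrow> rvec set \<Rightarrow> rvec set" where
  "vec_times A B = {a @\<^sub>v b | a b. a \<in> A \<and> b \<in> B}"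

text \<open>From \<open>(X \<times> Y, \<E>, P)\<close> to \<open>(X \<times> Y \<times> Z, {E \<times> Z | E \<in> \<E>}, P')\<close> with \<open>Z = \<real>\<^sup>n\<close>, and from
  \<open>(Y \<times> Z, \<F>, Q)\<close> to \<open>(X \<times> Y \<times> Z, {X \<times> F | F \<in> \<F>}, Q')\<close> with \<open>X = \<real>\<^sup>l\<close>.\<close>

definition weaken_right :: "nat \<Rightarrow> rvec measure \<Rightarrow> rvec measure" where
  "weaken_right n P = carry_system (vec_times (space P) (carrier_vec n))
     (\<lambda>E. vec_times E (carrier_vec n)) P"

definition weaken_left :: "nat \<Rightarrow> rvec measure \<Rightarrow> rvec measure" where
  "weaken_left l Q = carry_system (vec_times (carrier_vec l) (space Q))
     (\<lambda>F. vec_times (carrier_vec l) F) Q"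

lemma weaken_right:
  assumes P: "space P = carrier_vec k"
  shows space_weaken_right: "space (weaken_right n P) = carrier_vec (k + n)"
    and sets_weaken_right:
      "sets (weaken_right n P) = (\<lambda>E. vec_times E (carrier_vec n)) ` sets P"
    and emeasure_weaken_right: "E \<in> sets P \<Longrightarrow>
      emeasure (weaken_right n P) (vec_times E (carrier_vec n)) = emeasure P E"
proof -
  let ?h = "\<lambda>v :: rvec. vec_first v k"
  have ev: "vec_times E (carrier_vec n) = ?h -` E \<inter> carrier_vec (k + n)"
    if E: "E \<subseteq> carrier_vec k" for E
  proof (intro equalityI subsetI)
    fix v assume "v \<in> vec_times E (carrier_vec n)"
    then obtain a b where v: "v = a @\<^sub>v b" "a \<in> E" "b \<in> carrier_vec n"
      unfolding vec_times_def by blast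
    then have a: "a \<in> carrier_vec k" using E by blast
    show "v \<in> ?h -` E \<inter> carrier_vec (k + n)"
      using v(2,3) a unfolding v(1) by (simp add: vec_first_append)
  next
    fix v assume v: "v \<in> ?h -` E \<inter> carrier_vec (k + n)"
    then have "v = vec_first v k @\<^sub>v vec_last v n" by simp
    then show "v \<in> vec_times E (carrier_vec n)"
      using v vec_last_carrier unfolding vec_times_def by blast
  qed
  have S: "vec_times (space P) (carrier_vec n) = carrier_vec (k + n)"
    unfolding P by (subst ev) auto
  have h: "?h ` carrier_vec (k + n) = space P"
  proof (intro equalityI subsetI)
    fix a assume "a \<in> space P"
    then have a: "a \<in> carrier_vec k" by (simp add: P)
    show "a \<in> ?h ` carrier_vec (k + n)"
      by (rule image_eqI[of _ _ "a @\<^sub>v 0\<^sub>v n"]) (use a in \<open>simp_all add: vec_first_append\<close>)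
  qed (auto simp: P)
  note * = carry_system[OF h, of "\<lambda>E. vec_times E (carrier_vec n)",
      OF ev[OF sets.sets_into_space[of _ P, unfolded P]], folded S, folded weaken_right_def]
  show "space (weaken_right n P) = carrier_vec (k + n)"
    "sets (weaken_right n P) = (\<lambda>E. vec_times E (carrier_vec n)) ` sets P"
    "E \<in> sets P \<Longrightarrow> emeasure (weaken_right n P) (vec_times E (carrier_vec n)) = emeasure P E"
    using * S by auto
qed

lemma weaken_left:
  assumes Q: "space Q = carrier_vec k"
  shows space_weaken_left: "space (weaken_left l Q) = carrier_vec (l + k)"
    and sets_weaken_left: "sets (weaken_left l Q) = vec_times (carrier_vec l) ` sets Q"
    and emeasure_weaken_left: "E \<in> sets Q \<Longrightarrow>
      emeasure (weaken_left l Q) (vec_times (carrier_vec l) E) = emeasure Q E"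
proof -
  let ?h = "\<lambda>v :: rvec. vec_last v k"
  have ev: "vec_times (carrier_vec l) E = ?h -` E \<inter> carrier_vec (l + k)"
    if E: "E \<subseteq> carrier_vec k" for E
  proof (intro equalityI subsetI)
    fix v assume "v \<in> vec_times (carrier_vec l) E"
    then obtain a b where v: "v = a @\<^sub>v b" "a \<in> carrier_vec l" "b \<in> E"
      unfolding vec_times_def by blast
    then have b: "b \<in> carrier_vec k" using E by blast
    show "v \<in> ?h -` E \<inter> carrier_vec (l + k)"
      using v(2,3) b unfolding v(1) by (simp add: vec_last_append)
  next
    fix v assume v: "v \<in> ?h -` E \<inter> carrier_vec (l + k)"
    then have "v = vec_first v l @\<^sub>v vec_last v k" by simp
    then show "v \<in> vec_times (carrier_vec l) E"
      using v vec_first_carrier unfolding vec_times_def by blast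
  qed
  have S: "vec_times (carrier_vec l) (space Q) = carrier_vec (l + k)"
    unfolding Q by (subst ev) auto
  have h: "?h ` carrier_vec (l + k) = space Q"
  proof (intro equalityI subsetI)
    fix a assume "a \<in> space Q"
    then have a: "a \<in> carrier_vec k" by (simp add: Q)
    show "a \<in> ?h ` carrier_vec (l + k)"
      by (rule image_eqI[of _ _ "0\<^sub>v l @\<^sub>v a"]) (use a in \<open>simp_all add: vec_last_append\<close>)
  qed (auto simp: Q)
  note * = carry_system[OF h, of "vec_times (carrier_vec l)",
      OF ev[OF sets.sets_into_space[of _ Q, unfolded Q]], folded S, folded weaken_left_def]
  show "space (weaken_left l Q) = carrier_vec (l + k)"
    "sets (weaken_left l Q) = vec_times (carrier_vec l) ` sets Q"
    "E \<in> sets Q \<Longrightarrow> emeasure (weaken_left l Q) (vec_times (carrier_vec l) E) = emeasure Q E"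
    using * S by auto
qed

text \<open>The quantification is over nonempty events: with empty events admitted,
  \<open>{} \<inter> S = {} \<inter> {}\<close> would make the condition fail on every nonempty \<open>S\<close>.\<close>

definition complementary :: "'a measure \<Rightarrow> 'a measure \<Rightarrow> bool" where
  "complementary P\<^sub>1 P\<^sub>2 \<longleftrightarrow> space P\<^sub>1 = space P\<^sub>2 \<and>
     (\<forall>E\<^sub>1\<in>sets P\<^sub>1 - {{}}. \<forall>E\<^sub>1'\<in>sets P\<^sub>1 - {{}}. \<forall>E\<^sub>2\<in>sets P\<^sub>2 - {{}}. \<forall>E\<^sub>2'\<in>sets P\<^sub>2 - {{}}.
        E\<^sub>1 \<inter> E\<^sub>2 = E\<^sub>1' \<inter> E\<^sub>2' \<longrightarrow> E\<^sub>1 = E\<^sub>1' \<and> E\<^sub>2 = E\<^sub>2')"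

definition is_interconnection :: "'a measure \<Rightarrow> 'a measure \<Rightarrow> 'a measure \<Rightarrow> bool" where
  "is_interconnection P\<^sub>1 P\<^sub>2 R \<longleftrightarrow>
     prob_space R \<and> space R = space P\<^sub>1 \<and>
     sets R = sigma_sets (space P\<^sub>1) {E\<^sub>1 \<inter> E\<^sub>2 | E\<^sub>1 E\<^sub>2. E\<^sub>1 \<in> sets P\<^sub>1 \<and> E\<^sub>2 \<in> sets P\<^sub>2} \<and>
     (\<forall>E\<^sub>1\<in>sets P\<^sub>1. \<forall>E\<^sub>2\<in>sets P\<^sub>2. emeasure R (E\<^sub>1 \<inter> E\<^sub>2) = emeasure P\<^sub>1 E\<^sub>1 * emeasure P\<^sub>2 E\<^sub>2)"

lemma is_interconnection_unique:
  assumes sp: "space P\<^sub>1 = space P\<^sub>2"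
    and R: "is_interconnection P\<^sub>1 P\<^sub>2 R" and R': "is_interconnection P\<^sub>1 P\<^sub>2 R'"
  shows "R = R'"
proof -
  let ?G = "{E\<^sub>1 \<inter> E\<^sub>2 | E\<^sub>1 E\<^sub>2. E\<^sub>1 \<in> sets P\<^sub>1 \<and> E\<^sub>2 \<in> sets P\<^sub>2}"
  interpret R: prob_space R using R by (simp add: is_interconnection_def)
  have G: "?G \<subseteq> Pow (space P\<^sub>1)" using sets.sets_into_space by fastforce
  have S: "space P\<^sub>1 \<in> ?G"
    using sets.top[of P\<^sub>1] sets.top[of P\<^sub>2] sp by (metis (mono_tags, lifting) Int_absorb mem_Collect_eq)
  show ?thesis
  proof (rule measure_eqI_generator_eq[of ?G "space P\<^sub>1" R R' "\<lambda>_. space P\<^sub>1"])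
    show "Int_stable ?G"
    proof (rule Int_stableI)
      fix a b assume "a \<in> ?G" "b \<in> ?G"
      then obtain A1 A2 B1 B2 where
        ab: "a = A1 \<inter> A2" "b = B1 \<inter> B2" "A1 \<in> sets P\<^sub>1" "B1 \<in> sets P\<^sub>1" "A2 \<in> sets P\<^sub>2" "B2 \<in> sets P\<^sub>2"
        by blast
      have "a \<inter> b = (A1 \<inter> B1) \<inter> (A2 \<inter> B2)" using ab by blast
      then show "a \<inter> b \<in> ?G" using ab by blast
    qed
    show "emeasure R X = emeasure R' X" if "X \<in> ?G" for X
      using that R R' unfolding is_interconnection_def by force
  qed (use G S R R' in \<open>auto simp: is_interconnection_def\<close>)
qed

definition interconnection :: "'a measure \<Rightarrow> 'a measure \<Rightarrow> 'a measure" where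
  "interconnection P\<^sub>1 P\<^sub>2 = (THE R. is_interconnection P\<^sub>1 P\<^sub>2 R)"

lemma interconnection_eqI:
  assumes "space P\<^sub>1 = space P\<^sub>2" "is_interconnection P\<^sub>1 P\<^sub>2 R"
  shows "interconnection P\<^sub>1 P\<^sub>2 = R"
  unfolding interconnection_def
  using assms is_interconnection_unique by (blast intro: the_equality)

definition cylinder :: "nat \<Rightarrow> nat \<Rightarrow> nat \<Rightarrow> rvec set \<Rightarrow> rvec set" where
  "cylinder l m n H = {x @\<^sub>v y @\<^sub>v z | x y z.
     x \<in> carrier_vec l \<and> y \<in> carrier_vec m \<and> z \<in> carrier_vec n \<and> x @\<^sub>v z \<in> H}"

definition eliminate :: "nat \<Rightarrow> nat \<Rightarrow> nat \<Rightarrow> rvec measure \<Rightarrow> rvec measure" where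
  "eliminate l m n R = measure_of (carrier_vec (l + n))
     {H. H \<subseteq> carrier_vec (l + n) \<and> cylinder l m n H \<in> sets R}
     (\<lambda>H. emeasure R (cylinder l m n H))"

lemma eliminate:
  assumes R: "space R = carrier_vec (l + m + n)"
  shows space_eliminate: "space (eliminate l m n R) = carrier_vec (l + n)"
    and sets_eliminate: "sets (eliminate l m n R) =
      {H. H \<subseteq> carrier_vec (l + n) \<and> cylinder l m n H \<in> sets R}"
    and emeasure_eliminate: "H \<in> sets (eliminate l m n R) \<Longrightarrow>
      emeasure (eliminate l m n R) H = emeasure R (cylinder l m n H)"
proof -
  let ?S = "carrier_vec (l + n) :: rvec set" and ?c = "cylinder l m n"
  let ?H = "{H. H \<subseteq> ?S \<and> ?c H \<in> sets R}"
  define pr where "pr v = vec_first v l @\<^sub>v vec_last v n" for v :: rvec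
  have pr: "pr (x @\<^sub>v y @\<^sub>v z) = x @\<^sub>v z"
    if "x \<in> carrier_vec l" "y \<in> carrier_vec m" "z \<in> carrier_vec n" for x y z
    using vec_first_append[OF that(1), of "y @\<^sub>v z"] vec_last_append[OF that(3), of "x @\<^sub>v y"]
    unfolding pr_def by (simp add: append_vec_assoc)
  have c: "?c H = pr -` H \<inter> space R" for H
  proof (intro Set.set_eqI iffI)
    fix v assume "v \<in> ?c H"
    then show "v \<in> pr -` H \<inter> space R"
      unfolding cylinder_def R by (auto simp: pr add.assoc)
  next
    fix v assume v: "v \<in> pr -` H \<inter> space R"
    then have "v = vec_first v l @\<^sub>v vec_last v (m + n)" by (simp add: R add.assoc)
    also have "vec_last v (m + n) =
        vec_first (vec_last v (m + n)) m @\<^sub>v vec_last (vec_last v (m + n)) n" by simp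
    finally obtain x y z where e: "v = x @\<^sub>v y @\<^sub>v z"
      "x \<in> carrier_vec l" "y \<in> carrier_vec m" "z \<in> carrier_vec n"
      using vec_first_carrier vec_last_carrier by blast
    have "x @\<^sub>v z \<in> H" using v pr[OF e(2-4)] unfolding e(1) by simp
    then show "v \<in> ?c H" using e unfolding cylinder_def by blast
  qed
  have prS: "pr \<in> space R \<rightarrow> ?S" by (auto simp: pr_def)
  have sa: "sigma_algebra ?S ?H"
  proof (rule sigma_algebra_iff2[THEN iffD2], intro conjI ballI allI impI)
    show "{} \<in> ?H" by (simp add: c)
    fix H assume H: "H \<in> ?H"
    have "?c (?S - H) = space R - ?c H" using prS by (auto simp: c)
    then show "?S - H \<in> ?H" using H by auto
  next
    fix H :: "nat \<Rightarrow> rvec set" assume H: "range H \<subseteq> ?H"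
    have "?c (\<Union>i. H i) = (\<Union>i. ?c (H i))" by (auto simp: c)
    moreover have "(\<Union>i. ?c (H i)) \<in> sets R" using H by (intro sets.countable_UN) auto
    ultimately show "(\<Union>i. H i) \<in> ?H" using H by auto
  qed auto
  show "space (eliminate l m n R) = ?S"
    unfolding eliminate_def by (rule space_measure_of) auto
  show s: "sets (eliminate l m n R) = ?H"
    unfolding eliminate_def using sa by (subst sets_measure_of) (auto simp: sigma_algebra.sigma_sets_eq)
  have ca: "countably_additive ?H (\<lambda>H. emeasure R (?c H))"
  proof (rule countably_additiveI)
    fix H :: "nat \<Rightarrow> rvec set" assume H: "range H \<subseteq> ?H" and d: "disjoint_family H"
    have "(\<Sum>i. emeasure R (?c (H i))) = emeasure R (\<Union>i. ?c (H i))"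
    proof (rule suminf_emeasure)
      show "range (\<lambda>i. ?c (H i)) \<subseteq> sets R" using H by auto
      show "disjoint_family (\<lambda>i. ?c (H i))"
        using d unfolding disjoint_family_on_def c by blast
    qed
    also have "(\<Union>i. ?c (H i)) = ?c (\<Union>i. H i)" by (auto simp: c)
    finally show "(\<Sum>i. emeasure R (?c (H i))) = emeasure R (?c (\<Union>i. H i))" .
  qed
  show "emeasure (eliminate l m n R) H = emeasure R (?c H)" if "H \<in> sets (eliminate l m n R)"
    unfolding eliminate_def
    by (rule emeasure_measure_of_sigma[OF sa _ ca]) (use that s in \<open>auto simp: positive_def c\<close>)
qed

end

theory Submission
  imports Defs
begin

text \<open>
  The name of \<open>(f, \<psi>, p)\<close> is the pullback of \<open>\<psi>\<close> along the surjection \<open>(x, y) \<mapsto> p y - f x\<close>, and its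
  weakening is the pullback along the same map with a further coordinate ignored. The two weakened
  systems are thus pullbacks along \<open>(x, y, z) \<mapsto> p y - f x\<close> and \<open>(x, y, z) \<mapsto> q z - g y\<close>. Since \<open>p\<close> and
  \<open>q\<close> are onto, these maps are jointly onto; this yields complementarity, and the interconnection is
  the pullback of \<open>\<psi> \<otimes> \<chi>\<close> along the pair of them. For the composite with copying, suitable pushouts
  give the representative with apex \<open>P \<times> Q\<close> whose name is that same pullback.

  Eliminating \<open>y\<close> keeps the events that are invariant under all \<open>(p y, - g y)\<close>. These vectors form the
  kernel of the map from \<open>P \<times> Q\<close> onto the pushout of \<open>p\<close> and \<open>g\<close>, and that map has a linear section,
  so the remaining events are the preimages of Borel sets of the pushout, on which the measure is
  that of the composite.
\<close>

section \<open>Matrices\<close>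

text \<open>The operations on morphisms are unions over all representatives and, for composition,
  over all pushouts. A composite can be computed from one convenient choice only once every other
  choice is known to give the same class. For this, two pushouts of one span must differ by an
  invertible square matrix, and that matrix must act on all three components of the composite triple
  at once. The noise of a composite is therefore rewritten from a convolution into the pushforward
  of a product measure under one block matrix.

  Systems are compared through \<open>presents\<close>: a matrix and a noise measure determine a
  system, so each equality of systems becomes an equality of matrices and of measures.

  The delicate point is measurability. The image of a Borel set under a linear map need not be
  Borel, so events are never carried forward along the quotient maps. They are pulled back along
  linear sections instead, and this is why right inverses and sections accompany every surjection
  and every cokernel below.\<close>

definition append_cols :: "rmat \<Rightarrow> rmat \<Rightarrow> rmat" (infixr \<open>@\<^sub>c\<close> 66) where
  "A @\<^sub>c B = Matrix.mat (dim_row A) (dim_col A + dim_col B)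
     (\<lambda>(i, j). if j < dim_col A then A $$ (i, j) else B $$ (i, j - dim_col A))"

lemma dim_append_cols [simp]:
  "dim_row (A @\<^sub>c B) = dim_row A" "dim_col (A @\<^sub>c B) = dim_col A + dim_col B"
  by (simp_all add: append_cols_def)

lemma dim_append_rows [simp]:
  "dim_row (A @\<^sub>r B) = dim_row A + dim_row B" "dim_col (A @\<^sub>r B) = dim_col A"
  by (simp_all add: append_rows_def)

lemma dim_prod_mat [simp]:
  "dim_row (prod_mat A B) = dim_row A + dim_row B"
  "dim_col (prod_mat A B) = dim_col A + dim_col B"
  by (simp_all add: prod_mat_def)

lemma scalar_prod_append':
  fixes v\<^sub>1 v\<^sub>2 :: rvec
  assumes "dim_vec v\<^sub>1 = dim_vec w\<^sub>1" "dim_vec v\<^sub>2 = dim_vec w\<^sub>2"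
  shows "(v\<^sub>1 @\<^sub>v v\<^sub>2) \<bullet> (w\<^sub>1 @\<^sub>v w\<^sub>2) = v\<^sub>1 \<bullet> w\<^sub>1 + v\<^sub>2 \<bullet> w\<^sub>2"
  by (rule scalar_prod_append[of _ "dim_vec w\<^sub>1" _ "dim_vec w\<^sub>2"])
     (use assms in \<open>auto intro: carrier_vecI\<close>)

lemma append_cols_mult_vec:
  assumes "dim_vec x = dim_col A" "dim_vec y = dim_col B" "dim_row B = dim_row A"
  shows "(A @\<^sub>c B) *\<^sub>v (x @\<^sub>v y) = A *\<^sub>v x + B *\<^sub>v y"
proof (rule eq_vecI)
  fix i assume "i < dim_vec (A *\<^sub>v x + B *\<^sub>v y)"
  then have i: "i < dim_row A" using assms by simp
  have "Matrix.row (A @\<^sub>c B) i = Matrix.row A i @\<^sub>v Matrix.row B i"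
    by (rule eq_vecI) (use i assms in \<open>simp_all add: Matrix.row_def append_cols_def\<close>)
  then show "((A @\<^sub>c B) *\<^sub>v (x @\<^sub>v y)) $ i = (A *\<^sub>v x + B *\<^sub>v y) $ i"
    using i assms by (simp add: scalar_prod_append')
qed (use assms in simp)

lemma append_rows_mult_vec:
  fixes A B :: rmat
  assumes "dim_vec x = dim_col A" "dim_col B = dim_col A"
  shows "(A @\<^sub>r B) *\<^sub>v x = (A *\<^sub>v x) @\<^sub>v (B *\<^sub>v x)"
  by (rule mat_mult_append[of _ "dim_row A" "dim_col A" _ "dim_row B"])
     (use assms in \<open>auto intro: carrier_matI carrier_vecI\<close>)

lemma mult_mat_mult_vec:
  fixes A B :: rmat
  assumes "dim_col A = dim_row B" "dim_vec x = dim_col B"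
  shows "(A * B) *\<^sub>v x = A *\<^sub>v (B *\<^sub>v x)"
  by (rule assoc_mult_mat_vec[of _ "dim_row A" "dim_row B" _ "dim_col B"])
     (use assms in \<open>auto intro: carrier_matI carrier_vecI\<close>)

lemma mult_mat_vec_add:
  fixes A :: rmat
  assumes "dim_vec x = dim_col A" "dim_vec y = dim_col A"
  shows "A *\<^sub>v (x + y) = A *\<^sub>v x + A *\<^sub>v y"
  by (rule mult_add_distrib_mat_vec[of _ "dim_row A" "dim_col A"])
     (use assms in \<open>auto intro: carrier_matI carrier_vecI\<close>)

lemma mult_mat_vec_diff:
  fixes A :: rmat
  assumes "dim_vec x = dim_col A" "dim_vec y = dim_col A"
  shows "A *\<^sub>v (x - y) = A *\<^sub>v x - A *\<^sub>v y"
  by (rule mult_minus_distrib_mat_vec[of _ "dim_row A" "dim_col A"])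
     (use assms in \<open>auto intro: carrier_matI carrier_vecI\<close>)

lemma mult_mat_vec_uminus:
  fixes A :: rmat
  assumes "dim_vec x = dim_col A"
  shows "A *\<^sub>v (- x) = - (A *\<^sub>v x)"
  by (rule eq_vecI) (use assms in \<open>auto simp: scalar_prod_def sum_negf\<close>)

lemma mult_mat_vec_smult:
  fixes A :: rmat
  assumes "dim_vec x = dim_col A"
  shows "A *\<^sub>v (a \<cdot>\<^sub>v x) = a \<cdot>\<^sub>v (A *\<^sub>v x)"
  by (rule mult_mat_vec[of _ "dim_row A" "dim_col A"])
     (use assms in \<open>auto intro: carrier_matI carrier_vecI\<close>)

lemma mult_mat_vec_zero [simp]: "(A :: rmat) *\<^sub>v 0\<^sub>v (dim_col A) = 0\<^sub>v (dim_row A)"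
  by (rule eq_vecI) auto

lemma zero_mat_mult_vec:
  "dim_vec x = c \<Longrightarrow> 0\<^sub>m r c *\<^sub>v x = (0\<^sub>v r :: rvec)"
  by (rule eq_vecI) (auto simp: scalar_prod_def)

lemma one_mat_mult_vec: "dim_vec x = n \<Longrightarrow> 1\<^sub>m n *\<^sub>v x = (x :: rvec)"
  by (rule one_mult_mat_vec) (rule carrier_vecI)

lemma prod_mat_mult_vec':
  assumes "dim_vec x = dim_col A" "dim_vec y = dim_col B"
  shows "prod_mat A B *\<^sub>v (x @\<^sub>v y) = (A *\<^sub>v x) @\<^sub>v (B *\<^sub>v y)"
  by (rule prod_mat_mult_vec) (use assms in \<open>auto intro: carrier_vecI\<close>)

lemma append_vec_add':
  fixes x y :: rvec
  assumes "dim_vec x = dim_vec x'" "dim_vec y = dim_vec y'"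
  shows "(x @\<^sub>v y) + (x' @\<^sub>v y') = (x + x') @\<^sub>v (y + y')"
  by (rule eq_vecI) (use assms in auto)

lemma append_vec_diff:
  fixes x y :: rvec
  assumes "dim_vec x = dim_vec x'" "dim_vec y = dim_vec y'"
  shows "(x @\<^sub>v y) - (x' @\<^sub>v y') = (x - x') @\<^sub>v (y - y')"
  by (rule eq_vecI) (use assms in auto)

lemma append_vec_uminus: "- (x @\<^sub>v y) = - x @\<^sub>v - (y :: rvec)"
  by (rule eq_vecI) auto

lemma append_vec_eq_iff:
  fixes x y :: rvec
  assumes "dim_vec x = dim_vec x'"
  shows "x @\<^sub>v y = x' @\<^sub>v y' \<longleftrightarrow> x = x' \<and> y = y'"
  by (rule append_vec_eq[of _ "dim_vec x'"]) (use assms in \<open>auto intro: carrier_vecI\<close>)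

lemma append_vec_zero: "(0\<^sub>v (m + n) :: rvec) = 0\<^sub>v m @\<^sub>v 0\<^sub>v n"
  by (rule eq_vecI) auto

lemma carrier_vec_appendE:
  assumes "v \<in> carrier_vec (m + n)"
  obtains x y where "v = x @\<^sub>v y" "dim_vec x = m" "dim_vec y = n"
  using assms vec_first_last_append[OF assms] dim_vec_first dim_vec_last by metis

text \<open>These rules push a block matrix through a concatenated vector until only actions of the
  given matrices remain. Their side conditions are equations between dimensions, which the
  simplifier can discharge; carrier memberships would leave dimensions to be guessed.\<close>

lemmas mat_action_simps =
  append_cols_mult_vec append_rows_mult_vec mult_mat_mult_vec mult_mat_vec_add mult_mat_vec_diff
  mult_mat_vec_uminus zero_mat_mult_vec one_mat_mult_vec prod_mat_mult_vec'
  append_vec_add' append_vec_diff append_vec_uminus append_vec_eq_iff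

text \<open>Columns are values on unit vectors. Together with \<open>mat_action_simps\<close> this
  replaces block multiplication and associativity by evaluation at a generic vector cut into
  blocks.\<close>

lemma mat_eq_by_action:
  fixes A B :: rmat
  assumes "dim_row A = dim_row B" "dim_col A = dim_col B"
    and "\<And>x. x \<in> carrier_vec (dim_col B) \<Longrightarrow> A *\<^sub>v x = B *\<^sub>v x"
  shows "A = B"
proof (rule mat_col_eqI)
  fix j assume j: "j < dim_col B"
  have "A *\<^sub>v unit_vec (dim_col B) j = B *\<^sub>v unit_vec (dim_col B) j"
    by (rule assms(3)) simp
  then show "Matrix.col A j = Matrix.col B j"
    using j assms(1,2)
    by (auto simp: vec_eq_iff scalar_prod_right_unit)
qed (use assms in auto)

lemma mat_mult_eqD:
  fixes A B D :: rmat
  assumes "A * B = D" "dim_col A = dim_row B" "dim_vec x = dim_col B"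
  shows "A *\<^sub>v (B *\<^sub>v x) = D *\<^sub>v x"
  using assms mult_mat_mult_vec by metis

text \<open>Evaluating at a vector with one block zero isolates the other matrix. This splits one
  equation for the map out of a product into the two equations that a pushout asks for.\<close>

lemma append_cols_inject:
  assumes "A @\<^sub>c B = A' @\<^sub>c B'" "dim_row B = dim_row A" "dim_row B' = dim_row A'"
    "dim_col A = dim_col A'"
  shows "A = A'" "B = B'"
proof -
  have d: "dim_row A = dim_row A'" "dim_col B = dim_col B'"
    using arg_cong[OF assms(1), of dim_row] arg_cong[OF assms(1), of dim_col] assms(4) by auto
  have e: "A *\<^sub>v x + B *\<^sub>v y = A' *\<^sub>v x + B' *\<^sub>v y"
    if "dim_vec x = dim_col A'" "dim_vec y = dim_col B'" for x y
    using append_cols_mult_vec[of x A y B] append_cols_mult_vec[of x A' y B'] that d assms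
    by simp
  show "A = A'"
  proof (rule mat_eq_by_action)
    fix x :: rvec assume x: "x \<in> carrier_vec (dim_col A')"
    show "A *\<^sub>v x = A' *\<^sub>v x"
      using e[of x "0\<^sub>v (dim_col B')"] x d assms mult_mat_vec_zero[of B] mult_mat_vec_zero[of B']
      by (simp add: left_zero_vec[OF carrier_vecI] right_zero_vec[OF carrier_vecI])
  qed (use d assms in auto)
  show "B = B'"
  proof (rule mat_eq_by_action)
    fix x :: rvec assume x: "x \<in> carrier_vec (dim_col B')"
    show "B *\<^sub>v x = B' *\<^sub>v x"
      using e[of "0\<^sub>v (dim_col A')" x] x d assms mult_mat_vec_zero[of A] mult_mat_vec_zero[of A']
      by (simp add: left_zero_vec[OF carrier_vecI] right_zero_vec[OF carrier_vecI])
  qed (use d assms in auto)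
qed

lemma mult_append_cols:
  assumes "dim_row A = dim_col U" "dim_row B = dim_col U"
  shows "U * (A @\<^sub>c B) = (U * A) @\<^sub>c (U * B)"
proof (rule mat_eq_by_action)
  fix x :: rvec assume "x \<in> carrier_vec (dim_col (U * A @\<^sub>c U * B))"
  then have "x \<in> carrier_vec (dim_col A + dim_col B)" by simp
  then show "(U * (A @\<^sub>c B)) *\<^sub>v x = (U * A @\<^sub>c U * B) *\<^sub>v x"
    by (rule carrier_vec_appendE) (simp add: mat_action_simps assms)
qed (use assms in auto)

text \<open>The columns of the right inverse are chosen preimages of the unit vectors. Such linear
  sections of \<open>p\<close> and \<open>q\<close> are what surjectivity is used for from here
  on.\<close>

lemma surj_mat_right_inverse:
  assumes p: "p \<in> carrier_mat k n" "surj_mat p"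
  obtains s where "s \<in> carrier_mat n k" "p * s = 1\<^sub>m k"
proof -
  have "\<exists>y\<in>carrier_vec n. p *\<^sub>v y = unit_vec k i" for i
    using p unfolding surj_mat_def by (metis carrier_matD image_iff unit_vec_carrier)
  then obtain y where y: "\<And>i. y i \<in> carrier_vec n" "\<And>i. p *\<^sub>v y i = unit_vec k i" by metis
  let ?s = "mat_of_cols n (map y [0..<k])"
  have s: "?s \<in> carrier_mat n k" by (rule carrier_matI) simp_all
  moreover have "p * ?s = 1\<^sub>m k"
  proof (rule mat_col_eqI)
    fix j assume "j < dim_col (1\<^sub>m k :: rmat)"
    then have j: "j < k" by simp
    have "Matrix.col (p * ?s) j = p *\<^sub>v Matrix.col ?s j"
      by (rule col_mult2[OF p(1) s j])
    then show "Matrix.col (p * ?s) j = Matrix.col (1\<^sub>m k) j"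
      using j y by simp
  qed (use p in auto)
  ultimately show thesis by (rule that)
qed

lemma surj_mat_if_right_inverse:
  assumes "p * s = 1\<^sub>m (dim_row p)" "dim_row s = dim_col p"
  shows "surj_mat p"
proof -
  have c: "dim_col s = dim_row p" using arg_cong[OF assms(1), of dim_col] by simp
  have "a \<in> (\<lambda>y. p *\<^sub>v y) ` carrier_vec (dim_col p)" if a: "a \<in> carrier_vec (dim_row p)" for a
  proof (rule image_eqI)
    show "a = p *\<^sub>v (s *\<^sub>v a)"
      using mat_mult_eqD[OF assms(1), of a] a assms c by (simp add: one_mat_mult_vec)
    show "s *\<^sub>v a \<in> carrier_vec (dim_col p)" by (rule carrier_vecI) (simp add: assms(2))
  qed
  then show ?thesis unfolding surj_mat_def by (auto intro: carrier_vecI)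
qed

section \<open>Cokernels of real matrices with linear sections\<close>

lemma vec_diff_eq_zeroD:
  fixes x y :: rvec
  assumes "x - y = 0\<^sub>v n" "dim_vec x = n" "dim_vec y = n"
  shows "x = y"
proof (rule eq_vecI)
  fix i assume "i < dim_vec y"
  then show "x $ i = y $ i" using arg_cong[OF assms(1), of "\<lambda>v. v $ i"] assms(2,3) by simp
qed (use assms in simp)

lemma vec_add_uminus_eq_zeroD:
  fixes x y :: rvec
  assumes "x + - y = 0\<^sub>v n" "dim_vec x = n" "dim_vec y = n"
  shows "x = y"
proof (rule eq_vecI)
  fix i assume "i < dim_vec y"
  then show "x $ i = y $ i" using arg_cong[OF assms(1), of "\<lambda>v. v $ i"] assms(2,3) by simp
qed (use assms in simp)

text \<open>Coordinates on the quotient by the line through \<open>c\<close>: choose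
  \<open>j\<close> with \<open>c $ j\<close> nonzero, subtract the multiple of \<open>c\<close> that
  clears coordinate \<open>j\<close>, then drop that coordinate. \<open>sk\<close> enumerates the
  remaining indices, and \<open>E\<close> reinserts a zero at \<open>j\<close>. A vector killed by
  \<open>D\<close> is the multiple of \<open>c\<close> with factor
  \<open>x $ j / c $ j\<close>.\<close>

lemma line_quotient:
  fixes c :: rvec
  assumes c: "c \<in> carrier_vec (Suc w)" "c \<noteq> 0\<^sub>v (Suc w)"
  obtains D E where "D \<in> carrier_mat w (Suc w)" "E \<in> carrier_mat (Suc w) w" "D * E = 1\<^sub>m w"
    "D *\<^sub>v c = 0\<^sub>v w"
    "\<And>x. x \<in> carrier_vec (Suc w) \<Longrightarrow> D *\<^sub>v x = 0\<^sub>v w \<Longrightarrow> \<exists>a. x = a \<cdot>\<^sub>v c"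
proof -
  obtain j where j: "j < Suc w" "c $ j \<noteq> 0"
    using c by (metis carrier_vecD eq_vecI index_zero_vec)
  define sk where "sk i = (if i < j then i else Suc i)" for i :: nat
  have sk: "sk i < Suc w" "sk i \<noteq> j" if "i < w" for i
    using that j by (auto simp: sk_def)
  have sk_inj: "sk i = sk i' \<longleftrightarrow> i = i'" for i i' by (auto simp: sk_def)
  have sk_surj: "\<exists>i<w. a = sk i" if "a < Suc w" "a \<noteq> j" for a
  proof (rule exI[of _ "if a < j then a else a - 1"])
    show "(if a < j then a else a - 1) < w \<and> a = sk (if a < j then a else a - 1)"
      using that j by (auto simp: sk_def)
  qed
  define D where "D = Matrix.mat w (Suc w)
    (\<lambda>(i, b). (if b = sk i then 1 else 0) - (if b = j then c $ sk i / c $ j else 0))"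
  define E where "E = Matrix.mat (Suc w) w (\<lambda>(a, b). if a = sk b then 1 else 0 :: real)"
  have D: "(D *\<^sub>v x) $ i = x $ sk i - c $ sk i / c $ j * x $ j"
    if x: "x \<in> carrier_vec (Suc w)" and i: "i < w" for x i
  proof -
    have "(D *\<^sub>v x) $ i = (\<Sum>b = 0..<Suc w. D $$ (i, b) * x $ b)"
      using x i by (simp add: D_def scalar_prod_def del: sum.op_ivl_Suc)
    also have "\<dots> = (\<Sum>b = 0..<Suc w.
        (if b = sk i then x $ b else 0) - (if b = j then c $ sk i / c $ j * x $ b else 0))"
      by (rule sum.cong) (use i sk[OF i] in \<open>auto simp: D_def left_diff_distrib\<close>)
    also have "\<dots> = x $ sk i - c $ sk i / c $ j * x $ j"
      using sk[OF i] j by (simp add: sum_subtractf del: sum.op_ivl_Suc)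
    finally show ?thesis .
  qed
  have dims: "D \<in> carrier_mat w (Suc w)" "E \<in> carrier_mat (Suc w) w"
    by (simp_all add: D_def E_def)
  moreover have "D * E = 1\<^sub>m w"
  proof (rule eq_matI)
    fix i b assume "i < dim_row (1\<^sub>m w :: rmat)" "b < dim_col (1\<^sub>m w :: rmat)"
    then have ib: "i < w" "b < w" by auto
    have "(D * E) $$ (i, b) = (D *\<^sub>v Matrix.col E b) $ i" using dims ib by simp
    also have "\<dots> = Matrix.col E b $ sk i - c $ sk i / c $ j * Matrix.col E b $ j"
      by (rule D) (use ib in \<open>simp_all add: E_def\<close>)
    also have "\<dots> = (1\<^sub>m w :: rmat) $$ (i, b)"
      using ib sk j sk_inj by (auto simp: E_def)
    finally show "(D * E) $$ (i, b) = (1\<^sub>m w :: rmat) $$ (i, b)" .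
  qed (use dims in auto)
  moreover have "D *\<^sub>v c = 0\<^sub>v w"
    by (rule eq_vecI) (use D c j dims in \<open>auto simp del: index_mult_mat_vec\<close>)
  moreover have "\<exists>a. x = a \<cdot>\<^sub>v c" if x: "x \<in> carrier_vec (Suc w)" and Dx: "D *\<^sub>v x = 0\<^sub>v w" for x
  proof (rule exI, rule eq_vecI)
    fix a assume "a < dim_vec ((x $ j / c $ j) \<cdot>\<^sub>v c)"
    then have a: "a < Suc w" using c by simp
    show "x $ a = ((x $ j / c $ j) \<cdot>\<^sub>v c) $ a"
    proof (cases "a = j")
      case False
      then obtain i where i: "i < w" "a = sk i" using sk_surj a by blast
      show ?thesis using D[OF x i(1)] i a c by (simp add: Dx)
    qed (use j c in simp)
  qed (use x c in simp)
  ultimately show thesis by (rule that)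
qed

text \<open>\<open>C\<close> is a cokernel of \<open>M\<close> with a chosen section \<open>S\<close>. The section is what makes preimages of Borel
  sets under \<open>C\<close> descend to Borel sets.\<close>

definition split_cokernel :: "rmat \<Rightarrow> rmat \<Rightarrow> rmat \<Rightarrow> bool" where
  "split_cokernel M C S \<longleftrightarrow>
     C \<in> carrier_mat (dim_row C) (dim_row M) \<and> S \<in> carrier_mat (dim_row M) (dim_row C) \<and>
     C * S = 1\<^sub>m (dim_row C) \<and> C * M = 0\<^sub>m (dim_row C) (dim_col M) \<and>
     (\<forall>x\<in>carrier_vec (dim_row M). C *\<^sub>v x = 0\<^sub>v (dim_row C) \<longrightarrow>
        (\<exists>y\<in>carrier_vec (dim_col M). x = M *\<^sub>v y))"

lemma split_cokernel_exists: "\<exists>C S. split_cokernel M C S"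
proof -
  define N m where "N = dim_row M" and "m = dim_col M"
  have M: "M \<in> carrier_mat N m" by (auto simp: N_def m_def)
  txt \<open>Starting from the identity, quotient by one column of \<open>C * M\<close> at a time until \<open>C * M\<close> vanishes;
    meanwhile the kernel of \<open>C\<close> stays within the range of \<open>M\<close>.\<close>
  have "\<exists>C S. split_cokernel M C S"
    if "C \<in> carrier_mat w N" "S \<in> carrier_mat N w" "C * S = 1\<^sub>m w"
      and "\<And>x. x \<in> carrier_vec N \<Longrightarrow> C *\<^sub>v x = 0\<^sub>v w \<Longrightarrow> \<exists>y\<in>carrier_vec m. x = M *\<^sub>v y"
    for w C S
    using that
  proof (induction w arbitrary: C S)
    case 0
    have "C * M = 0\<^sub>m 0 m" using 0 M by (intro eq_matI) auto
    then have "split_cokernel M C S"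
      using 0 M unfolding split_cokernel_def by auto
    then show ?case by blast
  next
    case (Suc w)
    note C = Suc.prems(1) and S = Suc.prems(2) and CS = Suc.prems(3) and ker = Suc.prems(4)
    show ?case
    proof (cases "C * M = 0\<^sub>m (Suc w) m")
      case True
      then have "split_cokernel M C S"
        using C S CS ker M unfolding split_cokernel_def by auto
      then show ?thesis by blast
    next
      case False
      then obtain e where e: "e \<in> carrier_vec m" "C *\<^sub>v (M *\<^sub>v e) \<noteq> 0\<^sub>v (Suc w)"
      proof -
        have "C * M = 0\<^sub>m (Suc w) m" if "\<forall>e\<in>carrier_vec m :: rvec set. C *\<^sub>v (M *\<^sub>v e) = 0\<^sub>v (Suc w)"
          by (rule mat_eq_by_action) (use that C M in \<open>auto simp: mat_action_simps\<close>)
        then show ?thesis using False that by blast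
      qed
      let ?c = "C *\<^sub>v (M *\<^sub>v e)"
      have c: "?c \<in> carrier_vec (Suc w)" using C M e by auto
      obtain D E where DE: "D \<in> carrier_mat w (Suc w)" "E \<in> carrier_mat (Suc w) w" "D * E = 1\<^sub>m w"
          "\<And>x. x \<in> carrier_vec (Suc w) \<Longrightarrow> D *\<^sub>v x = 0\<^sub>v w \<Longrightarrow> \<exists>a. x = a \<cdot>\<^sub>v ?c"
        by (rule line_quotient[OF c e(2)]) blast
      show ?thesis
      proof (rule Suc.IH)
        show "D * C \<in> carrier_mat w N" "S * E \<in> carrier_mat N w" using C S DE by auto
        show "D * C * (S * E) = 1\<^sub>m w"
          by (rule mat_eq_by_action)
             (use C S DE mat_mult_eqD[OF CS] mat_mult_eqD[OF DE(3)] in \<open>auto simp: mat_action_simps\<close>)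
        \<comment> \<open>The kernel condition survives the step: if \<open>D\<close> kills
          \<open>C *\<^sub>v x\<close>, then \<open>C *\<^sub>v x\<close> is a multiple of the image
          of \<open>M *\<^sub>v e\<close>, so correcting \<open>x\<close> by that multiple of
          \<open>M *\<^sub>v e\<close> puts it into the old kernel, hence into the range of
          \<open>M\<close>.\<close>
        fix x :: rvec assume x: "x \<in> carrier_vec N" "(D * C) *\<^sub>v x = 0\<^sub>v w"
        then have "D *\<^sub>v (C *\<^sub>v x) = 0\<^sub>v w" using C DE by (simp add: mat_action_simps)
        moreover have Cx: "C *\<^sub>v x \<in> carrier_vec (Suc w)" using C x by auto
        ultimately obtain a where a: "C *\<^sub>v x = a \<cdot>\<^sub>v ?c" using DE(4) by blast
        have "C *\<^sub>v (x - a \<cdot>\<^sub>v (M *\<^sub>v e)) = 0\<^sub>v (Suc w)"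
          using C x M e c by (simp add: mult_mat_vec_diff mult_mat_vec_smult a)
        moreover have "x - a \<cdot>\<^sub>v (M *\<^sub>v e) \<in> carrier_vec N" using x M e by auto
        ultimately obtain y where y: "y \<in> carrier_vec m" "x - a \<cdot>\<^sub>v (M *\<^sub>v e) = M *\<^sub>v y"
          using ker by blast
        have "x = (x - a \<cdot>\<^sub>v (M *\<^sub>v e)) + a \<cdot>\<^sub>v (M *\<^sub>v e)"
          by (rule eq_vecI) (use x M in auto)
        also have "\<dots> = M *\<^sub>v (y + a \<cdot>\<^sub>v e)"
          unfolding y(2) using y(1) e M by (simp add: mult_mat_vec_add mult_mat_vec_smult)
        finally show "\<exists>y\<in>carrier_vec m. x = M *\<^sub>v y"
          using y(1) e by (intro bexI[of _ "y + a \<cdot>\<^sub>v e"]) auto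
      qed
    qed
  qed
  moreover have "\<exists>y\<in>carrier_vec m. x = M *\<^sub>v y"
    if "x \<in> carrier_vec N" "1\<^sub>m N *\<^sub>v x = 0\<^sub>v N" for x
  proof (rule bexI[of _ "0\<^sub>v m"])
    show "x = M *\<^sub>v 0\<^sub>v m" using that mult_mat_vec_zero[of M] M by simp
  qed simp
  ultimately show ?thesis
    by (meson left_mult_one_mat one_carrier_mat)
qed

section \<open>Pushouts\<close>

text \<open>A pushout of \<open>p\<close> and \<open>g\<close> is a cokernel of the map taking y to
  (p y, - g y). A pair \<open>a\<close>, \<open>b\<close> with \<open>a * p = b * g\<close> is a map
  out of the product that vanishes on the range of this map, so it factors through the
  cokernel.\<close>

lemma is_pushout_of_split_cokernel:
  assumes i: "i\<^sub>1 \<in> carrier_mat w k" "i\<^sub>2 \<in> carrier_mat w k'"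
    and p: "p \<in> carrier_mat k m" and g: "g \<in> carrier_mat k' m"
    and coker: "split_cokernel (p @\<^sub>r (- g)) (i\<^sub>1 @\<^sub>c i\<^sub>2) S"
  shows "is_pushout p g i\<^sub>1 i\<^sub>2"
proof -
  let ?M = "p @\<^sub>r (- g)" and ?C = "i\<^sub>1 @\<^sub>c i\<^sub>2"
  have S: "S \<in> carrier_mat (k + k') w" and CS: "?C * S = 1\<^sub>m w" and CM: "?C * ?M = 0\<^sub>m w m"
    and ker: "\<And>x. x \<in> carrier_vec (k + k') \<Longrightarrow> ?C *\<^sub>v x = 0\<^sub>v w \<Longrightarrow> \<exists>y\<in>carrier_vec m. x = ?M *\<^sub>v y"
    using coker i p g unfolding split_cokernel_def by auto
  show ?thesis
    unfolding is_pushout_def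
  proof (intro exI[of _ w] conjI allI ballI impI)
    show "i\<^sub>1 * p = i\<^sub>2 * g"
    proof (rule mat_eq_by_action)
      fix y :: rvec assume "y \<in> carrier_vec (dim_col (i\<^sub>2 * g))"
      then have y: "dim_vec y = m" using g by simp
      have "i\<^sub>1 *\<^sub>v (p *\<^sub>v y) + - (i\<^sub>2 *\<^sub>v (g *\<^sub>v y)) = 0\<^sub>v w"
        using mat_mult_eqD[OF CM, of y] y i p g by (simp add: mat_action_simps)
      then have "i\<^sub>1 *\<^sub>v (p *\<^sub>v y) = i\<^sub>2 *\<^sub>v (g *\<^sub>v y)"
        by (rule vec_add_uminus_eq_zeroD) (use i in simp_all)
      then show "(i\<^sub>1 * p) *\<^sub>v y = (i\<^sub>2 * g) *\<^sub>v y"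
        using y i p g by (simp add: mat_action_simps)
    qed (use i p g in auto)
    fix v a b
    assume "a \<in> carrier_mat v (dim_row p)" "b \<in> carrier_mat v (dim_row g)" and ab: "a * p = b * g"
    then have a: "a \<in> carrier_mat v k" and b: "b \<in> carrier_mat v k'" using p g by auto
    \<comment> \<open>The only candidate: if \<open>u * ?C = a @\<^sub>c b\<close>, multiplying by
      the section on the right gives \<open>u\<close>.\<close>
    let ?u = "(a @\<^sub>c b) * S"
    have u: "?u \<in> carrier_mat v w" using a b S by auto
    have abM: "(a @\<^sub>c b) *\<^sub>v (?M *\<^sub>v y) = 0\<^sub>v v" if "y \<in> carrier_vec m" for y
    proof -
      have "a *\<^sub>v (p *\<^sub>v y) = b *\<^sub>v (g *\<^sub>v y)"
        using mat_mult_eqD[OF ab, of y] a b p g that by (simp add: mat_action_simps)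
      then show ?thesis using that a b p g by (simp add: mat_action_simps)
    qed
    have uC: "?u * ?C = a @\<^sub>c b"
    proof (rule mat_eq_by_action)
      fix x :: rvec assume "x \<in> carrier_vec (dim_col (a @\<^sub>c b))"
      then have x: "x \<in> carrier_vec (k + k')" using a b by simp
      \<comment> \<open>The defect of \<open>S\<close> as a left inverse lies in the kernel of
        \<open>?C\<close>, thus in the range of \<open>?M\<close>, where
        \<open>a @\<^sub>c b\<close> vanishes.\<close>
      let ?d = "x - S *\<^sub>v (?C *\<^sub>v x)"
      have "?C *\<^sub>v ?d = 0\<^sub>v w"
        using mat_mult_eqD[OF CS, of "?C *\<^sub>v x"] x S i
        by (simp add: mult_mat_vec_diff one_mat_mult_vec minus_cancel_vec[OF carrier_vecI])
      moreover have "?d \<in> carrier_vec (k + k')" by (rule carrier_vecI) (use x S in simp)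
      ultimately obtain y where y: "y \<in> carrier_vec m" "?d = ?M *\<^sub>v y"
        using ker by blast
      have "(a @\<^sub>c b) *\<^sub>v x - (a @\<^sub>c b) *\<^sub>v (S *\<^sub>v (?C *\<^sub>v x)) = (a @\<^sub>c b) *\<^sub>v ?d"
        using x S i a b by (simp add: mult_mat_vec_diff)
      also have "\<dots> = 0\<^sub>v v" unfolding y(2) by (rule abM[OF y(1)])
      finally have "(a @\<^sub>c b) *\<^sub>v x = (a @\<^sub>c b) *\<^sub>v (S *\<^sub>v (?C *\<^sub>v x))"
        by (rule vec_diff_eq_zeroD) (use a in simp_all)
      then show "(?u * ?C) *\<^sub>v x = (a @\<^sub>c b) *\<^sub>v x"
        using x S i a b by (simp add: mult_mat_mult_vec)
    qed (use i a b S in auto)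
    show "\<exists>!u. u \<in> carrier_mat v w \<and> u * i\<^sub>1 = a \<and> u * i\<^sub>2 = b"
    proof (rule ex1I[of _ ?u], intro conjI)
      have "(?u * i\<^sub>1) @\<^sub>c (?u * i\<^sub>2) = a @\<^sub>c b"
        using uC mult_append_cols[of i\<^sub>1 ?u i\<^sub>2] i S by simp
      then show "?u * i\<^sub>1 = a" "?u * i\<^sub>2 = b"
        by (rule append_cols_inject; use a b i S in simp)+
    next
      fix u assume u': "u \<in> carrier_mat v w \<and> u * i\<^sub>1 = a \<and> u * i\<^sub>2 = b"
      then have "dim_col u = w" by auto
      then have "u * ?C = a @\<^sub>c b" using u' mult_append_cols[of i\<^sub>1 u i\<^sub>2] i by simp
      then have "u * ?C * S = ?u" by simp
      moreover have "u * ?C * S = u * (?C * S)"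
        by (rule assoc_mult_mat[of _ v w _ "k + k'"]) (use u' i S in auto)
      ultimately show "u = ?u" using u' CS right_mult_one_mat[of u v w] by simp
    qed (rule u)
  qed (use i p g in auto)
qed

text \<open>The legs are the two column blocks of a cokernel map. The section is returned as well,
  because elimination needs more than the universal property.\<close>

lemma split_pushout_exists:
  assumes p: "p \<in> carrier_mat k m" and g: "g \<in> carrier_mat k' m"
  obtains w i\<^sub>1 i\<^sub>2 S where "i\<^sub>1 \<in> carrier_mat w k" "i\<^sub>2 \<in> carrier_mat w k'"
    "split_cokernel (p @\<^sub>r (- g)) (i\<^sub>1 @\<^sub>c i\<^sub>2) S"
proof -
  obtain C S where CS: "split_cokernel (p @\<^sub>r (- g)) C S" using split_cokernel_exists by blast
  have "\<exists>w. C \<in> carrier_mat w (dim_row (p @\<^sub>r (- g)))"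
    using CS unfolding split_cokernel_def by blast
  then obtain w where C: "C \<in> carrier_mat w (k + k')" using p g by auto
  define i j where "i = Matrix.mat w k (\<lambda>(a, b). C $$ (a, b))"
    and "j = Matrix.mat w k' (\<lambda>(a, b). C $$ (a, k + b))"
  have "C = i @\<^sub>c j"
    by (rule eq_matI) (use C in \<open>auto simp: append_cols_def i_def j_def\<close>)
  moreover have "i \<in> carrier_mat w k" "j \<in> carrier_mat w k'" by (simp_all add: i_def j_def)
  ultimately show thesis using that CS by metis
qed

text \<open>The traces of \<open>A * B\<close> and \<open>B * A\<close> agree, and here they are
  \<open>m\<close> and \<open>n\<close>.\<close>

lemma invertible_dims_eq:
  fixes A B :: rmat
  assumes "A \<in> carrier_mat m n" "B \<in> carrier_mat n m" "A * B = 1\<^sub>m m" "B * A = 1\<^sub>m n"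
  shows "m = n"
proof -
  have tr: "(\<Sum>i<m. (A * B) $$ (i, i)) = (\<Sum>i<m. \<Sum>j<n. A $$ (i, j) * B $$ (j, i))"
    "(\<Sum>j<n. (B * A) $$ (j, j)) = (\<Sum>j<n. \<Sum>i<m. B $$ (j, i) * A $$ (i, j))"
    using assms(1,2) by (auto simp: scalar_prod_def atLeast0LessThan intro!: sum.cong)
  have "(\<Sum>i<m. (A * B) $$ (i, i)) = (\<Sum>j<n. (B * A) $$ (j, j))"
    unfolding tr by (subst sum.swap) (simp add: mult.commute)
  then show ?thesis unfolding assms(3,4) by simp
qed

text \<open>The mediating matrices in both directions compose to identities, since each composite
  and the identity mediate from a pushout to itself. The apexes could a priori have different
  dimensions, whereas \<open>gx_rel\<close> allows only square matrices; the trace argument closes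
  this gap.\<close>

lemma is_pushout_unique:
  assumes 1: "is_pushout p g i\<^sub>1 i\<^sub>2" and 2: "is_pushout p g j\<^sub>1 j\<^sub>2"
  obtains \<rho> where "\<rho> \<in> carrier_mat (dim_row i\<^sub>1) (dim_row i\<^sub>1)" "invertible_mat \<rho>"
    "j\<^sub>1 = \<rho> * i\<^sub>1" "j\<^sub>2 = \<rho> * i\<^sub>2"
proof -
  obtain w where w: "i\<^sub>1 \<in> carrier_mat w (dim_row p)" "i\<^sub>2 \<in> carrier_mat w (dim_row g)"
      "i\<^sub>1 * p = i\<^sub>2 * g"
    and univ: "\<And>v a b. a \<in> carrier_mat v (dim_row p) \<Longrightarrow> b \<in> carrier_mat v (dim_row g) \<Longrightarrow>
      a * p = b * g \<Longrightarrow> \<exists>!u. u \<in> carrier_mat v w \<and> u * i\<^sub>1 = a \<and> u * i\<^sub>2 = b"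
    using 1 unfolding is_pushout_def by metis
  obtain w' where w': "j\<^sub>1 \<in> carrier_mat w' (dim_row p)" "j\<^sub>2 \<in> carrier_mat w' (dim_row g)"
      "j\<^sub>1 * p = j\<^sub>2 * g"
    and univ': "\<And>v a b. a \<in> carrier_mat v (dim_row p) \<Longrightarrow> b \<in> carrier_mat v (dim_row g) \<Longrightarrow>
      a * p = b * g \<Longrightarrow> \<exists>!u. u \<in> carrier_mat v w' \<and> u * j\<^sub>1 = a \<and> u * j\<^sub>2 = b"
    using 2 unfolding is_pushout_def by metis
  obtain \<rho> where \<rho>: "\<rho> \<in> carrier_mat w' w" "\<rho> * i\<^sub>1 = j\<^sub>1" "\<rho> * i\<^sub>2 = j\<^sub>2"
    using univ[OF w'] by blast
  obtain \<rho>' where \<rho>': "\<rho>' \<in> carrier_mat w w'" "\<rho>' * j\<^sub>1 = i\<^sub>1" "\<rho>' * j\<^sub>2 = i\<^sub>2"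
    using univ'[OF w] by blast
  have "\<rho>' * \<rho> * i\<^sub>1 = i\<^sub>1" "\<rho>' * \<rho> * i\<^sub>2 = i\<^sub>2"
    using w \<rho> \<rho>' by (simp_all add: assoc_mult_mat[of \<rho>' w w' \<rho> w])
  then have a: "\<rho>' * \<rho> = 1\<^sub>m w"
    using univ[OF w] w \<rho> \<rho>' by (metis left_mult_one_mat mult_carrier_mat one_carrier_mat)
  have "\<rho> * \<rho>' * j\<^sub>1 = j\<^sub>1" "\<rho> * \<rho>' * j\<^sub>2 = j\<^sub>2"
    using w' \<rho> \<rho>' by (simp_all add: assoc_mult_mat[of \<rho> w' w \<rho>' w'])
  then have b: "\<rho> * \<rho>' = 1\<^sub>m w'"
    using univ'[OF w'] w' \<rho> \<rho>' by (metis left_mult_one_mat mult_carrier_mat one_carrier_mat)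
  have "w = w'"
    using invertible_dims_eq[OF \<rho>(1) \<rho>'(1) b a] by simp
  show thesis
  proof (rule that[of \<rho>])
    show "invertible_mat \<rho>"
      unfolding invertible_mat_def inverts_mat_def
      using a b \<rho> \<rho>' \<open>w = w'\<close> by auto
  qed (use \<rho> \<open>w = w'\<close> w in auto)
qed

section \<open>Measurability of vector operations\<close>

lemma measurable_borel_vec_dim:
  "f \<in> measurable M (borel_vec n) \<Longrightarrow> x \<in> space M \<Longrightarrow> dim_vec (f x) = n"
  using measurable_space[of f M "borel_vec n" x] by simp

lemma measurable_append_vec:
  assumes "f \<in> measurable M (borel_vec k)" "g \<in> measurable M (borel_vec k')"
  shows "(\<lambda>x. f x @\<^sub>v g x) \<in> measurable M (borel_vec (k + k'))"
  unfolding measurable_borel_vec_iff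
proof (intro conjI allI impI)
  note f = assms(1)[unfolded measurable_borel_vec_iff] and g = assms(2)[unfolded measurable_borel_vec_iff]
  show "(\<lambda>x. f x @\<^sub>v g x) \<in> space M \<rightarrow> carrier_vec (k + k')" using f g by auto
  fix i assume i: "i < k + k'"
  have d: "dim_vec (f x) = k" "dim_vec (g x) = k'" if "x \<in> space M" for x
    by (rule measurable_borel_vec_dim[OF assms(1) that], rule measurable_borel_vec_dim[OF assms(2) that])
  show "(\<lambda>x. (f x @\<^sub>v g x) $ i) \<in> borel_measurable M"
  proof (cases "i < k")
    case True
    then have "(\<lambda>x. f x $ i) \<in> borel_measurable M" using f by blast
    then show ?thesis
      by (rule measurable_cong[THEN iffD1, rotated]) (use True d i in simp)
  next
    case False
    then have "(\<lambda>x. g x $ (i - k)) \<in> borel_measurable M" using g i by auto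
    then show ?thesis
      by (rule measurable_cong[THEN iffD1, rotated]) (use False d i in simp)
  qed
qed

lemma measurable_add_vec:
  assumes "f \<in> measurable M (borel_vec k)" "g \<in> measurable M (borel_vec k)"
  shows "(\<lambda>x. f x + g x) \<in> measurable M (borel_vec k)"
  unfolding measurable_borel_vec_iff
proof (intro conjI allI impI)
  note f = assms(1)[unfolded measurable_borel_vec_iff] and g = assms(2)[unfolded measurable_borel_vec_iff]
  show "(\<lambda>x. f x + g x) \<in> space M \<rightarrow> carrier_vec k"
    using f g by (intro Pi_I add_carrier_vec) (auto dest: funcset_mem)
  fix i assume i: "i < k"
  have "(\<lambda>x. f x $ i + g x $ i) \<in> borel_measurable M"
    using f g i by (intro borel_measurable_add) blast+
  then show "(\<lambda>x. (f x + g x) $ i) \<in> borel_measurable M"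
    by (rule measurable_cong[THEN iffD1, rotated]) (use measurable_borel_vec_dim[OF assms(2)] i in simp)
qed

lemma measurable_scalar_prod:
  assumes "f \<in> measurable M (borel_vec k)"
  shows "(\<lambda>x. t \<bullet> f x) \<in> borel_measurable M"
proof -
  note f = assms[unfolded measurable_borel_vec_iff]
  have "(\<lambda>x. \<Sum>i = 0..<k. t $ i * f x $ i) \<in> borel_measurable M"
    using f by (intro borel_measurable_sum borel_measurable_times) auto
  then show ?thesis
    by (rule measurable_cong[THEN iffD1, rotated]) (use measurable_borel_vec_dim[OF assms] in \<open>simp add: scalar_prod_def\<close>)
qed

lemma measurable_split_append:
  assumes "sets \<psi> = sets (borel_vec k)" "sets \<chi> = sets (borel_vec k')"
  shows "(\<lambda>(u, v). u @\<^sub>v v) \<in> measurable (\<psi> \<Otimes>\<^sub>M \<chi>) (borel_vec (k + k'))"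
proof -
  have "fst \<in> measurable (\<psi> \<Otimes>\<^sub>M \<chi>) (borel_vec k)" "snd \<in> measurable (\<psi> \<Otimes>\<^sub>M \<chi>) (borel_vec k')"
    using assms measurable_cong_sets by (metis measurable_fst, metis measurable_snd)
  from measurable_append_vec[OF this] show ?thesis by (simp add: case_prod_beta)
qed

lemma measurable_split_add:
  assumes "sets \<psi> = sets (borel_vec k)" "sets \<chi> = sets (borel_vec k)"
  shows "(\<lambda>(u, v). u + v) \<in> measurable (\<psi> \<Otimes>\<^sub>M \<chi>) (borel_vec k)"
proof -
  have "fst \<in> measurable (\<psi> \<Otimes>\<^sub>M \<chi>) (borel_vec k)" "snd \<in> measurable (\<psi> \<Otimes>\<^sub>M \<chi>) (borel_vec k)"
    using assms measurable_cong_sets by (metis measurable_fst, metis measurable_snd)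
  from measurable_add_vec[OF this] show ?thesis by (simp add: case_prod_beta)
qed

lemma measurable_mult_mat_vec':
  assumes "sets \<psi> = sets (borel_vec k)" "A \<in> carrier_mat k' k"
  shows "(\<lambda>x. A *\<^sub>v x) \<in> measurable \<psi> (borel_vec k')"
  using measurable_mult_mat_vec[OF assms(2)] measurable_cong_sets[OF assms(1) refl] by blast

section \<open>Gaussian distributions are closed under linear operations\<close>

lemma gaussianD:
  assumes "gaussian k \<psi>"
  shows "prob_space \<psi>" "space \<psi> = carrier_vec k" "sets \<psi> = sets (borel_vec k)"
  using assms by (auto simp: gaussian_def gaussian_with_def)

text \<open>Fubini: the integrand has modulus 1 and is therefore integrable. This is the
  factorization of characteristic functions under independence.\<close>

lemma integral_iexp_pair:
  assumes "prob_space M" "prob_space N" and a: "a \<in> borel_measurable M" and b: "b \<in> borel_measurable N"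
  shows "(CLINT z|M \<Otimes>\<^sub>M N. iexp (a (fst z) + b (snd z))) = (CLINT x|M. iexp (a x)) * (CLINT y|N. iexp (b y))"
proof -
  interpret M: prob_space M by fact
  interpret N: prob_space N by fact
  interpret P: pair_prob_space M N ..
  have "integrable (M \<Otimes>\<^sub>M N) (\<lambda>z. iexp (a (fst z) + b (snd z)))"
    by (rule P.integrable_const_bound[of _ 1]) (simp, use a b in measurable)
  from P.integral_fst'[OF this]
  have "(CLINT z|M \<Otimes>\<^sub>M N. iexp (a (fst z) + b (snd z))) = (CLINT x|M. CLINT y|N. iexp (a x) * iexp (b y))"
    by (simp add: exp_add algebra_simps)
  then show ?thesis by simp
qed

lemma gaussian_dirac:
  assumes \<mu>: "\<mu> \<in> carrier_vec k"
  shows "gaussian k (dirac k \<mu>)"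
  unfolding gaussian_def
proof (intro bexI exI conjI)
  show "positive_semidefinite k (0\<^sub>m k k)"
    by (auto simp: positive_semidefinite_def zero_mat_mult_vec)
  show "gaussian_with k \<mu> (0\<^sub>m k k) (dirac k \<mu>)"
    unfolding gaussian_with_def dirac_def
  proof (intro conjI ballI)
    show "prob_space (return (borel_vec k) \<mu>)" by (rule prob_space_return) (use \<mu> in simp)
    fix t :: rvec assume t: "t \<in> carrier_vec k"
    have "(\<lambda>x. t \<bullet> x) \<in> borel_measurable (borel_vec k)"
      by (rule measurable_scalar_prod) (rule measurable_ident_sets[OF refl])
    then have "(CLINT x|return (borel_vec k) \<mu>. iexp (t \<bullet> x)) = iexp (t \<bullet> \<mu>)"
      by (intro integral_return) (use \<mu> in \<open>simp, measurable\<close>)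
    then show "(CLINT x|return (borel_vec k) \<mu>. iexp (t \<bullet> x)) =
        exp (\<i> * complex_of_real (t \<bullet> \<mu>) - complex_of_real (t \<bullet> (0\<^sub>m k k *\<^sub>v t)) / 2)"
      using t by (simp add: zero_mat_mult_vec)
  qed auto
qed (rule \<mu>)

text \<open>The characteristic function of the pushforward at t is that of \<open>\<psi>\<close> at
  \<open>transpose_mat A *\<^sub>v t\<close>. Hence the mean \<open>A *\<^sub>v \<mu>\<close> and
  the covariance \<open>A * \<Sigma> * transpose_mat A\<close>, which may be singular even for
  regular \<open>\<Sigma>\<close>.\<close>

lemma gaussian_push:
  assumes \<psi>: "gaussian k \<psi>" and A: "A \<in> carrier_mat k' k"
  shows "gaussian k' (push A \<psi>)"
proof -
  interpret prob_space \<psi> by (rule gaussianD(1)[OF \<psi>])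
  obtain \<mu> \<Sigma> where \<mu>: "\<mu> \<in> carrier_vec k" and \<Sigma>: "positive_semidefinite k \<Sigma>"
    and g: "gaussian_with k \<mu> \<Sigma> \<psi>"
    using \<psi> unfolding gaussian_def by blast
  have \<Sigma>c: "\<Sigma> \<in> carrier_mat k k" "transpose_mat \<Sigma> = \<Sigma>"
    using \<Sigma> by (auto simp: positive_semidefinite_def)
  have p: "push A \<psi> = distr \<psi> (borel_vec k') (\<lambda>x. A *\<^sub>v x)" using A by (simp add: push_def)
  have mA: "(\<lambda>x. A *\<^sub>v x) \<in> measurable \<psi> (borel_vec k')"
    by (rule measurable_mult_mat_vec'[OF gaussianD(3)[OF \<psi>] A])
  let ?\<Sigma> = "A * \<Sigma> * transpose_mat A"
  have q: "t \<bullet> (?\<Sigma> *\<^sub>v t) = (transpose_mat A *\<^sub>v t) \<bullet> (\<Sigma> *\<^sub>v (transpose_mat A *\<^sub>v t))"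
    if t: "t \<in> carrier_vec k'" for t
  proof -
    have "t \<bullet> (?\<Sigma> *\<^sub>v t) = t \<bullet> (A *\<^sub>v (\<Sigma> *\<^sub>v (transpose_mat A *\<^sub>v t)))"
      using A \<Sigma>c t by (simp add: mult_mat_mult_vec)
    also have "\<dots> = (transpose_mat A *\<^sub>v t) \<bullet> (\<Sigma> *\<^sub>v (transpose_mat A *\<^sub>v t))"
      by (rule transpose_vec_mult_scalar[symmetric, OF A]) (use A \<Sigma>c t in auto)
    finally show ?thesis .
  qed
  show ?thesis
    unfolding gaussian_def
  proof (intro bexI exI conjI)
    show "A *\<^sub>v \<mu> \<in> carrier_vec k'" using A \<mu> by auto
    show "positive_semidefinite k' ?\<Sigma>"
      unfolding positive_semidefinite_def
    proof (intro conjI ballI)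
      show "?\<Sigma> \<in> carrier_mat k' k'" using A \<Sigma>c by auto
      show "transpose_mat ?\<Sigma> = ?\<Sigma>"
        using A \<Sigma>c
        by (simp add: transpose_mult[of A k' k _ k'] transpose_mult[of \<Sigma> k k _ k']
            assoc_mult_mat[of A k' k _ k _ k'])
      fix t :: rvec assume t: "t \<in> carrier_vec k'"
      then have "transpose_mat A *\<^sub>v t \<in> carrier_vec k" using A by auto
      then show "0 \<le> t \<bullet> (?\<Sigma> *\<^sub>v t)"
        unfolding q[OF t] using \<Sigma> by (simp add: positive_semidefinite_def)
    qed
    show "gaussian_with k' (A *\<^sub>v \<mu>) ?\<Sigma> (push A \<psi>)"
      unfolding gaussian_with_def
    proof (intro conjI ballI)
      show "prob_space (push A \<psi>)" unfolding p by (rule prob_space_distr[OF mA])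
      fix t :: rvec assume t: "t \<in> carrier_vec k'"
      have "(\<lambda>x. t \<bullet> x) \<in> borel_measurable (borel_vec k')"
        by (rule measurable_scalar_prod) (rule measurable_ident_sets[OF refl])
      then have "(CLINT x|push A \<psi>. iexp (t \<bullet> x)) = (CLINT x|\<psi>. iexp (t \<bullet> (A *\<^sub>v x)))"
        unfolding p by (intro integral_distr[OF mA]) measurable
      also have "\<dots> = (CLINT x|\<psi>. iexp ((transpose_mat A *\<^sub>v t) \<bullet> x))"
        by (rule Bochner_Integration.integral_cong)
           (use A t gaussianD(2)[OF \<psi>] in \<open>simp_all add: transpose_vec_mult_scalar[of _ k' k]\<close>)
      also have "\<dots> = exp (\<i> * complex_of_real ((transpose_mat A *\<^sub>v t) \<bullet> \<mu>) -
          complex_of_real ((transpose_mat A *\<^sub>v t) \<bullet> (\<Sigma> *\<^sub>v (transpose_mat A *\<^sub>v t))) / 2)"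
        using g A t unfolding gaussian_with_def by auto
      finally show "(CLINT x|push A \<psi>. iexp (t \<bullet> x)) =
          exp (\<i> * complex_of_real (t \<bullet> (A *\<^sub>v \<mu>)) - complex_of_real (t \<bullet> (?\<Sigma> *\<^sub>v t)) / 2)"
        unfolding q[OF t] using transpose_vec_mult_scalar[OF A \<mu> t] by simp
    qed (use A in \<open>auto simp: push_def\<close>)
  qed
qed

text \<open>By independence the characteristic function factors over the two blocks, so the
  exponents add: the means are concatenated and the covariance is block diagonal.\<close>

lemma gaussian_product_dist:
  assumes \<psi>: "gaussian k \<psi>" and \<chi>: "gaussian k' \<chi>"
  shows "gaussian (k + k') (product_dist k k' \<psi> \<chi>)"
proof -
  interpret A: prob_space \<psi> by (rule gaussianD(1)[OF \<psi>])
  interpret B: prob_space \<chi> by (rule gaussianD(1)[OF \<chi>])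
  interpret P: pair_prob_space \<psi> \<chi> ..
  obtain \<mu> \<Sigma> where \<mu>: "\<mu> \<in> carrier_vec k" and \<Sigma>: "positive_semidefinite k \<Sigma>"
    and g: "gaussian_with k \<mu> \<Sigma> \<psi>"
    using \<psi> unfolding gaussian_def by blast
  obtain \<mu>' \<Sigma>' where \<mu>': "\<mu>' \<in> carrier_vec k'" and \<Sigma>': "positive_semidefinite k' \<Sigma>'"
    and g': "gaussian_with k' \<mu>' \<Sigma>' \<chi>"
    using \<chi> unfolding gaussian_def by blast
  have \<Sigma>c: "\<Sigma> \<in> carrier_mat k k" "transpose_mat \<Sigma> = \<Sigma>" "\<Sigma>' \<in> carrier_mat k' k'" "transpose_mat \<Sigma>' = \<Sigma>'"
    using \<Sigma> \<Sigma>' by (auto simp: positive_semidefinite_def)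
  have m: "(\<lambda>(u, v). u @\<^sub>v v) \<in> measurable (\<psi> \<Otimes>\<^sub>M \<chi>) (borel_vec (k + k'))"
    by (rule measurable_split_append) (use gaussianD \<psi> \<chi> in auto)
  let ?\<Sigma> = "prod_mat \<Sigma> \<Sigma>'"
  have q: "(t @\<^sub>v t') \<bullet> (?\<Sigma> *\<^sub>v (t @\<^sub>v t')) = t \<bullet> (\<Sigma> *\<^sub>v t) + t' \<bullet> (\<Sigma>' *\<^sub>v t')"
    if "dim_vec t = k" "dim_vec t' = k'" for t t'
    using that \<Sigma>c by (simp add: prod_mat_mult_vec' scalar_prod_append')
  show ?thesis
    unfolding gaussian_def
  proof (intro bexI exI conjI)
    show "\<mu> @\<^sub>v \<mu>' \<in> carrier_vec (k + k')" using \<mu> \<mu>' by auto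
    show "positive_semidefinite (k + k') ?\<Sigma>"
      unfolding positive_semidefinite_def
    proof (intro conjI ballI)
      show "?\<Sigma> \<in> carrier_mat (k + k') (k + k')" by (rule carrier_matI) (use \<Sigma>c in auto)
      show "transpose_mat ?\<Sigma> = ?\<Sigma>"
        using \<Sigma>c unfolding prod_mat_def
        by (simp add: transpose_four_block_mat[of _ k k _ k' _ k'])
      fix s :: rvec assume "s \<in> carrier_vec (k + k')"
      then obtain t t' where s: "s = t @\<^sub>v t'" "dim_vec t = k" "dim_vec t' = k'"
        by (rule carrier_vec_appendE)
      show "0 \<le> s \<bullet> (?\<Sigma> *\<^sub>v s)"
        unfolding s(1) q[OF s(2,3)] using \<Sigma> \<Sigma>' carrier_vecI[OF s(2)] carrier_vecI[OF s(3)]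
        by (simp add: positive_semidefinite_def)
    qed
    show "gaussian_with (k + k') (\<mu> @\<^sub>v \<mu>') ?\<Sigma> (product_dist k k' \<psi> \<chi>)"
      unfolding gaussian_with_def
    proof (intro conjI ballI)
      show "prob_space (product_dist k k' \<psi> \<chi>)"
        unfolding product_dist_def by (rule P.prob_space_distr[OF m])
      fix s :: rvec assume "s \<in> carrier_vec (k + k')"
      then obtain t t' where s: "s = t @\<^sub>v t'" "dim_vec t = k" "dim_vec t' = k'"
        by (rule carrier_vec_appendE)
      note t = carrier_vecI[OF s(2)] carrier_vecI[OF s(3)]
      have ms: "(\<lambda>x. s \<bullet> x) \<in> borel_measurable (borel_vec (k + k'))"
        by (rule measurable_scalar_prod) (rule measurable_ident_sets[OF refl])
      have mt: "(\<lambda>x. t \<bullet> x) \<in> borel_measurable \<psi>" "(\<lambda>x. t' \<bullet> x) \<in> borel_measurable \<chi>"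
        by (rule measurable_scalar_prod, rule measurable_ident_sets, rule gaussianD, rule \<psi> \<chi>)+
      have "(CLINT x|product_dist k k' \<psi> \<chi>. iexp (s \<bullet> x)) =
          (CLINT z|\<psi> \<Otimes>\<^sub>M \<chi>. iexp (s \<bullet> (case z of (u, v) \<Rightarrow> u @\<^sub>v v)))"
        unfolding product_dist_def by (rule integral_distr[OF m]) (use ms in measurable)
      also have "\<dots> = (CLINT z|\<psi> \<Otimes>\<^sub>M \<chi>. iexp (t \<bullet> fst z + t' \<bullet> snd z))"
        by (rule Bochner_Integration.integral_cong)
           (use s gaussianD(2) \<psi> \<chi> in \<open>auto simp: space_pair_measure scalar_prod_append'\<close>)
      also have "\<dots> = (CLINT x|\<psi>. iexp (t \<bullet> x)) * (CLINT y|\<chi>. iexp (t' \<bullet> y))"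
        by (rule integral_iexp_pair) (use mt A.prob_space_axioms B.prob_space_axioms in auto)
      also have "\<dots> = exp (\<i> * complex_of_real (t \<bullet> \<mu>) - complex_of_real (t \<bullet> (\<Sigma> *\<^sub>v t)) / 2) *
          exp (\<i> * complex_of_real (t' \<bullet> \<mu>') - complex_of_real (t' \<bullet> (\<Sigma>' *\<^sub>v t')) / 2)"
        using g g' t unfolding gaussian_with_def by simp
      also have "\<dots> = exp (\<i> * complex_of_real (s \<bullet> (\<mu> @\<^sub>v \<mu>')) - complex_of_real (s \<bullet> (?\<Sigma> *\<^sub>v s)) / 2)"
        unfolding exp_add[symmetric] s(1) q[OF s(2,3)] using s \<mu> \<mu>'
        by (simp add: scalar_prod_append' algebra_simps add_divide_distrib)
      finally show "(CLINT x|product_dist k k' \<psi> \<chi>. iexp (s \<bullet> x)) =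
          exp (\<i> * complex_of_real (s \<bullet> (\<mu> @\<^sub>v \<mu>')) - complex_of_real (s \<bullet> (?\<Sigma> *\<^sub>v s)) / 2)" .
    qed (auto simp: product_dist_def)
  qed
qed

section \<open>Pushforwards of products and convolutions\<close>

lemma push_push:
  assumes "sets \<psi> = sets (borel_vec k)" "B \<in> carrier_mat k' k" "A \<in> carrier_mat k'' k'"
  shows "push A (push B \<psi>) = push (A * B) \<psi>"
proof -
  have sp: "space \<psi> = carrier_vec k" using sets_eq_imp_space_eq[OF assms(1)] by simp
  have "push A (push B \<psi>) = distr \<psi> (borel_vec k'') ((\<lambda>x. A *\<^sub>v x) \<circ> (\<lambda>x. B *\<^sub>v x))"
    unfolding push_def using assms
    by (simp add: distr_distr[OF measurable_mult_mat_vec measurable_mult_mat_vec'])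
  also have "\<dots> = push (A * B) \<psi>"
    unfolding push_def using assms sp by (intro distr_cong) (simp_all add: mult_mat_mult_vec)
  finally show ?thesis .
qed

lemma push_one:
  assumes "sets \<psi> = sets (borel_vec k)"
  shows "push (1\<^sub>m k) \<psi> = \<psi>"
proof -
  have sp: "space \<psi> = carrier_vec k" using sets_eq_imp_space_eq[OF assms(1)] by simp
  have "push (1\<^sub>m k) \<psi> = distr \<psi> \<psi> (\<lambda>x. x)"
    unfolding push_def using assms sp by (intro distr_cong) (simp_all add: one_mat_mult_vec)
  then show ?thesis by (simp add: distr_id)
qed

lemma push_pair:
  assumes \<psi>: "gaussian k \<psi>" and \<chi>: "gaussian k' \<chi>"
    and A: "A \<in> carrier_mat a k" and B: "B \<in> carrier_mat b k'"
  shows "push A \<psi> \<Otimes>\<^sub>M push B \<chi> =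
    distr (\<psi> \<Otimes>\<^sub>M \<chi>) (borel_vec a \<Otimes>\<^sub>M borel_vec b) (\<lambda>(u, v). (A *\<^sub>v u, B *\<^sub>v v))"
proof -
  have mA: "(\<lambda>x. A *\<^sub>v x) \<in> measurable \<psi> (borel_vec a)" and mB: "(\<lambda>x. B *\<^sub>v x) \<in> measurable \<chi> (borel_vec b)"
    by (rule measurable_mult_mat_vec'; use gaussianD \<psi> \<chi> A B in blast)+
  interpret B: prob_space "push B \<chi>" by (rule gaussianD(1)[OF gaussian_push[OF \<chi> B]])
  show ?thesis
    using pair_measure_distr[OF mA mB] B.sigma_finite_measure_axioms A B by (simp add: push_def)
qed

text \<open>\<open>A *\<^sub>v u + B *\<^sub>v v\<close> is \<open>A @\<^sub>c B\<close> applied to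
  the pair. In this form, changing a composite by an invertible matrix is plain matrix
  multiplication.\<close>

lemma conv_dist_push:
  assumes \<psi>: "gaussian k \<psi>" and \<chi>: "gaussian k' \<chi>"
    and A: "A \<in> carrier_mat w k" and B: "B \<in> carrier_mat w k'"
  shows "conv_dist w (push A \<psi>) (push B \<chi>) = push (A @\<^sub>c B) (product_dist k k' \<psi> \<chi>)"
proof -
  note s = gaussianD(3)[OF \<psi>] gaussianD(3)[OF \<chi>]
  have sp: "space (\<psi> \<Otimes>\<^sub>M \<chi>) = carrier_vec k \<times> carrier_vec k'"
    using gaussianD(2) \<psi> \<chi> by (simp add: space_pair_measure)
  have C: "A @\<^sub>c B \<in> carrier_mat w (k + k')" by (rule carrier_matI) (use A B in auto)
  have mA: "(\<lambda>x. A *\<^sub>v x) \<in> measurable \<psi> (borel_vec w)" and mB: "(\<lambda>x. B *\<^sub>v x) \<in> measurable \<chi> (borel_vec w)"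
    by (rule measurable_mult_mat_vec'; use s A B in blast)+
  have mAB: "(\<lambda>(u, v). (A *\<^sub>v u, B *\<^sub>v v)) \<in> measurable (\<psi> \<Otimes>\<^sub>M \<chi>) (borel_vec w \<Otimes>\<^sub>M borel_vec w)"
    using mA mB by measurable
  have "conv_dist w (push A \<psi>) (push B \<chi>) =
      distr (\<psi> \<Otimes>\<^sub>M \<chi>) (borel_vec w) ((\<lambda>(u, v). u + v) \<circ> (\<lambda>(u, v). (A *\<^sub>v u, B *\<^sub>v v)))"
    unfolding conv_dist_def push_pair[OF assms]
    by (rule distr_distr[OF measurable_split_add[OF refl refl] mAB])
  also have "\<dots> = distr (\<psi> \<Otimes>\<^sub>M \<chi>) (borel_vec w) ((\<lambda>x. (A @\<^sub>c B) *\<^sub>v x) \<circ> (\<lambda>(u, v). u @\<^sub>v v))"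
    by (rule distr_cong) (use A B in \<open>auto simp: sp append_cols_mult_vec\<close>)
  also have "\<dots> = push (A @\<^sub>c B) (product_dist k k' \<psi> \<chi>)"
    unfolding push_def product_dist_def
    using distr_distr[OF measurable_mult_mat_vec[OF C] measurable_split_append[OF s]] A by simp
  finally show ?thesis .
qed

lemma product_dist_push:
  assumes \<psi>: "gaussian k \<psi>" and \<chi>: "gaussian k' \<chi>"
    and A: "A \<in> carrier_mat a k" and B: "B \<in> carrier_mat b k'"
  shows "product_dist a b (push A \<psi>) (push B \<chi>) = push (prod_mat A B) (product_dist k k' \<psi> \<chi>)"
proof -
  note s = gaussianD(3)[OF \<psi>] gaussianD(3)[OF \<chi>]
  have sp: "space (\<psi> \<Otimes>\<^sub>M \<chi>) = carrier_vec k \<times> carrier_vec k'"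
    using gaussianD(2) \<psi> \<chi> by (simp add: space_pair_measure)
  have C: "prod_mat A B \<in> carrier_mat (a + b) (k + k')" by (rule carrier_matI) (use A B in auto)
  have mA: "(\<lambda>x. A *\<^sub>v x) \<in> measurable \<psi> (borel_vec a)" and mB: "(\<lambda>x. B *\<^sub>v x) \<in> measurable \<chi> (borel_vec b)"
    by (rule measurable_mult_mat_vec'; use s A B in blast)+
  have mAB: "(\<lambda>(u, v). (A *\<^sub>v u, B *\<^sub>v v)) \<in> measurable (\<psi> \<Otimes>\<^sub>M \<chi>) (borel_vec a \<Otimes>\<^sub>M borel_vec b)"
    using mA mB by measurable
  have "product_dist a b (push A \<psi>) (push B \<chi>) =
      distr (\<psi> \<Otimes>\<^sub>M \<chi>) (borel_vec (a + b)) ((\<lambda>(u, v). u @\<^sub>v v) \<circ> (\<lambda>(u, v). (A *\<^sub>v u, B *\<^sub>v v)))"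
    unfolding product_dist_def push_pair[OF assms]
    by (rule distr_distr[OF measurable_split_append[OF refl refl] mAB])
  also have "\<dots> = distr (\<psi> \<Otimes>\<^sub>M \<chi>) (borel_vec (a + b)) ((\<lambda>x. prod_mat A B *\<^sub>v x) \<circ> (\<lambda>(u, v). u @\<^sub>v v))"
    by (rule distr_cong) (use A B in \<open>auto simp: sp prod_mat_mult_vec'\<close>)
  also have "\<dots> = push (prod_mat A B) (product_dist k k' \<psi> \<chi>)"
    unfolding push_def product_dist_def
    using distr_distr[OF measurable_mult_mat_vec[OF C] measurable_split_append[OF s]] A B by simp
  finally show ?thesis .
qed

section \<open>Composition and tensor product of classes\<close>

text \<open>Evaluates the unions that define composition and tensor: one admissible choice must
  exist, and all admissible choices must give the same class.\<close>

lemma Union_eq_const: "c \<in> A \<Longrightarrow> (\<And>x. x \<in> A \<Longrightarrow> x = c) \<Longrightarrow> \<Union>A = c"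
  by blast

lemma invertible_matI:
  fixes A B :: rmat
  assumes "A \<in> carrier_mat k k" "B \<in> carrier_mat k k" "A * B = 1\<^sub>m k" "B * A = 1\<^sub>m k"
  shows "invertible_mat A"
  unfolding invertible_mat_def inverts_mat_def using assms by auto

lemma invertible_matE:
  fixes A :: rmat
  assumes A: "A \<in> carrier_mat k k" "invertible_mat A"
  obtains B where "B \<in> carrier_mat k k" "A * B = 1\<^sub>m k" "B * A = 1\<^sub>m k"
proof -
  obtain B where B: "A * B = 1\<^sub>m k" "B * A = 1\<^sub>m (dim_row B)"
    using A unfolding invertible_mat_def inverts_mat_def by auto
  have "dim_col B = k" using arg_cong[OF B(1), of dim_col] by simp
  moreover have "dim_row B = k" using arg_cong[OF B(2), of dim_col] A by simp
  ultimately show ?thesis using that[of B] B by auto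
qed

lemma invertible_mult:
  fixes A B :: rmat
  assumes A: "A \<in> carrier_mat k k" "invertible_mat A" and B: "B \<in> carrier_mat k k" "invertible_mat B"
  shows "invertible_mat (A * B)"
proof -
  obtain A' where A': "A' \<in> carrier_mat k k" "A * A' = 1\<^sub>m k" "A' * A = 1\<^sub>m k"
    by (rule invertible_matE[OF A])
  obtain B' where B': "B' \<in> carrier_mat k k" "B * B' = 1\<^sub>m k" "B' * B = 1\<^sub>m k"
    by (rule invertible_matE[OF B])
  show ?thesis
  proof (rule invertible_matI)
    show "A * B * (B' * A') = 1\<^sub>m k"
      by (rule mat_eq_by_action) (use A(1) B(1) A' B' mat_mult_eqD[OF A'(2)] mat_mult_eqD[OF B'(2)]
        in \<open>simp_all add: mat_action_simps\<close>)
    show "B' * A' * (A * B) = 1\<^sub>m k"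
      by (rule mat_eq_by_action) (use A(1) B(1) A' B' mat_mult_eqD[OF A'(3)] mat_mult_eqD[OF B'(3)]
        in \<open>simp_all add: mat_action_simps\<close>)
  qed (use A(1) B(1) A' B' in auto)
qed

lemma prod_mat_mult:
  assumes "dim_col A = dim_row B" "dim_col A' = dim_row B'"
  shows "prod_mat A A' * prod_mat B B' = prod_mat (A * B) (A' * B')"
proof (rule mat_eq_by_action)
  fix x :: rvec assume "x \<in> carrier_vec (dim_col (prod_mat (A * B) (A' * B')))"
  then have "x \<in> carrier_vec (dim_col B + dim_col B')" by simp
  then show "(prod_mat A A' * prod_mat B B') *\<^sub>v x = prod_mat (A * B) (A' * B') *\<^sub>v x"
    by (rule carrier_vec_appendE) (simp add: mat_action_simps assms)
qed (use assms in auto)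

lemma prod_mat_one: "prod_mat (1\<^sub>m a) (1\<^sub>m b) = 1\<^sub>m (a + b)"
proof (rule mat_eq_by_action)
  fix x :: rvec assume "x \<in> carrier_vec (dim_col (1\<^sub>m (a + b) :: rmat))"
  then have "x \<in> carrier_vec (a + b)" by simp
  then show "prod_mat (1\<^sub>m a) (1\<^sub>m b) *\<^sub>v x = 1\<^sub>m (a + b) *\<^sub>v x"
    by (rule carrier_vec_appendE) (simp add: mat_action_simps)
qed auto

lemma prod_mat_carrier:
  "A \<in> carrier_mat a b \<Longrightarrow> B \<in> carrier_mat c d \<Longrightarrow> prod_mat A B \<in> carrier_mat (a + c) (b + d)"
  by (rule carrier_matI) auto

lemma invertible_prod_mat:
  assumes A: "A \<in> carrier_mat k k" "invertible_mat A" and B: "B \<in> carrier_mat k' k'" "invertible_mat B"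
  shows "invertible_mat (prod_mat A B)"
proof -
  obtain A' where A': "A' \<in> carrier_mat k k" "A * A' = 1\<^sub>m k" "A' * A = 1\<^sub>m k"
    by (rule invertible_matE[OF A])
  obtain B' where B': "B' \<in> carrier_mat k' k'" "B * B' = 1\<^sub>m k'" "B' * B = 1\<^sub>m k'"
    by (rule invertible_matE[OF B])
  show ?thesis
    by (rule invertible_matI[of _ "k + k'" "prod_mat A' B'"])
       (use A(1) B(1) A' B' in \<open>simp_all add: prod_mat_mult prod_mat_one prod_mat_carrier\<close>)
qed

lemma surj_mat_prod:
  assumes "surj_mat p" "surj_mat q"
  shows "surj_mat (prod_mat p q)"
proof -
  obtain s where s: "s \<in> carrier_mat (dim_col p) (dim_row p)" "p * s = 1\<^sub>m (dim_row p)"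
    by (rule surj_mat_right_inverse[OF _ assms(1)]) auto
  obtain t where t: "t \<in> carrier_mat (dim_col q) (dim_row q)" "q * t = 1\<^sub>m (dim_row q)"
    by (rule surj_mat_right_inverse[OF _ assms(2)]) auto
  show ?thesis
    by (rule surj_mat_if_right_inverse[of _ "prod_mat s t"])
       (use s t in \<open>simp_all add: prod_mat_mult prod_mat_one\<close>)
qed

section \<open>Representatives of morphisms and change of representative\<close>

lemma gx_triplesI:
  "f \<in> carrier_mat k m \<Longrightarrow> p \<in> carrier_mat k n \<Longrightarrow> surj_mat p \<Longrightarrow> gaussian k \<psi> \<Longrightarrow>
    (f, \<psi>, p) \<in> gx_triples m n"
  unfolding gx_triples_def by blast

lemma gx_triplesE:
  assumes "(f, \<psi>, p) \<in> gx_triples m n"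
  obtains k where "f \<in> carrier_mat k m" "p \<in> carrier_mat k n" "surj_mat p" "gaussian k \<psi>"
  using assms by (auto simp: gx_triples_def)

lemma gx_classE:
  assumes "t \<in> gx_class (f, \<psi>, p)" "p \<in> carrier_mat k n"
  obtains \<tau> where "\<tau> \<in> carrier_mat k k" "invertible_mat \<tau>" "t = (\<tau> * f, push \<tau> \<psi>, \<tau> * p)"
  using assms unfolding gx_class_def gx_rel_def by auto

lemma gx_classI:
  assumes "\<tau> \<in> carrier_mat k k" "invertible_mat \<tau>" "p \<in> carrier_mat k n"
  shows "(\<tau> * f, push \<tau> \<psi>, \<tau> * p) \<in> gx_class (f, \<psi>, p)"
  using assms unfolding gx_class_def gx_rel_def by auto

lemma gx_class_self:
  assumes "(f, \<psi>, p) \<in> gx_triples m n"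
  shows "(f, \<psi>, p) \<in> gx_class (f, \<psi>, p)"
proof -
  obtain k where k: "f \<in> carrier_mat k m" "p \<in> carrier_mat k n" "gaussian k \<psi>"
    using gx_triplesE[OF assms] by metis
  have "invertible_mat (1\<^sub>m k :: rmat)" by (rule invertible_matI[of _ k "1\<^sub>m k"]) auto
  from gx_classI[OF _ this k(2), of f \<psi>] show ?thesis
    using k push_one[OF gaussianD(3)[OF k(3)]] by simp
qed

lemma gx_triples_transport:
  assumes t: "(f, \<psi>, p) \<in> gx_triples m n" and p: "p \<in> carrier_mat k n"
    and \<tau>: "\<tau> \<in> carrier_mat k k" "invertible_mat \<tau>"
  shows "(\<tau> * f, push \<tau> \<psi>, \<tau> * p) \<in> gx_triples m n"
proof -
  obtain k' where k': "f \<in> carrier_mat k' m" "p \<in> carrier_mat k' n" "surj_mat p" "gaussian k' \<psi>"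
    by (rule gx_triplesE[OF t])
  have "k' = k" using k' p by auto
  note k = k'[unfolded this]
  obtain \<tau>' where \<tau>': "\<tau>' \<in> carrier_mat k k" "\<tau> * \<tau>' = 1\<^sub>m k" "\<tau>' * \<tau> = 1\<^sub>m k"
    by (rule invertible_matE[OF \<tau>])
  show ?thesis
    by (rule gx_triplesI[OF mult_carrier_mat[OF \<tau>(1) k(1)] mult_carrier_mat[OF \<tau>(1) k(2)]
          surj_mat_mult_invertible[OF \<tau>(1) \<tau>'(1,2) k(2,3)] gaussian_push[OF k(4) \<tau>(1)]])
qed

lemma gx_class_transport:
  assumes t: "(f, \<psi>, p) \<in> gx_triples m n" and p: "p \<in> carrier_mat k n"
    and \<tau>: "\<tau> \<in> carrier_mat k k" "invertible_mat \<tau>"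
  shows "gx_class (\<tau> * f, push \<tau> \<psi>, \<tau> * p) = gx_class (f, \<psi>, p)"
proof -
  \<comment> \<open>One inclusion suffices: the other is the same step taken from the transported
    triple with the inverse matrix, which leads back to the original triple.\<close>
  have step: "gx_class (\<tau> * f, push \<tau> \<psi>, \<tau> * p) \<subseteq> gx_class (f, \<psi>, p)"
    if t: "(f, \<psi>, p) \<in> gx_triples m n" and p: "p \<in> carrier_mat k n"
      and \<tau>: "\<tau> \<in> carrier_mat k k" "invertible_mat \<tau>" for f \<psi> p \<tau>
  proof
    fix s assume s: "s \<in> gx_class (\<tau> * f, push \<tau> \<psi>, \<tau> * p)"
    have "\<tau> * p \<in> carrier_mat k n" using p \<tau> by auto
    with s obtain \<sigma> where \<sigma>: "\<sigma> \<in> carrier_mat k k" "invertible_mat \<sigma>"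
      and s_eq: "s = (\<sigma> * (\<tau> * f), push \<sigma> (push \<tau> \<psi>), \<sigma> * (\<tau> * p))"
      by (rule gx_classE)
    obtain k' where k': "f \<in> carrier_mat k' m" "p \<in> carrier_mat k' n" "gaussian k' \<psi>"
      using gx_triplesE[OF t] by metis
    have "k' = k" using k' p by auto
    note k = k'[unfolded this]
    have "s = (\<sigma> * \<tau> * f, push (\<sigma> * \<tau>) \<psi>, \<sigma> * \<tau> * p)"
      unfolding s_eq using k \<sigma> \<tau>(1) push_push[OF gaussianD(3)[OF k(3)] \<tau>(1) \<sigma>(1)]
      by (simp add: assoc_mult_mat[of \<sigma> k k \<tau> k])
    then show "s \<in> gx_class (f, \<psi>, p)"
      using gx_classI[OF _ invertible_mult[OF \<sigma> \<tau>] p, of f \<psi>] \<sigma> \<tau> by auto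
  qed
  obtain k' where k': "f \<in> carrier_mat k' m" "p \<in> carrier_mat k' n" "gaussian k' \<psi>"
    using gx_triplesE[OF t] by metis
  have "k' = k" using k' p by auto
  note k = k'[unfolded this]
  obtain \<tau>' where \<tau>': "\<tau>' \<in> carrier_mat k k" "\<tau> * \<tau>' = 1\<^sub>m k" "\<tau>' * \<tau> = 1\<^sub>m k"
    by (rule invertible_matE[OF \<tau>])
  have i: "invertible_mat \<tau>'" by (rule invertible_matI[OF \<tau>'(1) \<tau>(1) \<tau>'(3,2)])
  have "\<tau>' * (\<tau> * f) = f" "\<tau>' * (\<tau> * p) = p"
    using k \<tau>(1) \<tau>' by (simp_all add: assoc_mult_mat[symmetric, of \<tau>' k k \<tau> k])
  moreover have "push \<tau>' (push \<tau> \<psi>) = \<psi>"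
    using push_push[OF gaussianD(3)[OF k(3)] \<tau>(1) \<tau>'(1)] push_one[OF gaussianD(3)[OF k(3)]] \<tau>'(3)
    by simp
  moreover have "\<tau> * p \<in> carrier_mat k n" using p \<tau> by auto
  note step[OF gx_triples_transport[OF assms] this \<tau>'(1) i]
  ultimately show ?thesis using step[OF assms] by auto
qed

text \<open>Membership in \<open>gx_hom\<close> provides some representative, which need not be the
  triple at hand; transport makes any member of the class usable as its representative.\<close>

lemma gx_hom_class:
  assumes F: "F \<in> gx_hom m n" "(f, \<psi>, p) \<in> F"
  shows "(f, \<psi>, p) \<in> gx_triples m n" "F = gx_class (f, \<psi>, p)"
proof -
  obtain f0 \<psi>0 p0 where t0: "(f0, \<psi>0, p0) \<in> gx_triples m n" and F0: "F = gx_class (f0, \<psi>0, p0)"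
    using F unfolding gx_hom_def quotient_def gx_class_def by auto
  obtain k where k: "p0 \<in> carrier_mat k n" using gx_triplesE[OF t0] by metis
  obtain \<tau> where \<tau>: "\<tau> \<in> carrier_mat k k" "invertible_mat \<tau>"
    "(f, \<psi>, p) = (\<tau> * f0, push \<tau> \<psi>0, \<tau> * p0)"
    using F(2)[unfolded F0] k by (rule gx_classE)
  show "(f, \<psi>, p) \<in> gx_triples m n" "F = gx_class (f, \<psi>, p)"
    using gx_triples_transport[OF t0 k \<tau>(1,2)] gx_class_transport[OF t0 k \<tau>(1,2)] \<tau>(3) F0 by auto
qed

lemma gx_name_class:
  assumes "(f, \<psi>, p) \<in> gx_triples m n"
  shows "gx_name (gx_class (f, \<psi>, p)) = gx_triple_name (f, \<psi>, p)"
proof (rule gx_name_eq)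
  show "gx_class (f, \<psi>, p) \<in> gx_hom m n"
    using assms unfolding gx_hom_def gx_class_def by (rule quotientI)
qed (rule gx_class_self[OF assms])

text \<open>Isomorphisms applied to the legs of the span can be absorbed into the legs of the
  pushout: a cocone \<open>a\<close>, \<open>b\<close> over \<open>p\<close>, \<open>g\<close> is
  the cocone \<open>a * \<tau>'\<close>, \<open>b * \<sigma>'\<close> over
  \<open>\<tau> * p\<close>, \<open>\<sigma> * g\<close>.\<close>

lemma is_pushout_transport:
  assumes po: "is_pushout (\<tau> * p) (\<sigma> * g) i\<^sub>1 i\<^sub>2"
    and p: "p \<in> carrier_mat k m" and g: "g \<in> carrier_mat k' m"
    and \<tau>: "\<tau> \<in> carrier_mat k k" "invertible_mat \<tau>" and \<sigma>: "\<sigma> \<in> carrier_mat k' k'" "invertible_mat \<sigma>"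
  shows "is_pushout p g (i\<^sub>1 * \<tau>) (i\<^sub>2 * \<sigma>)"
proof -
  have d: "dim_row (\<tau> * p) = k" "dim_row (\<sigma> * g) = k'" "dim_row p = k" "dim_row g = k'"
    using \<tau> \<sigma> p g by auto
  obtain \<tau>' where \<tau>': "\<tau>' \<in> carrier_mat k k" "\<tau> * \<tau>' = 1\<^sub>m k" "\<tau>' * \<tau> = 1\<^sub>m k"
    by (rule invertible_matE[OF \<tau>])
  obtain \<sigma>' where \<sigma>': "\<sigma>' \<in> carrier_mat k' k'" "\<sigma> * \<sigma>' = 1\<^sub>m k'" "\<sigma>' * \<sigma> = 1\<^sub>m k'"
    by (rule invertible_matE[OF \<sigma>])
  obtain w where i: "i\<^sub>1 \<in> carrier_mat w k" "i\<^sub>2 \<in> carrier_mat w k'"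
    and eq: "i\<^sub>1 * (\<tau> * p) = i\<^sub>2 * (\<sigma> * g)"
    and univ: "\<And>v a b. a \<in> carrier_mat v k \<Longrightarrow> b \<in> carrier_mat v k' \<Longrightarrow>
      a * (\<tau> * p) = b * (\<sigma> * g) \<Longrightarrow> \<exists>!u. u \<in> carrier_mat v w \<and> u * i\<^sub>1 = a \<and> u * i\<^sub>2 = b"
    using po unfolding is_pushout_def d by metis
  have cancel: "a * \<tau>' * \<tau> = a" "a * \<tau> * \<tau>' = a" if "a \<in> carrier_mat v k" for a v
    using that \<tau>(1) \<tau>' by (simp_all add: assoc_mult_mat[of a v k _ k])
  have cancel': "b * \<sigma>' * \<sigma> = b" "b * \<sigma> * \<sigma>' = b" if "b \<in> carrier_mat v k'" for b v
    using that \<sigma>(1) \<sigma>' by (simp_all add: assoc_mult_mat[of b v k' _ k'])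
  show ?thesis
    unfolding is_pushout_def d
  proof (intro exI[of _ w] conjI allI ballI impI)
    show "i\<^sub>1 * \<tau> * p = i\<^sub>2 * \<sigma> * g"
      using eq i p g \<tau>(1) \<sigma>(1) by (simp add: assoc_mult_mat[of i\<^sub>1 w k] assoc_mult_mat[of i\<^sub>2 w k'])
    fix v a b
    assume a: "a \<in> carrier_mat v k" and b: "b \<in> carrier_mat v k'" and ab: "a * p = b * g"
    have "a * \<tau>' * (\<tau> * p) = b * \<sigma>' * (\<sigma> * g)"
    proof -
      have "a * \<tau>' * (\<tau> * p) = a * \<tau>' * \<tau> * p"
        by (rule assoc_mult_mat[symmetric, of _ v k _ k _ m]) (use a \<tau> \<tau>' p in auto)
      moreover have "b * \<sigma>' * (\<sigma> * g) = b * \<sigma>' * \<sigma> * g"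
        by (rule assoc_mult_mat[symmetric, of _ v k' _ k' _ m]) (use b \<sigma> \<sigma>' g in auto)
      ultimately show ?thesis using ab cancel(1)[OF a] cancel'(1)[OF b] by simp
    qed
    then have ex1: "\<exists>!u. u \<in> carrier_mat v w \<and> u * i\<^sub>1 = a * \<tau>' \<and> u * i\<^sub>2 = b * \<sigma>'"
      using univ[of "a * \<tau>'" v "b * \<sigma>'"] a b \<tau>' \<sigma>' by auto
    have iff: "u * i\<^sub>1 = a * \<tau>' \<longleftrightarrow> u * (i\<^sub>1 * \<tau>) = a" "u * i\<^sub>2 = b * \<sigma>' \<longleftrightarrow> u * (i\<^sub>2 * \<sigma>) = b"
      if u: "u \<in> carrier_mat v w" for u
    proof -
      have "u * (i\<^sub>1 * \<tau>) = u * i\<^sub>1 * \<tau>" "u * (i\<^sub>2 * \<sigma>) = u * i\<^sub>2 * \<sigma>"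
        using u i \<tau>(1) \<sigma>(1) by (simp_all add: assoc_mult_mat[of u v w])
      moreover have "u * i\<^sub>1 \<in> carrier_mat v k" "u * i\<^sub>2 \<in> carrier_mat v k'" using u i by auto
      ultimately show "u * i\<^sub>1 = a * \<tau>' \<longleftrightarrow> u * (i\<^sub>1 * \<tau>) = a" "u * i\<^sub>2 = b * \<sigma>' \<longleftrightarrow> u * (i\<^sub>2 * \<sigma>) = b"
        using cancel cancel' a b by metis+
    qed
    from ex1 show "\<exists>!u. u \<in> carrier_mat v w \<and> u * (i\<^sub>1 * \<tau>) = a \<and> u * (i\<^sub>2 * \<sigma>) = b"
      using iff by (metis (no_types, lifting))
  qed (use i \<tau> \<sigma> in auto)
qed

lemma gx_comp_along_triples:
  assumes s: "(f, \<psi>, p) \<in> gx_triples l m" and t: "(g, \<chi>, q) \<in> gx_triples m n"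
    and i: "i\<^sub>1 \<in> carrier_mat w (dim_row p)" "i\<^sub>2 \<in> carrier_mat w (dim_row g)"
    and coker: "split_cokernel (p @\<^sub>r (- g)) (i\<^sub>1 @\<^sub>c i\<^sub>2) S"
  shows "gx_comp_along i\<^sub>1 i\<^sub>2 (f, \<psi>, p) (g, \<chi>, q) \<in> gx_triples l n"
proof -
  obtain k where k: "f \<in> carrier_mat k l" "p \<in> carrier_mat k m" "surj_mat p" "gaussian k \<psi>"
    by (rule gx_triplesE[OF s])
  obtain k' where k': "g \<in> carrier_mat k' m" "q \<in> carrier_mat k' n" "surj_mat q" "gaussian k' \<chi>"
    by (rule gx_triplesE[OF t])
  have i: "i\<^sub>1 \<in> carrier_mat w k" "i\<^sub>2 \<in> carrier_mat w k'" using i k k' by auto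
  have "is_pushout p g i\<^sub>1 i\<^sub>2" by (rule is_pushout_of_split_cokernel[OF i k(2) k'(1) coker])
  then have eq: "i\<^sub>1 * p = i\<^sub>2 * g" unfolding is_pushout_def by blast
  have S: "S \<in> carrier_mat (k + k') w" and CS: "(i\<^sub>1 @\<^sub>c i\<^sub>2) * S = 1\<^sub>m w"
    using coker i k k' unfolding split_cokernel_def by auto
  obtain p' where p': "p' \<in> carrier_mat m k" "p * p' = 1\<^sub>m k"
    by (rule surj_mat_right_inverse[OF k(2,3)])
  obtain q' where q': "q' \<in> carrier_mat n k'" "q * q' = 1\<^sub>m k'"
    by (rule surj_mat_right_inverse[OF k'(2,3)])
  have C: "i\<^sub>1 @\<^sub>c i\<^sub>2 \<in> carrier_mat w (k + k')" by (rule carrier_matI) (use i in auto)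
  have "gaussian w (conv_dist w (push i\<^sub>1 \<psi>) (push i\<^sub>2 \<chi>))"
    unfolding conv_dist_push[OF k(4) k'(4) i]
    by (rule gaussian_push[OF gaussian_product_dist[OF k(4) k'(4)] C])
  \<comment> \<open>Pushouts preserve surjections. The section writes \<open>z\<close> as the sum of
    the images of some \<open>a\<close> and \<open>b\<close>; since \<open>p\<close> is onto and
    \<open>i\<^sub>1 * p = i\<^sub>2 * g\<close>, the contribution of \<open>a\<close> also lies in
    the image of \<open>i\<^sub>2\<close>, and then \<open>q\<close> reaches the total.\<close>
  moreover have "surj_mat (i\<^sub>2 * q)"
    unfolding surj_mat_def
  proof (intro equalityI subsetI)
    fix z :: rvec assume "z \<in> carrier_vec (dim_row (i\<^sub>2 * q))"
    then have z: "dim_vec z = w" using i by simp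
    have "S *\<^sub>v z \<in> carrier_vec (k + k')" by (rule carrier_vecI) (use S in simp)
    then obtain a b where ab: "S *\<^sub>v z = a @\<^sub>v b" "dim_vec a = k" "dim_vec b = k'"
      by (rule carrier_vec_appendE)
    have "z = i\<^sub>1 *\<^sub>v a + i\<^sub>2 *\<^sub>v b"
      using mat_mult_eqD[OF CS, of z] S i z ab by (simp add: mat_action_simps)
    also have "i\<^sub>1 *\<^sub>v a = i\<^sub>1 *\<^sub>v (p *\<^sub>v (p' *\<^sub>v a))"
      using mat_mult_eqD[OF p'(2), of a] k p' ab by (simp add: one_mat_mult_vec)
    also have "\<dots> = i\<^sub>2 *\<^sub>v (g *\<^sub>v (p' *\<^sub>v a))"
      using mat_mult_eqD[OF eq, of "p' *\<^sub>v a"] i k k' p' by (simp add: mat_action_simps)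
    also have "\<dots> + i\<^sub>2 *\<^sub>v b = i\<^sub>2 *\<^sub>v (g *\<^sub>v (p' *\<^sub>v a) + b)"
      using i k' ab by (simp add: mult_mat_vec_add)
    also have "\<dots> = (i\<^sub>2 * q) *\<^sub>v (q' *\<^sub>v (g *\<^sub>v (p' *\<^sub>v a) + b))"
      using mat_mult_eqD[OF q'(2), of "g *\<^sub>v (p' *\<^sub>v a) + b"] i k' q' ab
      by (simp add: mult_mat_mult_vec one_mat_mult_vec)
    finally show "z \<in> (\<lambda>y. (i\<^sub>2 * q) *\<^sub>v y) ` carrier_vec (dim_col (i\<^sub>2 * q))"
      by (rule image_eqI) (use q' k' in \<open>auto intro: carrier_vecI\<close>)
  qed (use i in \<open>auto intro: carrier_vecI\<close>)
  moreover have "i\<^sub>1 * f \<in> carrier_mat w l" "i\<^sub>2 * q \<in> carrier_mat w n" "dim_row i\<^sub>1 = w"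
    using i k k' by auto
  ultimately show ?thesis by (simp add: gx_triplesI)
qed

text \<open>Independence of all choices. Other representatives and another pushout for them yield,
  after absorbing the two isomorphisms, a second pushout of the original span. The comparison matrix
  \<open>\<rho>\<close> between the two pushouts then relates the composite triples.\<close>

lemma gx_comp_class:
  assumes s: "(f, \<psi>, p) \<in> gx_triples l m" and t: "(g, \<chi>, q) \<in> gx_triples m n"
    and i: "i\<^sub>1 \<in> carrier_mat w (dim_row p)" "i\<^sub>2 \<in> carrier_mat w (dim_row g)"
    and coker: "split_cokernel (p @\<^sub>r (- g)) (i\<^sub>1 @\<^sub>c i\<^sub>2) S"
  shows "gx_class (f, \<psi>, p) ;; gx_class (g, \<chi>, q) = gx_class (gx_comp_along i\<^sub>1 i\<^sub>2 (f, \<psi>, p) (g, \<chi>, q))"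
proof -
  obtain k where k: "f \<in> carrier_mat k l" "p \<in> carrier_mat k m" "surj_mat p" "gaussian k \<psi>"
    by (rule gx_triplesE[OF s])
  obtain k' where k': "g \<in> carrier_mat k' m" "q \<in> carrier_mat k' n" "surj_mat q" "gaussian k' \<chi>"
    by (rule gx_triplesE[OF t])
  note i0 = i
  have i: "i\<^sub>1 \<in> carrier_mat w k" "i\<^sub>2 \<in> carrier_mat w k'" using i k k' by auto
  note se = gaussianD(3)[OF k(4)] gaussianD(3)[OF k'(4)]
  have po: "is_pushout p g i\<^sub>1 i\<^sub>2" by (rule is_pushout_of_split_cokernel[OF i k(2) k'(1) coker])
  have comp: "gx_comp_along i\<^sub>1 i\<^sub>2 (f, \<psi>, p) (g, \<chi>, q) =
      (i\<^sub>1 * f, push (i\<^sub>1 @\<^sub>c i\<^sub>2) (product_dist k k' \<psi> \<chi>), i\<^sub>2 * q)"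
    using conv_dist_push[OF k(4) k'(4) i] i by simp
  note comp_triple = gx_comp_along_triples[OF s t i0 coker, unfolded comp]
  have "gx_class (gx_comp_along j\<^sub>1 j\<^sub>2 (f', \<psi>', p') (g', \<chi>', q')) =
      gx_class (gx_comp_along i\<^sub>1 i\<^sub>2 (f, \<psi>, p) (g, \<chi>, q))"
    if F': "(f', \<psi>', p') \<in> gx_class (f, \<psi>, p)" and G': "(g', \<chi>', q') \<in> gx_class (g, \<chi>, q)"
      and J: "is_pushout p' g' j\<^sub>1 j\<^sub>2"
    for f' \<psi>' p' g' \<chi>' q' j\<^sub>1 j\<^sub>2
  proof -
    obtain \<tau> where \<tau>: "\<tau> \<in> carrier_mat k k" "invertible_mat \<tau>"
      and s': "f' = \<tau> * f" "\<psi>' = push \<tau> \<psi>" "p' = \<tau> * p"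
      using gx_classE[OF F' k(2)] by blast
    obtain \<sigma> where \<sigma>: "\<sigma> \<in> carrier_mat k' k'" "invertible_mat \<sigma>"
      and t': "g' = \<sigma> * g" "\<chi>' = push \<sigma> \<chi>" "q' = \<sigma> * q"
      using gx_classE[OF G' k'(2)] by blast
    have po': "is_pushout p g (j\<^sub>1 * \<tau>) (j\<^sub>2 * \<sigma>)"
      using is_pushout_transport[OF _ k(2) k'(1) \<tau> \<sigma>] J s' t' by simp
    obtain \<rho> where \<rho>: "\<rho> \<in> carrier_mat w w" "invertible_mat \<rho>" "j\<^sub>1 * \<tau> = \<rho> * i\<^sub>1" "j\<^sub>2 * \<sigma> = \<rho> * i\<^sub>2"
      using is_pushout_unique[OF po po'] i by auto
    have "dim_row j\<^sub>1 = w" "dim_row j\<^sub>2 = w"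
      using arg_cong[OF \<rho>(3), of dim_row] arg_cong[OF \<rho>(4), of dim_row] \<rho>(1) by auto
    moreover have "dim_col j\<^sub>1 = k" "dim_col j\<^sub>2 = k'"
      using J \<tau>(1) \<sigma>(1) unfolding is_pushout_def s' t' by auto
    ultimately have j: "j\<^sub>1 \<in> carrier_mat w k" "j\<^sub>2 \<in> carrier_mat w k'" by auto
    have C: "i\<^sub>1 @\<^sub>c i\<^sub>2 \<in> carrier_mat w (k + k')" by (rule carrier_matI) (use i in auto)
    \<comment> \<open>The noise component must be transported by the same \<open>\<rho>\<close> as
      the two linear maps: both summands acquire the factor \<open>\<rho>\<close>, which then comes
      out of the block matrix.\<close>
    have "conv_dist w (push j\<^sub>1 \<psi>') (push j\<^sub>2 \<chi>') = conv_dist w (push (\<rho> * i\<^sub>1) \<psi>) (push (\<rho> * i\<^sub>2) \<chi>)"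
      unfolding s' t' using push_push[OF se(1) \<tau>(1) j(1)] push_push[OF se(2) \<sigma>(1) j(2)] \<rho> by simp
    also have "\<dots> = push (\<rho> * i\<^sub>1 @\<^sub>c \<rho> * i\<^sub>2) (product_dist k k' \<psi> \<chi>)"
      by (rule conv_dist_push[OF k(4) k'(4)]) (use \<rho>(1) i in auto)
    also have "\<rho> * i\<^sub>1 @\<^sub>c \<rho> * i\<^sub>2 = \<rho> * (i\<^sub>1 @\<^sub>c i\<^sub>2)"
      by (rule mult_append_cols[symmetric]) (use \<rho>(1) i in auto)
    also have "push \<dots> (product_dist k k' \<psi> \<chi>) = push \<rho> (push (i\<^sub>1 @\<^sub>c i\<^sub>2) (product_dist k k' \<psi> \<chi>))"
      by (rule push_push[symmetric, OF _ C \<rho>(1)]) (simp add: product_dist_def)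
    finally have conv: "conv_dist w (push j\<^sub>1 \<psi>') (push j\<^sub>2 \<chi>') =
      push \<rho> (push (i\<^sub>1 @\<^sub>c i\<^sub>2) (product_dist k k' \<psi> \<chi>))" .
    have "j\<^sub>1 * f' = \<rho> * (i\<^sub>1 * f)"
      using assoc_mult_mat[OF j(1) \<tau>(1) k(1)] assoc_mult_mat[OF \<rho>(1) i(1) k(1)] \<rho>(3) s'(1) by simp
    moreover have "j\<^sub>2 * q' = \<rho> * (i\<^sub>2 * q)"
      using assoc_mult_mat[OF j(2) \<sigma>(1) k'(2)] assoc_mult_mat[OF \<rho>(1) i(2) k'(2)] \<rho>(4) t'(3) by simp
    moreover note gx_class_transport[OF comp_triple mult_carrier_mat[OF i(2) k'(2)] \<rho>(1,2)]
    ultimately show ?thesis using conv j unfolding comp by simp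
  qed
  moreover have "(f, \<psi>, p) \<in> gx_class (f, \<psi>, p)" "(g, \<chi>, q) \<in> gx_class (g, \<chi>, q)"
    using gx_class_self s t by auto
  ultimately show ?thesis
    unfolding gx_comp_def using po
    by (intro Union_eq_const[of "gx_class (gx_comp_along i\<^sub>1 i\<^sub>2 (f, \<psi>, p) (g, \<chi>, q))"]) (fast, fast)
qed

lemma gx_tensor_triple_triples:
  assumes s: "(f, \<psi>, p) \<in> gx_triples m n" and t: "(g, \<chi>, q) \<in> gx_triples m' n'"
  shows "gx_tensor_triple (f, \<psi>, p) (g, \<chi>, q) \<in> gx_triples (m + m') (n + n')"
proof -
  obtain k where k: "f \<in> carrier_mat k m" "p \<in> carrier_mat k n" "surj_mat p" "gaussian k \<psi>"
    by (rule gx_triplesE[OF s])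
  obtain k' where k': "g \<in> carrier_mat k' m'" "q \<in> carrier_mat k' n'" "surj_mat q" "gaussian k' \<chi>"
    by (rule gx_triplesE[OF t])
  show ?thesis
    using gx_triplesI[OF prod_mat_carrier[OF k(1) k'(1)] prod_mat_carrier[OF k(2) k'(2)]
        surj_mat_prod[OF k(3) k'(3)] gaussian_product_dist[OF k(4) k'(4)]] k(2) k'(2) by simp
qed

text \<open>Changing the representatives by \<open>\<tau>\<close> and \<open>\<sigma>\<close>
  changes the tensor triple by the single invertible matrix
  \<open>prod_mat \<tau> \<sigma>\<close>.\<close>

lemma gx_tensor_class:
  assumes s: "(f, \<psi>, p) \<in> gx_triples m n" and t: "(g, \<chi>, q) \<in> gx_triples m' n'"
  shows "gx_class (f, \<psi>, p) \<otimes>\<^sub>g gx_class (g, \<chi>, q) = gx_class (gx_tensor_triple (f, \<psi>, p) (g, \<chi>, q))"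
proof -
  obtain k where k: "f \<in> carrier_mat k m" "p \<in> carrier_mat k n" "surj_mat p" "gaussian k \<psi>"
    by (rule gx_triplesE[OF s])
  obtain k' where k': "g \<in> carrier_mat k' m'" "q \<in> carrier_mat k' n'" "surj_mat q" "gaussian k' \<chi>"
    by (rule gx_triplesE[OF t])
  have tens: "gx_tensor_triple (f, \<psi>, p) (g, \<chi>, q) =
      (prod_mat f g, product_dist k k' \<psi> \<chi>, prod_mat p q)"
    using k k' by simp
  note tens_triple = gx_tensor_triple_triples[OF s t, unfolded tens]
  have "gx_class (gx_tensor_triple s' t') = gx_class (gx_tensor_triple (f, \<psi>, p) (g, \<chi>, q))"
    if F': "s' \<in> gx_class (f, \<psi>, p)" and G': "t' \<in> gx_class (g, \<chi>, q)" for s' t'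
  proof -
    obtain \<tau> where \<tau>: "\<tau> \<in> carrier_mat k k" "invertible_mat \<tau>"
      and s': "s' = (\<tau> * f, push \<tau> \<psi>, \<tau> * p)"
      using gx_classE[OF F' k(2)] by blast
    obtain \<sigma> where \<sigma>: "\<sigma> \<in> carrier_mat k' k'" "invertible_mat \<sigma>"
      and t': "t' = (\<sigma> * g, push \<sigma> \<chi>, \<sigma> * q)"
      using gx_classE[OF G' k'(2)] by blast
    have "gx_tensor_triple s' t' = (prod_mat \<tau> \<sigma> * prod_mat f g,
        push (prod_mat \<tau> \<sigma>) (product_dist k k' \<psi> \<chi>), prod_mat \<tau> \<sigma> * prod_mat p q)"
      unfolding s' t' using k k' \<tau>(1) \<sigma>(1) product_dist_push[OF k(4) k'(4) \<tau>(1) \<sigma>(1)]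
      by (simp add: prod_mat_mult)
    then show ?thesis
      unfolding tens using gx_class_transport[OF tens_triple prod_mat_carrier[OF k(2) k'(2)]
          prod_mat_carrier[OF \<tau>(1) \<sigma>(1)] invertible_prod_mat[OF \<tau> \<sigma>]] by simp
  qed
  moreover have "(f, \<psi>, p) \<in> gx_class (f, \<psi>, p)" "(g, \<chi>, q) \<in> gx_class (g, \<chi>, q)"
    using gx_class_self s t by auto
  ultimately show ?thesis
    unfolding gx_tensor_def
    by (intro Union_eq_const[of "gx_class (gx_tensor_triple (f, \<psi>, p) (g, \<chi>, q))"]) (fast, fast)
qed

lemma gx_linear_triple:
  assumes "h \<in> carrier_mat n m"
  shows "(h, dirac n (0\<^sub>v n), 1\<^sub>m n) \<in> gx_triples m n"
proof -
  have "surj_mat (1\<^sub>m n :: rmat)" by (rule surj_mat_if_right_inverse[of _ "1\<^sub>m n"]) simp_all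
  then show ?thesis using assms gaussian_dirac[of "0\<^sub>v n" n] by (intro gx_triplesI) auto
qed

section \<open>Systems presented by a matrix\<close>

lemma vec_add_diff_cancel: "dim_vec x = dim_vec y \<Longrightarrow> x + (y - x) = (y :: rvec)"
  by (rule eq_vecI) auto

definition preim :: "nat \<Rightarrow> rmat \<Rightarrow> rvec set \<Rightarrow> rvec set" where
  "preim N H A = {v \<in> carrier_vec N. H *\<^sub>v v \<in> A}"

text \<open>The pullback of \<open>\<psi>\<close> along \<open>H\<close>, stated as a property and
  not as a construction, because names, weakenings and eliminations are built in different ways. The
  property determines the system, so two systems are equal as soon as they share matrix and
  noise.\<close>

definition presents :: "nat \<Rightarrow> rmat \<Rightarrow> rvec measure \<Rightarrow> rvec measure \<Rightarrow> bool" where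
  "presents N H \<psi> M \<longleftrightarrow> space M = carrier_vec N \<and> sets M = preim N H ` sets \<psi> \<and>
     (\<forall>A\<in>sets \<psi>. emeasure M (preim N H A) = emeasure \<psi> A)"

lemma presents_unique:
  assumes "presents N H \<psi> M" "presents N H \<psi> M'"
  shows "M = M'"
  by (rule measure_eqI) (use assms in \<open>auto simp: presents_def\<close>)

lemma preim_borel:
  assumes "H \<in> carrier_mat k N" "A \<in> sets (borel_vec k)"
  shows "preim N H A \<in> sets (borel_vec N)"
proof -
  have "preim N H A = (\<lambda>v. H *\<^sub>v v) -` A \<inter> space (borel_vec N)" by (auto simp: preim_def)
  then show ?thesis using measurable_sets[OF measurable_mult_mat_vec] assms by metis
qed

text \<open>An intersection of one event from each system is the preimage of a box, and on boxes the
  product measure factors.\<close>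

lemma preim_append_rows:
  assumes "H\<^sub>1 \<in> carrier_mat k N" "H\<^sub>2 \<in> carrier_mat k' N"
    "A \<subseteq> carrier_vec k" "B \<subseteq> carrier_vec k'"
  shows "preim N (H\<^sub>1 @\<^sub>r H\<^sub>2) {u @\<^sub>v w | u w. u \<in> A \<and> w \<in> B} = preim N H\<^sub>1 A \<inter> preim N H\<^sub>2 B"
proof -
  have "(H\<^sub>1 *\<^sub>v v) @\<^sub>v (H\<^sub>2 *\<^sub>v v) \<in> {u @\<^sub>v w | u w. u \<in> A \<and> w \<in> B} \<longleftrightarrow>
      H\<^sub>1 *\<^sub>v v \<in> A \<and> H\<^sub>2 *\<^sub>v v \<in> B" for v
  proof
    assume "(H\<^sub>1 *\<^sub>v v) @\<^sub>v (H\<^sub>2 *\<^sub>v v) \<in> {u @\<^sub>v w | u w. u \<in> A \<and> w \<in> B}"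
    then obtain u w where uw: "(H\<^sub>1 *\<^sub>v v) @\<^sub>v (H\<^sub>2 *\<^sub>v v) = u @\<^sub>v w" "u \<in> A" "w \<in> B" by blast
    have "dim_vec u = k" using uw(2) assms(3) by (meson carrier_vecD subsetD)
    then have "H\<^sub>1 *\<^sub>v v = u \<and> H\<^sub>2 *\<^sub>v v = w"
      using uw(1) assms(1) append_vec_eq_iff[of "H\<^sub>1 *\<^sub>v v" u "H\<^sub>2 *\<^sub>v v" w] by simp
    then show "H\<^sub>1 *\<^sub>v v \<in> A \<and> H\<^sub>2 *\<^sub>v v \<in> B" using uw by simp
  qed blast
  moreover have "(H\<^sub>1 @\<^sub>r H\<^sub>2) *\<^sub>v v = (H\<^sub>1 *\<^sub>v v) @\<^sub>v (H\<^sub>2 *\<^sub>v v)" if "v \<in> carrier_vec N" for v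
    by (rule append_rows_mult_vec) (use that assms(1,2) in auto)
  ultimately have "(H\<^sub>1 @\<^sub>r H\<^sub>2) *\<^sub>v v \<in> {u @\<^sub>v w | u w. u \<in> A \<and> w \<in> B} \<longleftrightarrow>
      H\<^sub>1 *\<^sub>v v \<in> A \<and> H\<^sub>2 *\<^sub>v v \<in> B" if "v \<in> carrier_vec N" for v
    using that by presburger
  then show ?thesis unfolding preim_def by blast
qed

lemma presents_prob_space:
  assumes M: "presents N H \<psi> M" and H: "H \<in> carrier_mat k N"
    and \<psi>: "prob_space \<psi>" "space \<psi> = carrier_vec k"
  shows "prob_space M"
proof (rule prob_spaceI)
  have "preim N H (space \<psi>) = space M" using M H \<psi>(2) by (auto simp: preim_def presents_def)
  then have "emeasure M (space M) = emeasure \<psi> (space \<psi>)"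
    using M by (metis presents_def sets.top)
  then show "emeasure M (space M) = 1" using prob_space.emeasure_space_1[OF \<psi>(1)] by simp
qed

text \<open>The fibre is the kernel of \<open>H\<close>. An invariant Borel set \<open>E\<close> is
  the preimage under \<open>H\<close> of the set of all w with \<open>R *\<^sub>v w\<close> in
  \<open>E\<close>, since \<open>R *\<^sub>v (H *\<^sub>v v)\<close> and \<open>v\<close> differ by
  a kernel vector. Using the preimage under \<open>R\<close>, and not the image of \<open>E\<close>
  under \<open>H\<close>, keeps the set Borel.\<close>

lemma presents_linear_system:
  assumes M: "presents N H \<psi> M" and H: "H \<in> carrier_mat k N"
    and R: "R \<in> carrier_mat N k" "H * R = 1\<^sub>m k" and \<psi>: "gaussian k \<psi>"
  shows "linear_system N {v \<in> carrier_vec N. H *\<^sub>v v = 0\<^sub>v k} M"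
proof -
  let ?D = "{v \<in> carrier_vec N. H *\<^sub>v v = 0\<^sub>v k}"
  have "VectorSpace.subspace class_ring ?D (module_vec TYPE(real) N)"
  proof (rule VectorSpace.subspace.intro)
    show vs: "vectorspace class_ring (module_vec TYPE(real) N)" by (rule vec_vs)
    show "LinearCombinations.submodule class_ring ?D (module_vec TYPE(real) N)"
      unfolding LinearCombinations.submodule_def
    proof (intro conjI allI impI)
      show "Module.module class_ring (module_vec TYPE(real) N)"
        using vs by (rule vectorspace.axioms)
      have "H *\<^sub>v 0\<^sub>v N = 0\<^sub>v k" using mult_mat_vec_zero[of H] H by simp
      then show "\<zero>\<^bsub>module_vec TYPE(real) N\<^esub> \<in> ?D" by (simp add: module_vec_simps)
    qed (use H in \<open>auto simp: module_vec_simps mult_mat_vec_add mult_mat_vec_smult\<close>)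
  qed
  moreover have "prob_space M" using presents_prob_space[OF M H] gaussianD \<psi> by blast
  moreover have "preim N H ` sets \<psi> = invariant_borel N ?D"
  proof (intro equalityI subsetI)
    fix E assume "E \<in> preim N H ` sets \<psi>"
    then obtain A where A: "A \<in> sets (borel_vec k)" "E = preim N H A" using gaussianD(3)[OF \<psi>] by auto
    have "a + d \<in> E" if "a \<in> E" "d \<in> ?D" for a d
      using that H unfolding A(2) preim_def by (auto simp: mult_mat_vec_add)
    then show "E \<in> invariant_borel N ?D"
      unfolding invariant_borel_def A(2) using preim_borel[OF H A(1)] by blast
  next
    fix E assume E: "E \<in> invariant_borel N ?D"
    then have Eb: "E \<in> sets (borel_vec N)" and inv: "\<And>a d. a \<in> E \<Longrightarrow> d \<in> ?D \<Longrightarrow> a + d \<in> E"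
      unfolding invariant_borel_def by blast+
    have Ec: "v \<in> carrier_vec N" if "v \<in> E" for v
      using sets.sets_into_space[OF Eb] that by auto
    have "preim N H (preim k R E) = E"
    proof -
      have "R *\<^sub>v (H *\<^sub>v v) \<in> E \<longleftrightarrow> v \<in> E" if v: "v \<in> carrier_vec N" for v
      proof -
        have HR: "H *\<^sub>v (R *\<^sub>v (H *\<^sub>v v)) = H *\<^sub>v v"
          using mat_mult_eqD[OF R(2), of "H *\<^sub>v v"] H R(1) by (simp add: one_mat_mult_vec)
        have z: "x - y \<in> ?D" if "x \<in> carrier_vec N" "y \<in> carrier_vec N" "H *\<^sub>v x = H *\<^sub>v y" for x y
          using that H by (simp add: mult_mat_vec_diff minus_cancel_vec[OF carrier_vecI])
        have c: "R *\<^sub>v (H *\<^sub>v v) \<in> carrier_vec N" by (rule carrier_vecI) (use R in simp)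
        have "v + (R *\<^sub>v (H *\<^sub>v v) - v) = R *\<^sub>v (H *\<^sub>v v)" "R *\<^sub>v (H *\<^sub>v v) + (v - R *\<^sub>v (H *\<^sub>v v)) = v"
          by (rule vec_add_diff_cancel; use v R in simp)+
        then show ?thesis
          using inv[of v "R *\<^sub>v (H *\<^sub>v v) - v"] inv[of "R *\<^sub>v (H *\<^sub>v v)" "v - R *\<^sub>v (H *\<^sub>v v)"]
            z[OF c v HR] z[OF v c HR[symmetric]] by metis
      qed
      moreover have "H *\<^sub>v v \<in> carrier_vec k" for v by (rule carrier_vecI) (use H in simp)
      ultimately show ?thesis using Ec unfolding preim_def by blast
    qed
    moreover have "preim k R E \<in> sets \<psi>" using preim_borel[OF R(1) Eb] gaussianD(3)[OF \<psi>] by simp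
    ultimately show "E \<in> preim N H ` sets \<psi>" by (metis imageI)
  qed
  ultimately show ?thesis using M by (simp add: linear_system_def presents_def)
qed

text \<open>An extension of the measure to all Borel sets is the pushforward of
  \<open>\<psi>\<close> along the right inverse, a Gaussian carried by the range of
  \<open>R\<close>. As \<open>H * R\<close> is the identity, it gives the preimage of
  \<open>A\<close> under \<open>H\<close> the mass of \<open>A\<close>.\<close>

lemma presents_gaussian_system:
  assumes M: "presents N H \<psi> M" and H: "H \<in> carrier_mat k N"
    and R: "R \<in> carrier_mat N k" "H * R = 1\<^sub>m k" and \<psi>: "gaussian k \<psi>"
  shows "gaussian_system N {v \<in> carrier_vec N. H *\<^sub>v v = 0\<^sub>v k} M"
  unfolding gaussian_system_def
proof (intro conjI exI ballI)
  show "linear_system N {v \<in> carrier_vec N. H *\<^sub>v v = 0\<^sub>v k} M"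
    by (rule presents_linear_system[OF assms])
  show "gaussian N (push R \<psi>)" by (rule gaussian_push[OF \<psi> R(1)])
  fix E assume "E \<in> sets M"
  then obtain A where A: "A \<in> sets \<psi>" "E = preim N H A" using M by (auto simp: presents_def)
  have Ak: "A \<in> sets (borel_vec k)" using A(1) gaussianD(3)[OF \<psi>] by simp
  have "H *\<^sub>v (R *\<^sub>v w) = w" if "w \<in> carrier_vec k" for w
    using mat_mult_eqD[OF R(2), of w] that H R(1) by (simp add: one_mat_mult_vec)
  moreover have "A \<subseteq> carrier_vec k" using sets.sets_into_space[OF Ak] by simp
  moreover have "R *\<^sub>v w \<in> carrier_vec N" for w by (rule carrier_vecI) (use R in simp)
  ultimately have pre: "(\<lambda>w. R *\<^sub>v w) -` preim N H A \<inter> space \<psi> = A"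
    using gaussianD(2)[OF \<psi>] by (auto simp: preim_def)
  have "emeasure (push R \<psi>) (preim N H A) = emeasure \<psi> A"
    using emeasure_distr[OF measurable_mult_mat_vec'[OF gaussianD(3)[OF \<psi>] R(1)] preim_borel[OF H Ak]]
      R(1) pre by (simp add: push_def)
  then show "emeasure M E = emeasure (push R \<psi>) E" using A M by (simp add: presents_def)
qed

lemma presents_name:
  assumes t: "(f, \<psi>, p) \<in> gx_triples m n"
  shows "presents (m + n) ((- f) @\<^sub>c p) \<psi> (gx_triple_name (f, \<psi>, p))"
proof -
  obtain k where k: "f \<in> carrier_mat k m" "p \<in> carrier_mat k n" by (rule gx_triplesE[OF t])
  have "name_event f p A = preim (m + n) ((- f) @\<^sub>c p) A" for A
  proof (intro Set.set_eqI iffI)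
    fix v assume "v \<in> name_event f p A"
    then obtain x y where v: "v = x @\<^sub>v y" "x \<in> carrier_vec m" "y \<in> carrier_vec n"
      "p *\<^sub>v y - f *\<^sub>v x \<in> A"
      using k unfolding name_event_def by auto
    have "((- f) @\<^sub>c p) *\<^sub>v v = p *\<^sub>v y - f *\<^sub>v x"
      by (rule eq_vecI) (use v k in \<open>simp_all add: append_cols_mult_vec\<close>)
    then show "v \<in> preim (m + n) ((- f) @\<^sub>c p) A" using v by (simp add: preim_def)
  next
    fix v assume "v \<in> preim (m + n) ((- f) @\<^sub>c p) A"
    then have v: "v \<in> carrier_vec (m + n)" "((- f) @\<^sub>c p) *\<^sub>v v \<in> A" by (auto simp: preim_def)
    obtain x y where xy: "v = x @\<^sub>v y" "dim_vec x = m" "dim_vec y = n"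
      by (rule carrier_vec_appendE[OF v(1)])
    have "((- f) @\<^sub>c p) *\<^sub>v v = p *\<^sub>v y - f *\<^sub>v x"
      by (rule eq_vecI) (use xy k in \<open>simp_all add: append_cols_mult_vec\<close>)
    then show "v \<in> name_event f p A"
      using v(2) xy k carrier_vecI[OF xy(2)] carrier_vecI[OF xy(3)] unfolding name_event_def by auto
  qed
  then show ?thesis
    unfolding presents_def
    using space_gx_triple_name[OF t] sets_gx_triple_name[OF t] emeasure_gx_triple_name[OF t] by simp
qed

lemma presents_weaken_right:
  assumes P: "presents N H \<psi> P" and H: "H \<in> carrier_mat k N"
  shows "presents (N + n) (H @\<^sub>c 0\<^sub>m k n) \<psi> (weaken_right n P)"
proof -
  have "vec_times (preim N H A) (carrier_vec n) = preim (N + n) (H @\<^sub>c 0\<^sub>m k n) A" for A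
  proof (intro Set.set_eqI iffI)
    fix v assume "v \<in> vec_times (preim N H A) (carrier_vec n)"
    then obtain a b where v: "v = a @\<^sub>v b" "a \<in> carrier_vec N" "H *\<^sub>v a \<in> A" "b \<in> carrier_vec n"
      unfolding vec_times_def preim_def by blast
    have "(H @\<^sub>c 0\<^sub>m k n) *\<^sub>v v = H *\<^sub>v a"
      by (rule eq_vecI) (use v H in \<open>simp_all add: append_cols_mult_vec zero_mat_mult_vec\<close>)
    then show "v \<in> preim (N + n) (H @\<^sub>c 0\<^sub>m k n) A" using v by (simp add: preim_def)
  next
    fix v assume "v \<in> preim (N + n) (H @\<^sub>c 0\<^sub>m k n) A"
    then have v: "v \<in> carrier_vec (N + n)" "(H @\<^sub>c 0\<^sub>m k n) *\<^sub>v v \<in> A" by (auto simp: preim_def)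
    obtain a b where ab: "v = a @\<^sub>v b" "dim_vec a = N" "dim_vec b = n"
      by (rule carrier_vec_appendE[OF v(1)])
    have "(H @\<^sub>c 0\<^sub>m k n) *\<^sub>v v = H *\<^sub>v a"
      by (rule eq_vecI) (use ab H in \<open>simp_all add: append_cols_mult_vec zero_mat_mult_vec\<close>)
    then show "v \<in> vec_times (preim N H A) (carrier_vec n)"
      using v(2) ab carrier_vecI[OF ab(2)] carrier_vecI[OF ab(3)]
      unfolding vec_times_def preim_def by auto
  qed
  note vt = this
  have sp: "space P = carrier_vec N" using P by (simp add: presents_def)
  have "emeasure (weaken_right n P) (preim (N + n) (H @\<^sub>c 0\<^sub>m k n) A) = emeasure \<psi> A" if "A \<in> sets \<psi>" for A
    unfolding vt[symmetric] using P that emeasure_weaken_right[OF sp, of "preim N H A" n]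
    by (simp add: presents_def)
  moreover have "sets (weaken_right n P) = preim (N + n) (H @\<^sub>c 0\<^sub>m k n) ` sets \<psi>"
    using P sets_weaken_right[OF sp, of n] by (simp add: presents_def image_image vt)
  ultimately show ?thesis
    unfolding presents_def using space_weaken_right[OF sp] by simp
qed

lemma presents_weaken_left:
  assumes P: "presents N H \<psi> P" and H: "H \<in> carrier_mat k N"
  shows "presents (l + N) (0\<^sub>m k l @\<^sub>c H) \<psi> (weaken_left l P)"
proof -
  have "vec_times (carrier_vec l) (preim N H A) = preim (l + N) (0\<^sub>m k l @\<^sub>c H) A" for A
  proof (intro Set.set_eqI iffI)
    fix v assume "v \<in> vec_times (carrier_vec l) (preim N H A)"
    then obtain a b where v: "v = a @\<^sub>v b" "a \<in> carrier_vec l" "b \<in> carrier_vec N" "H *\<^sub>v b \<in> A"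
      unfolding vec_times_def preim_def by blast
    have "(0\<^sub>m k l @\<^sub>c H) *\<^sub>v v = H *\<^sub>v b"
      by (rule eq_vecI) (use v H in \<open>simp_all add: append_cols_mult_vec zero_mat_mult_vec\<close>)
    then show "v \<in> preim (l + N) (0\<^sub>m k l @\<^sub>c H) A" using v by (simp add: preim_def)
  next
    fix v assume "v \<in> preim (l + N) (0\<^sub>m k l @\<^sub>c H) A"
    then have v: "v \<in> carrier_vec (l + N)" "(0\<^sub>m k l @\<^sub>c H) *\<^sub>v v \<in> A" by (auto simp: preim_def)
    obtain a b where ab: "v = a @\<^sub>v b" "dim_vec a = l" "dim_vec b = N"
      by (rule carrier_vec_appendE[OF v(1)])
    have "(0\<^sub>m k l @\<^sub>c H) *\<^sub>v v = H *\<^sub>v b"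
      by (rule eq_vecI) (use ab H in \<open>simp_all add: append_cols_mult_vec zero_mat_mult_vec\<close>)
    then show "v \<in> vec_times (carrier_vec l) (preim N H A)"
      using v(2) ab carrier_vecI[OF ab(2)] carrier_vecI[OF ab(3)]
      unfolding vec_times_def preim_def by auto
  qed
  note vt = this
  have sp: "space P = carrier_vec N" using P by (simp add: presents_def)
  have "emeasure (weaken_left l P) (preim (l + N) (0\<^sub>m k l @\<^sub>c H) A) = emeasure \<psi> A" if "A \<in> sets \<psi>" for A
    unfolding vt[symmetric] using P that emeasure_weaken_left[OF sp, of "preim N H A" l]
    by (simp add: presents_def)
  moreover have "sets (weaken_left l P) = preim (l + N) (0\<^sub>m k l @\<^sub>c H) ` sets \<psi>"
    using P sets_weaken_left[OF sp, of l] by (simp add: presents_def image_image vt)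
  ultimately show ?thesis
    unfolding presents_def using space_weaken_left[OF sp] by simp
qed

section \<open>Interconnection and elimination\<close>

text \<open>Every pair (u, w) is attained by the two maps jointly, so equal intersections of events
  force equal rectangles A x B and A' x B'. Nonempty rectangles determine their sides.\<close>

lemma presents_complementary:
  assumes P: "presents N H\<^sub>1 \<psi> P" "presents N H\<^sub>2 \<chi> Q"
    and c: "space \<psi> = carrier_vec k" "space \<chi> = carrier_vec k'"
    and onto: "\<And>u w. u \<in> carrier_vec k \<Longrightarrow> w \<in> carrier_vec k' \<Longrightarrow>
      \<exists>v\<in>carrier_vec N. H\<^sub>1 *\<^sub>v v = u \<and> H\<^sub>2 *\<^sub>v v = w"
  shows "complementary P Q"
  unfolding complementary_def
proof (intro conjI ballI impI)
  show "space P = space Q" using P by (simp add: presents_def)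
  fix E\<^sub>1 E\<^sub>1' E\<^sub>2 E\<^sub>2'
  assume ne: "E\<^sub>1 \<in> sets P - {{}}" "E\<^sub>1' \<in> sets P - {{}}" "E\<^sub>2 \<in> sets Q - {{}}" "E\<^sub>2' \<in> sets Q - {{}}"
    and eq: "E\<^sub>1 \<inter> E\<^sub>2 = E\<^sub>1' \<inter> E\<^sub>2'"
  obtain A where A: "A \<in> sets \<psi>" "E\<^sub>1 = preim N H\<^sub>1 A" using ne(1) P by (auto simp: presents_def)
  obtain A' where A': "A' \<in> sets \<psi>" "E\<^sub>1' = preim N H\<^sub>1 A'" using ne(2) P by (auto simp: presents_def)
  obtain B where B: "B \<in> sets \<chi>" "E\<^sub>2 = preim N H\<^sub>2 B" using ne(3) P by (auto simp: presents_def)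
  obtain B' where B': "B' \<in> sets \<chi>" "E\<^sub>2' = preim N H\<^sub>2 B'" using ne(4) P by (auto simp: presents_def)
  have sub: "A \<subseteq> carrier_vec k" "A' \<subseteq> carrier_vec k" "B \<subseteq> carrier_vec k'" "B' \<subseteq> carrier_vec k'"
    using sets.sets_into_space A(1) A'(1) B(1) B'(1) c by metis+
  have ne': "A \<noteq> {}" "A' \<noteq> {}" "B \<noteq> {}" "B' \<noteq> {}"
    using ne unfolding A(2) A'(2) B(2) B'(2) preim_def by auto
  have iff: "u \<in> A \<and> w \<in> B \<longleftrightarrow> u \<in> A' \<and> w \<in> B'" if uw: "u \<in> carrier_vec k" "w \<in> carrier_vec k'" for u w
  proof -
    obtain v where "v \<in> carrier_vec N" "H\<^sub>1 *\<^sub>v v = u" "H\<^sub>2 *\<^sub>v v = w" using onto[OF uw] by blast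
    then show ?thesis using eq unfolding A(2) A'(2) B(2) B'(2) preim_def by blast
  qed
  have "A = A'" "B = B'" using iff sub ne' by blast+
  then show "E\<^sub>1 = E\<^sub>1'" "E\<^sub>2 = E\<^sub>2'" using A A' B B' by simp_all
qed

lemma presents_interconnection:
  assumes P: "presents N H\<^sub>1 \<psi> P" and Q: "presents N H\<^sub>2 \<chi> Q"
    and R: "presents N (H\<^sub>1 @\<^sub>r H\<^sub>2) (product_dist k k' \<psi> \<chi>) R"
    and H: "H\<^sub>1 \<in> carrier_mat k N" "H\<^sub>2 \<in> carrier_mat k' N"
    and \<psi>: "gaussian k \<psi>" and \<chi>: "gaussian k' \<chi>"
  shows "is_interconnection P Q R"
proof -
  interpret A: prob_space \<psi> by (rule gaussianD(1)[OF \<psi>])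
  interpret B: prob_space \<chi> by (rule gaussianD(1)[OF \<chi>])
  interpret AB: pair_prob_space \<psi> \<chi> ..
  note g = gaussianD[OF gaussian_product_dist[OF \<psi> \<chi>]]
  have H12: "H\<^sub>1 @\<^sub>r H\<^sub>2 \<in> carrier_mat (k + k') N" using H by (rule carrier_append_rows)
  let ?box = "\<lambda>A B. {u @\<^sub>v w | u w. u \<in> A \<and> w \<in> B}"
  let ?G = "{E\<^sub>1 \<inter> E\<^sub>2 | E\<^sub>1 E\<^sub>2. E\<^sub>1 \<in> sets P \<and> E\<^sub>2 \<in> sets Q}"
  have spP: "space P = carrier_vec N" and spQ: "space Q = carrier_vec N" and spR: "space R = carrier_vec N"
    using P Q R by (auto simp: presents_def)
  have setsP: "sets P = preim N H\<^sub>1 ` sets (borel_vec k)" and setsQ: "sets Q = preim N H\<^sub>2 ` sets (borel_vec k')"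
    and setsR: "sets R = preim N (H\<^sub>1 @\<^sub>r H\<^sub>2) ` sets (borel_vec (k + k'))"
    using P Q R g gaussianD(3) \<psi> \<chi> by (auto simp: presents_def)
  have sub: "A \<subseteq> carrier_vec j" if "A \<in> sets (borel_vec j)" for A j
    using sets.sets_into_space[OF that] by simp
  have m: "(\<lambda>(u, v). u @\<^sub>v v) \<in> measurable (\<psi> \<Otimes>\<^sub>M \<chi>) (borel_vec (k + k'))"
    by (rule measurable_split_append) (use gaussianD \<psi> \<chi> in auto)
  have box: "?box A B \<in> sets (borel_vec (k + k'))"
    and em: "emeasure (product_dist k k' \<psi> \<chi>) (?box A B) = emeasure \<psi> A * emeasure \<chi> B"
    if A: "A \<in> sets (borel_vec k)" and B: "B \<in> sets (borel_vec k')" for A B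
  proof -
    \<comment> \<open>The two block projections. Stacked they form the identity, so a box is the
      intersection of the preimages of its sides, hence Borel.\<close>
    let ?P1 = "1\<^sub>m k @\<^sub>c 0\<^sub>m k k' :: rmat" and ?P2 = "0\<^sub>m k' k @\<^sub>c 1\<^sub>m k' :: rmat"
    have Pc: "?P1 \<in> carrier_mat k (k + k')" "?P2 \<in> carrier_mat k' (k + k')"
      by (rule carrier_matI; simp)+
    have I: "?P1 @\<^sub>r ?P2 = 1\<^sub>m (k + k')"
    proof (rule mat_eq_by_action)
      fix x :: rvec assume "x \<in> carrier_vec (dim_col (1\<^sub>m (k + k') :: rmat))"
      then have "x \<in> carrier_vec (k + k')" by simp
      then obtain a b where "x = a @\<^sub>v b" "dim_vec a = k" "dim_vec b = k'"
        by (rule carrier_vec_appendE)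
      then show "(?P1 @\<^sub>r ?P2) *\<^sub>v x = 1\<^sub>m (k + k') *\<^sub>v x"
        by (simp add: mat_action_simps left_zero_vec[OF carrier_vecI] right_zero_vec[OF carrier_vecI])
    qed auto
    have sb: "?box A B \<subseteq> carrier_vec (k + k')" using sub[OF A] sub[OF B] by auto
    have "?box A B = preim (k + k') (1\<^sub>m (k + k')) (?box A B)"
    proof -
      have "v \<in> ?box A B \<longleftrightarrow> v \<in> carrier_vec (k + k') \<and> 1\<^sub>m (k + k') *\<^sub>v v \<in> ?box A B" for v
        using sb by (metis (no_types, lifting) carrier_vecD one_mat_mult_vec subsetD)
      then show ?thesis unfolding preim_def by blast
    qed
    also have "\<dots> = preim (k + k') ?P1 A \<inter> preim (k + k') ?P2 B"
      unfolding I[symmetric] by (rule preim_append_rows[OF Pc sub[OF A] sub[OF B]])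
    also have "\<dots> \<in> sets (borel_vec (k + k'))"
      by (rule sets.Int[OF preim_borel[OF Pc(1) A] preim_borel[OF Pc(2) B]])
    finally show b: "?box A B \<in> sets (borel_vec (k + k'))" .
    have "(\<lambda>(u, v). u @\<^sub>v v) -` ?box A B \<inter> space (\<psi> \<Otimes>\<^sub>M \<chi>) = A \<times> B"
    proof (intro equalityI subsetI)
      fix z assume "z \<in> (\<lambda>(u, v). u @\<^sub>v v) -` ?box A B \<inter> space (\<psi> \<Otimes>\<^sub>M \<chi>)"
      then obtain a b u w where z: "z = (a, b)" "a @\<^sub>v b = u @\<^sub>v w" "u \<in> A" "w \<in> B" "a \<in> carrier_vec k"
        using gaussianD(2)[OF \<psi>] by (auto simp: space_pair_measure)
      have "dim_vec a = dim_vec u" using z(3,5) sub[OF A] by (metis carrier_vecD subsetD)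
      then have "a = u \<and> b = w" using z(2) append_vec_eq_iff by blast
      then show "z \<in> A \<times> B" using z by simp
    next
      fix z assume "z \<in> A \<times> B"
      then show "z \<in> (\<lambda>(u, v). u @\<^sub>v v) -` ?box A B \<inter> space (\<psi> \<Otimes>\<^sub>M \<chi>)"
        using sub[OF A] sub[OF B] gaussianD(2) \<psi> \<chi> by (auto simp: space_pair_measure)
    qed
    then have "emeasure (product_dist k k' \<psi> \<chi>) (?box A B) = emeasure (\<psi> \<Otimes>\<^sub>M \<chi>) (A \<times> B)"
      unfolding product_dist_def using emeasure_distr[OF m b] by simp
    also have "\<dots> = emeasure \<psi> A * emeasure \<chi> B"
      by (rule B.emeasure_pair_measure_Times) (use A B gaussianD(3) \<psi> \<chi> in auto)
    finally show "emeasure (product_dist k k' \<psi> \<chi>) (?box A B) = emeasure \<psi> A * emeasure \<chi> B" .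
  qed
  have pre: "preim N (H\<^sub>1 @\<^sub>r H\<^sub>2) (?box A B) = preim N H\<^sub>1 A \<inter> preim N H\<^sub>2 B"
    if "A \<in> sets (borel_vec k)" "B \<in> sets (borel_vec k')" for A B
    by (rule preim_append_rows[OF H sub[OF that(1)] sub[OF that(2)]])
  have G: "?G \<subseteq> Pow (carrier_vec N)" using sets.sets_into_space spP by blast
  show ?thesis
    unfolding is_interconnection_def spP
  proof (intro conjI ballI)
    show "prob_space R" by (rule presents_prob_space[OF R H12 g(1,2)])
    show "space R = carrier_vec N" by (rule spR)
    \<comment> \<open>For one inclusion, the concatenated map is measurable from the generated
      sigma-algebra because both components are; an event of one system becomes a generator by
      intersecting it with the whole space of the other. For the converse, each generator is the
      preimage of a box.\<close>
    show "sets R = sigma_sets (carrier_vec N) ?G"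
    proof (intro equalityI)
      let ?S = "sigma (carrier_vec N) ?G"
      have spS: "space ?S = carrier_vec N" and setsS: "sets ?S = sigma_sets (carrier_vec N) ?G"
        using G by (simp_all add: space_measure_of sets_measure_of)
      have "(\<lambda>v. H\<^sub>1 *\<^sub>v v) \<in> measurable ?S (borel_vec k)"
      proof (rule measurableI)
        fix A assume A: "A \<in> sets (borel_vec k)"
        have "(\<lambda>v. H\<^sub>1 *\<^sub>v v) -` A \<inter> space ?S = preim N H\<^sub>1 A \<inter> space Q"
          unfolding spS spQ by (auto simp: preim_def)
        also have "\<dots> \<in> ?G" using A setsP by blast
        finally show "(\<lambda>v. H\<^sub>1 *\<^sub>v v) -` A \<inter> space ?S \<in> sets ?S" unfolding setsS by blast
      qed (use H in \<open>auto intro: carrier_vecI\<close>)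
      moreover have "(\<lambda>v. H\<^sub>2 *\<^sub>v v) \<in> measurable ?S (borel_vec k')"
      proof (rule measurableI)
        fix A assume A: "A \<in> sets (borel_vec k')"
        have "(\<lambda>v. H\<^sub>2 *\<^sub>v v) -` A \<inter> space ?S = space P \<inter> preim N H\<^sub>2 A"
          unfolding spS spP by (auto simp: preim_def)
        also have "\<dots> \<in> ?G" using A setsQ by blast
        finally show "(\<lambda>v. H\<^sub>2 *\<^sub>v v) -` A \<inter> space ?S \<in> sets ?S" unfolding setsS by blast
      qed (use H in \<open>auto intro: carrier_vecI\<close>)
      ultimately have mS: "(\<lambda>v. (H\<^sub>1 *\<^sub>v v) @\<^sub>v (H\<^sub>2 *\<^sub>v v)) \<in> measurable ?S (borel_vec (k + k'))"
        by (rule measurable_append_vec)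
      show "sets R \<subseteq> sigma_sets (carrier_vec N) ?G"
      proof
        fix E assume "E \<in> sets R"
        then obtain B where B: "B \<in> sets (borel_vec (k + k'))" "E = preim N (H\<^sub>1 @\<^sub>r H\<^sub>2) B"
          using setsR by auto
        have "E = (\<lambda>v. (H\<^sub>1 *\<^sub>v v) @\<^sub>v (H\<^sub>2 *\<^sub>v v)) -` B \<inter> space ?S"
          unfolding B(2) spS preim_def using H by (auto simp: append_rows_mult_vec)
        also have "\<dots> \<in> sets ?S" by (rule measurable_sets[OF mS B(1)])
        finally show "E \<in> sigma_sets (carrier_vec N) ?G" unfolding setsS .
      qed
      have "?G \<subseteq> sets R"
      proof
        fix E assume "E \<in> ?G"
        then obtain A B where AB: "A \<in> sets (borel_vec k)" "B \<in> sets (borel_vec k')"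
          "E = preim N H\<^sub>1 A \<inter> preim N H\<^sub>2 B"
          unfolding setsP setsQ by blast
        show "E \<in> sets R"
          unfolding AB(3) pre[OF AB(1,2), symmetric] setsR using box[OF AB(1,2)] by (rule imageI)
      qed
      then show "sigma_sets (carrier_vec N) ?G \<subseteq> sets R"
        using sets.sigma_sets_subset[of ?G R] spR by simp
    qed
    fix E\<^sub>1 E\<^sub>2 assume "E\<^sub>1 \<in> sets P" "E\<^sub>2 \<in> sets Q"
    then obtain A B where AB: "A \<in> sets (borel_vec k)" "B \<in> sets (borel_vec k')"
      "E\<^sub>1 = preim N H\<^sub>1 A" "E\<^sub>2 = preim N H\<^sub>2 B"
      unfolding setsP setsQ by blast
    have "emeasure R (E\<^sub>1 \<inter> E\<^sub>2) = emeasure (product_dist k k' \<psi> \<chi>) (?box A B)"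
      unfolding AB(3,4) pre[OF AB(1,2), symmetric]
      using R box[OF AB(1,2)] g(3) by (simp add: presents_def)
    also have "\<dots> = emeasure P E\<^sub>1 * emeasure Q E\<^sub>2"
      unfolding em[OF AB(1,2)] AB(3,4) using P Q AB(1,2) gaussianD(3) \<psi> \<chi> by (simp add: presents_def)
    finally show "emeasure R (E\<^sub>1 \<inter> E\<^sub>2) = emeasure P E\<^sub>1 * emeasure Q E\<^sub>2" .
  qed
qed

lemma append_mem_cylinder:
  assumes "dim_vec x = l" "dim_vec y = m" "dim_vec z = n"
  shows "x @\<^sub>v y @\<^sub>v z \<in> cylinder l m n H \<longleftrightarrow> x @\<^sub>v z \<in> H"
proof
  assume "x @\<^sub>v y @\<^sub>v z \<in> cylinder l m n H"
  then obtain x' y' z' where e: "x @\<^sub>v y @\<^sub>v z = x' @\<^sub>v y' @\<^sub>v z'" "dim_vec x' = l" "dim_vec y' = m"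
    "x' @\<^sub>v z' \<in> H"
    unfolding cylinder_def by (auto dest: carrier_vecD)
  then have "x = x' \<and> z = z'" using assms by (simp add: append_vec_eq_iff)
  then show "x @\<^sub>v z \<in> H" using e by simp
qed (use assms carrier_vecI in \<open>unfold cylinder_def, blast\<close>)

text \<open>Elimination of y amounts to passing to the cokernel of its column block
  \<open>V\<close>. If the cylinder over \<open>E\<close> is an event, membership in the underlying
  Borel set cannot depend on y, so y may be chosen to move the point onto the range of the section
  \<open>S\<close>. There membership is decided by the value of \<open>C\<close> alone, through the
  Borel preimage under \<open>S\<close>.\<close>

lemma presents_eliminate:
  assumes R: "presents (l + (m + n)) (U @\<^sub>c V @\<^sub>c W) \<psi> R"
    and c: "U \<in> carrier_mat k l" "V \<in> carrier_mat k m" "W \<in> carrier_mat k n" "C \<in> carrier_mat w k"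
    and coker: "split_cokernel V C S"
    and \<psi>: "sets \<psi> = sets (borel_vec k)"
  shows "presents (l + n) ((C * U) @\<^sub>c (C * W)) (push C \<psi>) (eliminate l m n R)"
proof -
  let ?K = "(C * U) @\<^sub>c (C * W)" and ?H = "U @\<^sub>c V @\<^sub>c W"
  have S: "S \<in> carrier_mat k w" and CS: "C * S = 1\<^sub>m w" and CV: "C * V = 0\<^sub>m w m"
    and ker: "\<And>b. b \<in> carrier_vec k \<Longrightarrow> C *\<^sub>v b = 0\<^sub>v w \<Longrightarrow> \<exists>y\<in>carrier_vec m. b = V *\<^sub>v y"
    using coker c unfolding split_cokernel_def by auto
  have spR: "space R = carrier_vec (l + m + n)" and setsR: "sets R = preim (l + (m + n)) ?H ` sets \<psi>"
    and emR: "\<And>A. A \<in> sets \<psi> \<Longrightarrow> emeasure R (preim (l + (m + n)) ?H A) = emeasure \<psi> A"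
    using R by (auto simp: presents_def add.assoc)
  have sp\<psi>: "space \<psi> = carrier_vec k" using sets_eq_imp_space_eq[OF \<psi>] by simp
  have push: "push C \<psi> = distr \<psi> (borel_vec w) (\<lambda>x. C *\<^sub>v x)" using c by (simp add: push_def)
  have H: "?H *\<^sub>v (x @\<^sub>v y @\<^sub>v z) = U *\<^sub>v x + (V *\<^sub>v y + W *\<^sub>v z)"
    if "dim_vec x = l" "dim_vec y = m" "dim_vec z = n" for x y z
    using that c by (simp add: append_cols_mult_vec)
  have CH: "C *\<^sub>v (U *\<^sub>v x + (V *\<^sub>v y + W *\<^sub>v z)) = ?K *\<^sub>v (x @\<^sub>v z)"
    if "dim_vec x = l" "dim_vec y = m" "dim_vec z = n" for x y z
    using that c mat_mult_eqD[OF CV, of y]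
    by (simp add: mat_action_simps left_zero_vec[OF carrier_vecI])
  \<comment> \<open>\<open>C\<close> annihilates \<open>V *\<^sub>v y\<close>, so after applying
    \<open>C\<close> the middle variable is invisible.\<close>
  have cyl: "cylinder l m n (preim (l + n) ?K A) = preim (l + (m + n)) ?H (preim k C A)" for A
  proof (intro Set.set_eqI)
    fix v
    have "v \<in> cylinder l m n (preim (l + n) ?K A) \<longleftrightarrow> v \<in> preim (l + (m + n)) ?H (preim k C A)"
      if v: "v \<in> carrier_vec (l + (m + n))"
    proof -
      obtain x y' where xy: "v = x @\<^sub>v y'" "dim_vec x = l" "dim_vec y' = m + n"
        by (rule carrier_vec_appendE[OF v])
      obtain y z where yz: "y' = y @\<^sub>v z" "dim_vec y = m" "dim_vec z = n"
        by (rule carrier_vec_appendE[OF carrier_vecI[OF xy(3)]])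
      have "x @\<^sub>v z \<in> carrier_vec (l + n)" "U *\<^sub>v x + (V *\<^sub>v y + W *\<^sub>v z) \<in> carrier_vec k"
        by (rule carrier_vecI; use xy yz c in simp)+
      then show ?thesis
        using v unfolding xy(1) yz(1) append_mem_cylinder[OF xy(2) yz(2,3)] preim_def
        by (simp only: mem_Collect_eq H[OF xy(2) yz(2,3)] CH[OF xy(2) yz(2,3)] simp_thms)
    qed
    moreover have "v \<in> carrier_vec (l + (m + n))" if "v \<in> cylinder l m n (preim (l + n) ?K A)"
      using that unfolding cylinder_def by auto
    ultimately show "v \<in> cylinder l m n (preim (l + n) ?K A) \<longleftrightarrow> v \<in> preim (l + (m + n)) ?H (preim k C A)"
      unfolding preim_def by blast
  qed
  have preC: "preim k C A \<in> sets \<psi>" if "A \<in> sets (borel_vec w)" for A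
    using preim_borel[OF c(4) that] \<psi> by simp
  have setsE: "sets (eliminate l m n R) = preim (l + n) ?K ` sets (borel_vec w)"
  proof (intro equalityI subsetI)
    fix E assume "E \<in> preim (l + n) ?K ` sets (borel_vec w)"
    then obtain A where A: "A \<in> sets (borel_vec w)" "E = preim (l + n) ?K A" by blast
    have "cylinder l m n E \<in> sets R" unfolding A(2) cyl setsR using preC[OF A(1)] by (rule imageI)
    moreover have "E \<subseteq> carrier_vec (l + n)" unfolding A(2) preim_def by blast
    ultimately show "E \<in> sets (eliminate l m n R)" unfolding sets_eliminate[OF spR] by blast
  next
    fix E assume "E \<in> sets (eliminate l m n R)"
    then have Ec: "E \<subseteq> carrier_vec (l + n)" and "cylinder l m n E \<in> sets R"
      unfolding sets_eliminate[OF spR] by blast+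
    then obtain B where B: "B \<in> sets \<psi>" "cylinder l m n E = preim (l + (m + n)) ?H B"
      unfolding setsR by blast
    \<comment> \<open>The left side does not mention \<open>y\<close>; the right side is therefore
      the same for all \<open>y\<close>.\<close>
    have E_iff: "x @\<^sub>v z \<in> E \<longleftrightarrow> U *\<^sub>v x + (V *\<^sub>v y + W *\<^sub>v z) \<in> B"
      if d: "dim_vec x = l" "dim_vec y = m" "dim_vec z = n" for x y z
    proof -
      have "x @\<^sub>v y @\<^sub>v z \<in> carrier_vec (l + (m + n))" by (rule carrier_vecI) (use d in simp)
      then show ?thesis
        unfolding append_mem_cylinder[OF d, symmetric] B(2) preim_def using H[OF d] by simp
    qed
    have "E = preim (l + n) ?K (preim w S B)"
    proof -
      have "v \<in> E \<longleftrightarrow> S *\<^sub>v (?K *\<^sub>v v) \<in> B" if v: "v \<in> carrier_vec (l + n)" for v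
      proof -
        obtain x z where xz: "v = x @\<^sub>v z" "dim_vec x = l" "dim_vec z = n"
          by (rule carrier_vec_appendE[OF v])
        let ?b = "U *\<^sub>v x + W *\<^sub>v z"
        have K: "?K *\<^sub>v v = C *\<^sub>v ?b"
          using xz c by (simp add: append_cols_mult_vec mult_mat_mult_vec mult_mat_vec_add)
        have "C *\<^sub>v (S *\<^sub>v (C *\<^sub>v ?b) - ?b) = 0\<^sub>v w"
          using mat_mult_eqD[OF CS, of "C *\<^sub>v ?b"] S c
          by (simp add: mult_mat_vec_diff one_mat_mult_vec minus_cancel_vec[OF carrier_vecI])
        moreover have "S *\<^sub>v (C *\<^sub>v ?b) - ?b \<in> carrier_vec k" by (rule carrier_vecI) (use c in simp)
        ultimately obtain y where y: "y \<in> carrier_vec m" "S *\<^sub>v (C *\<^sub>v ?b) - ?b = V *\<^sub>v y"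
          using ker by blast
        \<comment> \<open>This \<open>y\<close> was obtained from the kernel of \<open>C\<close>
          being the range of \<open>V\<close>; it shifts the point onto the section without changing
          membership.\<close>
        have "U *\<^sub>v x + (V *\<^sub>v y + W *\<^sub>v z) = S *\<^sub>v (C *\<^sub>v ?b)"
          unfolding y(2)[symmetric] by (rule eq_vecI) (use c S xz in simp_all)
        then show ?thesis using E_iff[OF xz(2) carrier_vecD[OF y(1)] xz(3)] xz(1) K by simp
      qed
      moreover have "?K *\<^sub>v v \<in> carrier_vec w" for v by (rule carrier_vecI) (use c in simp)
      ultimately show ?thesis using Ec unfolding preim_def by blast
    qed
    moreover have "preim w S B \<in> sets (borel_vec w)" using preim_borel[OF S] B(1) \<psi> by simp
    ultimately show "E \<in> preim (l + n) ?K ` sets (borel_vec w)" by blast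
  qed
  show ?thesis
    unfolding presents_def
  proof (intro conjI ballI)
    show "space (eliminate l m n R) = carrier_vec (l + n)" by (rule space_eliminate[OF spR])
    show "sets (eliminate l m n R) = preim (l + n) ?K ` sets (push C \<psi>)"
      unfolding setsE push by simp
    fix A assume "A \<in> sets (push C \<psi>)"
    then have A: "A \<in> sets (borel_vec w)" unfolding push by simp
    have "preim (l + n) ?K A \<in> sets (eliminate l m n R)" unfolding setsE using A by (rule imageI)
    from emeasure_eliminate[OF spR this]
    have "emeasure (eliminate l m n R) (preim (l + n) ?K A) = emeasure \<psi> (preim k C A)"
      unfolding cyl emR[OF preC[OF A]] .
    also have "preim k C A = (\<lambda>x. C *\<^sub>v x) -` A \<inter> space \<psi>" by (auto simp: preim_def sp\<psi>)
    also have "emeasure \<psi> \<dots> = emeasure (push C \<psi>) A"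
      unfolding push by (rule emeasure_distr[symmetric, OF measurable_mult_mat_vec'[OF \<psi> c(4)] A])
    finally show "emeasure (eliminate l m n R) (preim (l + n) ?K A) = emeasure (push C \<psi>) A" .
  qed
qed

section \<open>The composite with copying\<close>

text \<open>Both sides agree on rectangles: \<open>A \<times> B\<close> has the mass of
  \<open>A\<close> or zero, according to whether \<open>y\<close> lies in \<open>B\<close>.\<close>

lemma pair_return_right:
  assumes "prob_space M" "y \<in> space N"
  shows "M \<Otimes>\<^sub>M return N y = distr M (M \<Otimes>\<^sub>M N) (\<lambda>x. (x, y))"
proof -
  interpret M: prob_space M by fact
  interpret N: prob_space "return N y" by (rule prob_space_return) fact
  have m: "(\<lambda>x. (x, y)) \<in> measurable M (M \<Otimes>\<^sub>M N)" using assms(2) by simp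
  show ?thesis
  proof (rule pair_measure_eqI)
    fix A B assume A: "A \<in> sets M" and "B \<in> sets (return N y)"
    then have B: "B \<in> sets N" by simp
    have "(\<lambda>x. (x, y)) -` (A \<times> B) \<inter> space M = (if y \<in> B then A else {})"
      using sets.sets_into_space[OF A] by auto
    then show "emeasure M A * emeasure (return N y) B = emeasure (distr M (M \<Otimes>\<^sub>M N) (\<lambda>x. (x, y))) (A \<times> B)"
      using emeasure_distr[OF m, of "A \<times> B"] A B by simp
  qed (auto intro!: sets_pair_measure_cong M.sigma_finite_measure_axioms N.sigma_finite_measure_axioms)
qed

lemma pair_return_left:
  assumes "prob_space M" "y \<in> space N"
  shows "return N y \<Otimes>\<^sub>M M = distr M (N \<Otimes>\<^sub>M M) (\<lambda>x. (y, x))"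
proof -
  interpret M: prob_space M by fact
  interpret N: prob_space "return N y" by (rule prob_space_return) fact
  have m: "(\<lambda>x. (y, x)) \<in> measurable M (N \<Otimes>\<^sub>M M)" using assms(2) by simp
  show ?thesis
  proof (rule pair_measure_eqI)
    fix A B assume B: "B \<in> sets M" and "A \<in> sets (return N y)"
    then have A: "A \<in> sets N" by simp
    have "(\<lambda>x. (y, x)) -` (A \<times> B) \<inter> space M = (if y \<in> A then B else {})"
      using sets.sets_into_space[OF B] by auto
    then show "emeasure (return N y) A * emeasure M B = emeasure (distr M (N \<Otimes>\<^sub>M M) (\<lambda>x. (y, x))) (A \<times> B)"
      using emeasure_distr[OF m, of "A \<times> B"] A B by simp
  qed (auto intro!: sets_pair_measure_cong M.sigma_finite_measure_axioms N.sigma_finite_measure_axioms)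
qed

text \<open>Linear maps enter the category with noise concentrated at zero. This turns the resulting
  Dirac factor into a zero block of a matrix, so that it can be multiplied away.\<close>

lemma product_dist_dirac_right:
  assumes \<psi>: "gaussian a \<psi>"
  shows "product_dist a b \<psi> (dirac b (0\<^sub>v b)) = push (1\<^sub>m a @\<^sub>r 0\<^sub>m b a) \<psi>"
proof -
  let ?N = "borel_vec b"
  have "product_dist a b \<psi> (dirac b (0\<^sub>v b)) =
      distr (distr \<psi> (\<psi> \<Otimes>\<^sub>M ?N) (\<lambda>x. (x, 0\<^sub>v b))) (borel_vec (a + b)) (\<lambda>(u, v). u @\<^sub>v v)"
    unfolding product_dist_def dirac_def using pair_return_right[OF gaussianD(1)[OF \<psi>], of _ ?N] by simp
  also have "\<dots> = distr \<psi> (borel_vec (a + b)) ((\<lambda>(u, v). u @\<^sub>v v) \<circ> (\<lambda>x. (x, 0\<^sub>v b)))"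
    by (rule distr_distr[OF measurable_split_append[OF gaussianD(3)[OF \<psi>] refl]]) simp
  also have "\<dots> = push (1\<^sub>m a @\<^sub>r 0\<^sub>m b a) \<psi>"
    unfolding push_def using gaussianD(2)[OF \<psi>]
    by (intro distr_cong) (simp_all add: append_rows_mult_vec zero_mat_mult_vec)
  finally show ?thesis .
qed

lemma product_dist_dirac_left:
  assumes \<chi>: "gaussian b \<chi>"
  shows "product_dist a b (dirac a (0\<^sub>v a)) \<chi> = push (0\<^sub>m a b @\<^sub>r 1\<^sub>m b) \<chi>"
proof -
  let ?N = "borel_vec a"
  have "product_dist a b (dirac a (0\<^sub>v a)) \<chi> =
      distr (distr \<chi> (?N \<Otimes>\<^sub>M \<chi>) (\<lambda>x. (0\<^sub>v a, x))) (borel_vec (a + b)) (\<lambda>(u, v). u @\<^sub>v v)"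
    unfolding product_dist_def dirac_def using pair_return_left[OF gaussianD(1)[OF \<chi>], of _ ?N] by simp
  also have "\<dots> = distr \<chi> (borel_vec (a + b)) ((\<lambda>(u, v). u @\<^sub>v v) \<circ> (\<lambda>x. (0\<^sub>v a, x)))"
    by (rule distr_distr[OF measurable_split_append[OF refl gaussianD(3)[OF \<chi>]]]) simp
  also have "\<dots> = push (0\<^sub>m a b @\<^sub>r 1\<^sub>m b) \<chi>"
    unfolding push_def using gaussianD(2)[OF \<chi>]
    by (intro distr_cong) (simp_all add: append_rows_mult_vec zero_mat_mult_vec)
  finally show ?thesis .
qed

text \<open>The last hypothesis is a splitting identity: on the kernel of \<open>C\<close> it reads
  \<open>x = M *\<^sub>v (T *\<^sub>v x)\<close>, so \<open>T\<close> supplies the preimages that a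
  cokernel demands.\<close>

lemma split_cokernelI:
  assumes C: "C \<in> carrier_mat w N" and M: "M \<in> carrier_mat N m" and S: "S \<in> carrier_mat N w"
    and T: "T \<in> carrier_mat m N"
    and CS: "\<And>x. x \<in> carrier_vec w \<Longrightarrow> C *\<^sub>v (S *\<^sub>v x) = x"
    and CM: "\<And>y. y \<in> carrier_vec m \<Longrightarrow> C *\<^sub>v (M *\<^sub>v y) = 0\<^sub>v w"
    and ST: "\<And>x. x \<in> carrier_vec N \<Longrightarrow> S *\<^sub>v (C *\<^sub>v x) + M *\<^sub>v (T *\<^sub>v x) = x"
  shows "split_cokernel M C S"
proof -
  have "C * S = 1\<^sub>m w"
    by (rule mat_eq_by_action) (use C S CS in \<open>simp_all add: mult_mat_mult_vec\<close>)
  moreover have "C * M = 0\<^sub>m w m"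
    by (rule mat_eq_by_action) (use C M CM in \<open>simp_all add: mult_mat_mult_vec zero_mat_mult_vec\<close>)
  moreover have "\<exists>y\<in>carrier_vec m. x = M *\<^sub>v y" if x: "x \<in> carrier_vec N" "C *\<^sub>v x = 0\<^sub>v w" for x
  proof (rule bexI[of _ "T *\<^sub>v x"])
    have "S *\<^sub>v 0\<^sub>v w = 0\<^sub>v N" using mult_mat_vec_zero[of S] S by simp
    then show "x = M *\<^sub>v (T *\<^sub>v x)"
      using ST[OF x(1)] x(2) M by (simp add: left_zero_vec[OF carrier_vecI])
    show "T *\<^sub>v x \<in> carrier_vec m" by (rule carrier_vecI) (use T in simp)
  qed
  ultimately show ?thesis using C M S unfolding split_cokernel_def by auto
qed

text \<open>The pushout of \<open>p\<close> along \<open>y \<mapsto> (y, y)\<close> is \<open>P \<times> Y\<close>, with legs \<open>u \<mapsto> (u, 0)\<close> and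
  \<open>(a, b) \<mapsto> (p a, b - a)\<close>.\<close>

lemma split_cokernel_copy:
  assumes p: "p \<in> carrier_mat k m"
  shows "split_cokernel (p @\<^sub>r - (1\<^sub>m m @\<^sub>r 1\<^sub>m m))
    ((1\<^sub>m k @\<^sub>r 0\<^sub>m m k) @\<^sub>c ((p @\<^sub>r - 1\<^sub>m m) @\<^sub>c (0\<^sub>m k m @\<^sub>r 1\<^sub>m m)))
    ((1\<^sub>m k @\<^sub>c 0\<^sub>m k m) @\<^sub>r (0\<^sub>m m (k + m) @\<^sub>r (0\<^sub>m m k @\<^sub>c 1\<^sub>m m)))"
    (is "split_cokernel ?M ?C ?S")
proof (rule split_cokernelI)
  \<comment> \<open>\<open>?T\<close> takes (u, a, b) to - a. The section puts zero into the first
    copy of Y, and what is left of (u, a, b) is (- p a, a, a), the image of - a under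
    \<open>?M\<close>.\<close>
  let ?T = "0\<^sub>m m k @\<^sub>c (- 1\<^sub>m m @\<^sub>c 0\<^sub>m m m) :: rmat"
  show "?C \<in> carrier_mat (k + m) (k + (m + m))" "?M \<in> carrier_mat (k + (m + m)) m"
    "?S \<in> carrier_mat (k + (m + m)) (k + m)" "?T \<in> carrier_mat m (k + (m + m))"
    by (rule carrier_matI; use p in simp)+
  show "?C *\<^sub>v (?S *\<^sub>v x) = x" if "x \<in> carrier_vec (k + m)" for x
  proof -
    obtain u c where x: "x = u @\<^sub>v c" "dim_vec u = k" "dim_vec c = m"
      by (rule carrier_vec_appendE[OF \<open>x \<in> _\<close>])
    have "?C *\<^sub>v (?S *\<^sub>v x) = u @\<^sub>v c"
      unfolding x(1) using x(2,3) p mult_mat_vec_zero[of p]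
      by (simp add: mat_action_simps) (auto intro!: eq_vecI)
    then show ?thesis using x by simp
  qed
  show "?C *\<^sub>v (?M *\<^sub>v y) = 0\<^sub>v (k + m)" if "y \<in> carrier_vec m" for y
    unfolding append_vec_zero using that p
    by (simp add: mat_action_simps)
  show "?S *\<^sub>v (?C *\<^sub>v x) + ?M *\<^sub>v (?T *\<^sub>v x) = x" if "x \<in> carrier_vec (k + (m + m))" for x
  proof -
    obtain u ab where x: "x = u @\<^sub>v ab" "dim_vec u = k" "dim_vec ab = m + m"
      by (rule carrier_vec_appendE[OF \<open>x \<in> _\<close>])
    obtain a b where ab: "ab = a @\<^sub>v b" "dim_vec a = m" "dim_vec b = m"
      by (rule carrier_vec_appendE[OF carrier_vecI[OF x(3)]])
    have "?S *\<^sub>v (?C *\<^sub>v x) + ?M *\<^sub>v (?T *\<^sub>v x) = u @\<^sub>v (a @\<^sub>v b)"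
      unfolding x(1) ab(1) using x(2) ab(2,3) p mult_mat_vec_zero[of p]
      by (simp add: mat_action_simps) (auto intro!: eq_vecI)
    then show ?thesis using x ab by simp
  qed
qed

text \<open>The pushout of \<open>(a, b) \<mapsto> (p a, b - a)\<close> along \<open>id \<times> g\<close> is \<open>P \<times> Q\<close>, with legs \<open>(u, c) \<mapsto> (u, g c)\<close>
  and \<open>(a, r) \<mapsto> (p a, r - g a)\<close>.\<close>

lemma split_cokernel_copied:
  assumes p: "p \<in> carrier_mat k m" and g: "g \<in> carrier_mat k' m"
  shows "split_cokernel (((p @\<^sub>r - 1\<^sub>m m) @\<^sub>c (0\<^sub>m k m @\<^sub>r 1\<^sub>m m)) @\<^sub>r - prod_mat (1\<^sub>m m) g)
    (prod_mat (1\<^sub>m k) g @\<^sub>c ((p @\<^sub>r - g) @\<^sub>c (0\<^sub>m k k' @\<^sub>r 1\<^sub>m k')))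
    (((1\<^sub>m k @\<^sub>r 0\<^sub>m m k) @\<^sub>c 0\<^sub>m (k + m) k') @\<^sub>r (0\<^sub>m m (k + k') @\<^sub>r (0\<^sub>m k' k @\<^sub>c 1\<^sub>m k')))"
    (is "split_cokernel ?M ?C ?S")
proof (rule split_cokernelI)
  \<comment> \<open>\<open>?T\<close> takes ((u, c), (a, r)) to (- a, c - a), the solution of M y =
    ((- p a, c), (a, g a - g c)); the right side is what the section leaves over.\<close>
  let ?T = "((0\<^sub>m m k @\<^sub>r 0\<^sub>m m k) @\<^sub>c (0\<^sub>m m m @\<^sub>r 1\<^sub>m m)) @\<^sub>c
    ((- 1\<^sub>m m @\<^sub>r - 1\<^sub>m m) @\<^sub>c 0\<^sub>m (m + m) k') :: rmat"
  show "?C \<in> carrier_mat (k + k') ((k + m) + (m + k'))" "?M \<in> carrier_mat ((k + m) + (m + k')) (m + m)"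
    "?S \<in> carrier_mat ((k + m) + (m + k')) (k + k')" "?T \<in> carrier_mat (m + m) ((k + m) + (m + k'))"
    by (rule carrier_matI; use p g in simp)+
  note z = mult_mat_vec_zero[of p] mult_mat_vec_zero[of g]
  show "?C *\<^sub>v (?S *\<^sub>v x) = x" if "x \<in> carrier_vec (k + k')" for x
  proof -
    obtain u c where x: "x = u @\<^sub>v c" "dim_vec u = k" "dim_vec c = k'"
      by (rule carrier_vec_appendE[OF \<open>x \<in> _\<close>])
    have "?C *\<^sub>v (?S *\<^sub>v x) = u @\<^sub>v c"
      unfolding x(1) using x(2,3) p g z
      by (simp add: mat_action_simps append_vec_zero) (auto intro!: eq_vecI)
    then show ?thesis using x by simp
  qed
  show "?C *\<^sub>v (?M *\<^sub>v y) = 0\<^sub>v (k + k')" if "y \<in> carrier_vec (m + m)" for y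
  proof -
    obtain a b where y: "y = a @\<^sub>v b" "dim_vec a = m" "dim_vec b = m"
      by (rule carrier_vec_appendE[OF \<open>y \<in> _\<close>])
    show ?thesis
      unfolding append_vec_zero y(1) using y(2,3) p g z
      by (simp add: mat_action_simps) (auto intro!: eq_vecI)
  qed
  show "?S *\<^sub>v (?C *\<^sub>v x) + ?M *\<^sub>v (?T *\<^sub>v x) = x" if "x \<in> carrier_vec ((k + m) + (m + k'))" for x
  proof -
    obtain uc ar where x: "x = uc @\<^sub>v ar" "dim_vec uc = k + m" "dim_vec ar = m + k'"
      by (rule carrier_vec_appendE[OF \<open>x \<in> _\<close>])
    obtain u c where uc: "uc = u @\<^sub>v c" "dim_vec u = k" "dim_vec c = m"
      by (rule carrier_vec_appendE[OF carrier_vecI[OF x(2)]])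
    obtain a r where ar: "ar = a @\<^sub>v r" "dim_vec a = m" "dim_vec r = k'"
      by (rule carrier_vec_appendE[OF carrier_vecI[OF x(3)]])
    have "?S *\<^sub>v (?C *\<^sub>v x) + ?M *\<^sub>v (?T *\<^sub>v x) = (u @\<^sub>v c) @\<^sub>v (a @\<^sub>v r)"
      unfolding x(1) uc(1) ar(1) using uc(2,3) ar(2,3) p g z
      by (simp add: mat_action_simps append_vec_zero) (auto intro!: eq_vecI)
    then show ?thesis using x uc ar by simp
  qed
qed

lemma uminus_zero_rvec: "- 0\<^sub>v n = (0\<^sub>v n :: rvec)"
  by (rule eq_vecI) auto

text \<open>The explicit pushouts are chosen so that the noise comes out as the product measure
  itself, with no residual matrix. The name of this representative is then the pullback along (x, y,
  z) to (p y - f x, q z - g y).\<close>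

lemma gx_comp_copy:
  assumes s: "(f, \<psi>, p) \<in> gx_triples l m" and t: "(g, \<chi>, q) \<in> gx_triples m n"
    and p: "p \<in> carrier_mat k m" and g: "g \<in> carrier_mat k' m"
  shows "gx_class (f, \<psi>, p) ;; gx_copy m ;; (gx_id m \<otimes>\<^sub>g gx_class (g, \<chi>, q)) =
      gx_class (f @\<^sub>r 0\<^sub>m k' l, product_dist k k' \<psi> \<chi>, (p @\<^sub>r - g) @\<^sub>c (0\<^sub>m k n @\<^sub>r q))"
      (is "_ = gx_class ?T")
    and "(f @\<^sub>r 0\<^sub>m k' l, product_dist k k' \<psi> \<chi>, (p @\<^sub>r - g) @\<^sub>c (0\<^sub>m k n @\<^sub>r q)) \<in> gx_triples l (m + n)"
proof -
  have f: "f \<in> carrier_mat k l" and \<psi>: "gaussian k \<psi>"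
    using gx_triplesE[OF s] p by (metis carrier_matD(1))+
  have q: "q \<in> carrier_mat k' n" and \<chi>: "gaussian k' \<chi>"
    using gx_triplesE[OF t] g by (metis carrier_matD(1))+
  note se = gaussianD(3)[OF \<psi>] gaussianD(3)[OF \<chi>]
  define h where "h = (1\<^sub>m m @\<^sub>r 1\<^sub>m m :: rmat)"
  define i\<^sub>1 where "i\<^sub>1 = (1\<^sub>m k @\<^sub>r 0\<^sub>m m k :: rmat)"
  define i\<^sub>2 where "i\<^sub>2 = (p @\<^sub>r - 1\<^sub>m m) @\<^sub>c (0\<^sub>m k m @\<^sub>r 1\<^sub>m m)"
  define j\<^sub>1 where "j\<^sub>1 = prod_mat (1\<^sub>m k) g"
  define j\<^sub>2 where "j\<^sub>2 = (p @\<^sub>r - g) @\<^sub>c (0\<^sub>m k k' @\<^sub>r 1\<^sub>m k')"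
  note defs = h_def i\<^sub>1_def i\<^sub>2_def j\<^sub>1_def j\<^sub>2_def
  let ?\<delta> = "\<lambda>a. dirac a (0\<^sub>v a)"
  have h: "h \<in> carrier_mat (m + m) m" and i: "i\<^sub>1 \<in> carrier_mat (k + m) k" "i\<^sub>2 \<in> carrier_mat (k + m) (m + m)"
    and j: "j\<^sub>1 \<in> carrier_mat (k + k') (k + m)" "j\<^sub>2 \<in> carrier_mat (k + k') (m + k')"
    unfolding defs by (rule carrier_matI; use p g in simp)+
  have copy: "gx_copy m = gx_class (h, ?\<delta> (m + m), 1\<^sub>m (m + m))"
    using h by (simp add: gx_copy_def gx_linear_def h_def)
  note copy_triple = gx_linear_triple[OF h]
  have id: "gx_id m = gx_class (1\<^sub>m m, ?\<delta> m, 1\<^sub>m m)"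
    by (simp add: gx_id_def gx_linear_def)
  note id_triple = gx_linear_triple[OF one_carrier_mat[of m]]

  \<comment> \<open>Copying is deterministic: its Dirac noise contributes nothing, and the noise of
    \<open>f\<close> is merely embedded.\<close>
  have push1: "conv_dist (k + m) (push i\<^sub>1 \<psi>) (push i\<^sub>2 (?\<delta> (m + m))) = push i\<^sub>1 \<psi>"
  proof -
    have ii: "i\<^sub>1 @\<^sub>c i\<^sub>2 \<in> carrier_mat (k + m) (k + (m + m))" by (rule carrier_matI) (use i in auto)
    have "conv_dist (k + m) (push i\<^sub>1 \<psi>) (push i\<^sub>2 (?\<delta> (m + m))) =
        push (i\<^sub>1 @\<^sub>c i\<^sub>2) (push (1\<^sub>m k @\<^sub>r 0\<^sub>m (m + m) k) \<psi>)"
      by (simp add: conv_dist_push[OF \<psi> gaussian_dirac i] product_dist_dirac_right[OF \<psi>])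
    also have "\<dots> = push ((i\<^sub>1 @\<^sub>c i\<^sub>2) * (1\<^sub>m k @\<^sub>r 0\<^sub>m (m + m) k)) \<psi>"
      by (rule push_push[OF se(1) _ ii]) auto
    also have "(i\<^sub>1 @\<^sub>c i\<^sub>2) * (1\<^sub>m k @\<^sub>r 0\<^sub>m (m + m) k) = i\<^sub>1"
    proof (rule mat_eq_by_action)
      fix x :: rvec assume x: "x \<in> carrier_vec (dim_col i\<^sub>1)"
      have "i\<^sub>2 *\<^sub>v 0\<^sub>v (m + m) = 0\<^sub>v (k + m)" using mult_mat_vec_zero[of i\<^sub>2] i by simp
      then show "((i\<^sub>1 @\<^sub>c i\<^sub>2) * (1\<^sub>m k @\<^sub>r 0\<^sub>m (m + m) k)) *\<^sub>v x = i\<^sub>1 *\<^sub>v x"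
        using x i by (simp add: mat_action_simps right_zero_vec[OF carrier_vecI])
    qed (use i in auto)
    finally show ?thesis .
  qed
  have comp1: "gx_comp_along i\<^sub>1 i\<^sub>2 (f, \<psi>, p) (h, ?\<delta> (m + m), 1\<^sub>m (m + m)) = (i\<^sub>1 * f, push i\<^sub>1 \<psi>, i\<^sub>2)"
    using i push1 by simp
  have i': "i\<^sub>1 \<in> carrier_mat (k + m) (dim_row p)" "i\<^sub>2 \<in> carrier_mat (k + m) (dim_row h)"
    using i p h by auto
  note coker1 = split_cokernel_copy[OF p, folded defs]
  note first = gx_comp_class[OF s copy_triple i' coker1, unfolded comp1, folded copy]
  note first_triple = gx_comp_along_triples[OF s copy_triple i' coker1, unfolded comp1]

  have tens: "gx_tensor_triple (1\<^sub>m m, ?\<delta> m, 1\<^sub>m m) (g, \<chi>, q) =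
      (prod_mat (1\<^sub>m m) g, push (0\<^sub>m m k' @\<^sub>r 1\<^sub>m k') \<chi>, prod_mat (1\<^sub>m m) q)"
    using q product_dist_dirac_left[OF \<chi>, of m] by simp
  note tensor = gx_tensor_class[OF id_triple t, unfolded tens, folded id]
  note tensor_triple = gx_tensor_triple_triples[OF id_triple t, unfolded tens]

  \<comment> \<open>The noise of \<open>f\<close> passes through u to (u, 0) and that of
    \<open>g\<close> through r to (0, r); side by side these two embeddings form the identity
    matrix.\<close>
  have push2: "conv_dist (k + k') (push j\<^sub>1 (push i\<^sub>1 \<psi>)) (push j\<^sub>2 (push (0\<^sub>m m k' @\<^sub>r 1\<^sub>m k') \<chi>)) =
      product_dist k k' \<psi> \<chi>"
  proof -
    have z: "0\<^sub>m m k' @\<^sub>r 1\<^sub>m k' \<in> carrier_mat (m + k') k'" by auto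
    have "conv_dist (k + k') (push j\<^sub>1 (push i\<^sub>1 \<psi>)) (push j\<^sub>2 (push (0\<^sub>m m k' @\<^sub>r 1\<^sub>m k') \<chi>)) =
        push ((j\<^sub>1 * i\<^sub>1) @\<^sub>c (j\<^sub>2 * (0\<^sub>m m k' @\<^sub>r 1\<^sub>m k'))) (product_dist k k' \<psi> \<chi>)"
      unfolding push_push[OF se(1) i(1) j(1)] push_push[OF se(2) z j(2)]
      by (rule conv_dist_push[OF \<psi> \<chi> mult_carrier_mat[OF j(1) i(1)] mult_carrier_mat[OF j(2) z]])
    also have "(j\<^sub>1 * i\<^sub>1) @\<^sub>c (j\<^sub>2 * (0\<^sub>m m k' @\<^sub>r 1\<^sub>m k')) = 1\<^sub>m (k + k')"
    proof (rule mat_eq_by_action)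
      fix x :: rvec assume "x \<in> carrier_vec (dim_col (1\<^sub>m (k + k') :: rmat))"
      then have "x \<in> carrier_vec (k + k')" by simp
      then obtain u w where x: "x = u @\<^sub>v w" "dim_vec u = k" "dim_vec w = k'"
        by (rule carrier_vec_appendE)
      show "((j\<^sub>1 * i\<^sub>1) @\<^sub>c (j\<^sub>2 * (0\<^sub>m m k' @\<^sub>r 1\<^sub>m k'))) *\<^sub>v x = 1\<^sub>m (k + k') *\<^sub>v x"
        unfolding x(1) defs using x(2,3) p g mult_mat_vec_zero[of p] mult_mat_vec_zero[of g]
        by (simp add: mat_action_simps) (auto intro!: eq_vecI)
    qed (use i j in auto)
    finally show ?thesis
      using push_one[OF gaussianD(3)[OF gaussian_product_dist[OF \<psi> \<chi>]]] by simp
  qed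
  have comp2: "gx_comp_along j\<^sub>1 j\<^sub>2 (i\<^sub>1 * f, push i\<^sub>1 \<psi>, i\<^sub>2)
      (prod_mat (1\<^sub>m m) g, push (0\<^sub>m m k' @\<^sub>r 1\<^sub>m k') \<chi>, prod_mat (1\<^sub>m m) q) = ?T"
  proof -
    have "j\<^sub>1 * (i\<^sub>1 * f) = f @\<^sub>r 0\<^sub>m k' l"
    proof (rule mat_eq_by_action)
      fix x :: rvec assume "x \<in> carrier_vec (dim_col (f @\<^sub>r 0\<^sub>m k' l))"
      then show "(j\<^sub>1 * (i\<^sub>1 * f)) *\<^sub>v x = (f @\<^sub>r 0\<^sub>m k' l) *\<^sub>v x"
        unfolding defs using f g mult_mat_vec_zero[of g] by (simp add: mat_action_simps)
    qed (use f i j in auto)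
    moreover have "j\<^sub>2 * prod_mat (1\<^sub>m m) q = (p @\<^sub>r - g) @\<^sub>c (0\<^sub>m k n @\<^sub>r q)"
    proof (rule mat_eq_by_action)
      fix x :: rvec assume "x \<in> carrier_vec (dim_col ((p @\<^sub>r - g) @\<^sub>c (0\<^sub>m k n @\<^sub>r q)))"
      then have "x \<in> carrier_vec (m + n)" using p q by simp
      then obtain y z where x: "x = y @\<^sub>v z" "dim_vec y = m" "dim_vec z = n"
        by (rule carrier_vec_appendE)
      show "(j\<^sub>2 * prod_mat (1\<^sub>m m) q) *\<^sub>v x = ((p @\<^sub>r - g) @\<^sub>c (0\<^sub>m k n @\<^sub>r q)) *\<^sub>v x"
        unfolding x(1) defs using x(2,3) p g q by (simp add: mat_action_simps)
    qed (use p g q j in auto)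
    ultimately show ?thesis using push2 j by simp
  qed
  have j': "j\<^sub>1 \<in> carrier_mat (k + k') (dim_row i\<^sub>2)" "j\<^sub>2 \<in> carrier_mat (k + k') (dim_row (prod_mat (1\<^sub>m m) g))"
    using j i g by auto
  note coker2 = split_cokernel_copied[OF p g, folded i\<^sub>2_def j\<^sub>1_def j\<^sub>2_def]
  show "gx_class (f, \<psi>, p) ;; gx_copy m ;; (gx_id m \<otimes>\<^sub>g gx_class (g, \<chi>, q)) = gx_class ?T"
    unfolding first tensor
    using gx_comp_class[OF first_triple tensor_triple j' coker2] unfolding comp2 .
  show "?T \<in> gx_triples l (m + n)"
    using gx_comp_along_triples[OF first_triple tensor_triple j' coker2] unfolding comp2 .
qed

section \<open>Fibres, complementarity, interconnection and elimination for composable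
  morphisms\<close>

theorem theorem5p6:
  fixes l m n :: nat
    and F G :: "gx_triple set"
    and f p g q :: rmat
    and \<psi> \<chi> P Q P' Q' :: "rvec measure"
  assumes F: "F \<in> gx_hom l m" "(f, \<psi>, p) \<in> F"
    and G: "G \<in> gx_hom m n" "(g, \<chi>, q) \<in> G"
    and P: "P = gx_name F" and Q: "Q = gx_name G"
    and P': "P' = weaken_right n P" and Q': "Q' = weaken_left l Q"
  shows "gaussian_system (l + m)
           {x @\<^sub>v y | x y. x \<in> carrier_vec l \<and> y \<in> carrier_vec m \<and> f *\<^sub>v x = p *\<^sub>v y} P \<and>
     gaussian_system (m + n)
           {y @\<^sub>v z | y z. y \<in> carrier_vec m \<and> z \<in> carrier_vec n \<and> g *\<^sub>v y = q *\<^sub>v z} Q \<and>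
     linear_system (l + m + n)
           {x @\<^sub>v y @\<^sub>v z | x y z. x \<in> carrier_vec l \<and> y \<in> carrier_vec m \<and> z \<in> carrier_vec n \<and>
              f *\<^sub>v x = p *\<^sub>v y} P' \<and>
     linear_system (l + m + n)
           {x @\<^sub>v y @\<^sub>v z | x y z. x \<in> carrier_vec l \<and> y \<in> carrier_vec m \<and> z \<in> carrier_vec n \<and>
              g *\<^sub>v y = q *\<^sub>v z} Q' \<and>
     complementary P' Q' \<and>
     is_interconnection P' Q' (interconnection P' Q') \<and>
     interconnection P' Q' = gx_name (F ;; gx_copy m ;; (gx_id m \<otimes>\<^sub>g G)) \<and>
     eliminate l m n (interconnection P' Q') = gx_name (F ;; G)"
proof -
  note s = gx_hom_class[OF F] and t = gx_hom_class[OF G]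
  obtain k where k: "f \<in> carrier_mat k l" "p \<in> carrier_mat k m" "surj_mat p" "gaussian k \<psi>"
    by (rule gx_triplesE[OF s(1)])
  obtain k' where k': "g \<in> carrier_mat k' m" "q \<in> carrier_mat k' n" "surj_mat q" "gaussian k' \<chi>"
    by (rule gx_triplesE[OF t(1)])
  obtain p' where p': "p' \<in> carrier_mat m k" "p * p' = 1\<^sub>m k"
    by (rule surj_mat_right_inverse[OF k(2,3)])
  obtain q' where q': "q' \<in> carrier_mat n k'" "q * q' = 1\<^sub>m k'"
    by (rule surj_mat_right_inverse[OF k'(2,3)])
  have pp': "p *\<^sub>v (p' *\<^sub>v x) = x" if "dim_vec x = k" for x
    using mat_mult_eqD[OF p'(2), of x] that k(2) p'(1) by (simp add: one_mat_mult_vec)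
  have qq': "q *\<^sub>v (q' *\<^sub>v x) = x" if "dim_vec x = k'" for x
    using mat_mult_eqD[OF q'(2), of x] that k'(2) q'(1) by (simp add: one_mat_mult_vec)
  have zero: "f *\<^sub>v 0\<^sub>v l = 0\<^sub>v k" "g *\<^sub>v 0\<^sub>v m = 0\<^sub>v k'" "p *\<^sub>v 0\<^sub>v m = 0\<^sub>v k" "q *\<^sub>v 0\<^sub>v n = 0\<^sub>v k'"
    using mult_mat_vec_zero[of f] mult_mat_vec_zero[of g] mult_mat_vec_zero[of p] mult_mat_vec_zero[of q] k k'
    by simp_all
  \<comment> \<open>Links the fibres, written as solution sets, to kernels of presenting
    matrices.\<close>
  have kernel: "{a @\<^sub>v b | a b. a \<in> carrier_vec i \<and> b \<in> carrier_vec j \<and> A *\<^sub>v a = B *\<^sub>v b} =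
      {v \<in> carrier_vec (i + j). ((- A) @\<^sub>c B) *\<^sub>v v = 0\<^sub>v r}"
    if AB: "A \<in> carrier_mat r i" "B \<in> carrier_mat r j" for A B r i j
  proof -
    have key: "A *\<^sub>v a = B *\<^sub>v b \<longleftrightarrow> ((- A) @\<^sub>c B) *\<^sub>v (a @\<^sub>v b) = 0\<^sub>v r" if d: "dim_vec a = i" "dim_vec b = j" for a b
    proof -
      have e: "((- A) @\<^sub>c B) *\<^sub>v (a @\<^sub>v b) = B *\<^sub>v b - A *\<^sub>v a"
        by (rule eq_vecI) (use d AB in \<open>simp_all add: append_cols_mult_vec\<close>)
      show ?thesis
        unfolding e using vec_diff_eq_zeroD[of "B *\<^sub>v b" "A *\<^sub>v a" r] AB
        by (auto simp: minus_cancel_vec[OF carrier_vecI])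
    qed
    show ?thesis
    proof (intro Set.set_eqI iffI)
      fix v assume "v \<in> {a @\<^sub>v b | a b. a \<in> carrier_vec i \<and> b \<in> carrier_vec j \<and> A *\<^sub>v a = B *\<^sub>v b}"
      then obtain a b where "v = a @\<^sub>v b" "a \<in> carrier_vec i" "b \<in> carrier_vec j" "A *\<^sub>v a = B *\<^sub>v b"
        by blast
      then show "v \<in> {v \<in> carrier_vec (i + j). ((- A) @\<^sub>c B) *\<^sub>v v = 0\<^sub>v r}"
        using key[of a b] by simp
    next
      fix v assume "v \<in> {v \<in> carrier_vec (i + j). ((- A) @\<^sub>c B) *\<^sub>v v = 0\<^sub>v r}"
      then have v: "v \<in> carrier_vec (i + j)" "((- A) @\<^sub>c B) *\<^sub>v v = 0\<^sub>v r" by blast+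
      obtain a b where ab: "v = a @\<^sub>v b" "dim_vec a = i" "dim_vec b = j"
        by (rule carrier_vec_appendE[OF v(1)])
      then have "A *\<^sub>v a = B *\<^sub>v b" using key v(2) by simp
      then show "v \<in> {a @\<^sub>v b | a b. a \<in> carrier_vec i \<and> b \<in> carrier_vec j \<and> A *\<^sub>v a = B *\<^sub>v b}"
        using ab(1) carrier_vecI[OF ab(2)] carrier_vecI[OF ab(3)] by blast
    qed
  qed

  let ?H = "(- f) @\<^sub>c p" and ?K = "(- g) @\<^sub>c q"
  let ?H' = "?H @\<^sub>c 0\<^sub>m k n" and ?K' = "0\<^sub>m k' l @\<^sub>c ?K"
  have Hc: "?H \<in> carrier_mat k (l + m)" "?K \<in> carrier_mat k' (m + n)"
    "?H' \<in> carrier_mat k (l + m + n)" "?K' \<in> carrier_mat k' (l + (m + n))"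
    by (rule carrier_matI; use k k' in simp)+
  have presP: "presents (l + m) ?H \<psi> P"
    using presents_name[OF s(1)] gx_name_eq[OF F] P by simp
  have presQ: "presents (m + n) ?K \<chi> Q"
    using presents_name[OF t(1)] gx_name_eq[OF G] Q by simp
  have presP': "presents (l + m + n) ?H' \<psi> P'"
    unfolding P' by (rule presents_weaken_right[OF presP Hc(1)])
  have presQ': "presents (l + (m + n)) ?K' \<chi> Q'"
    unfolding Q' by (rule presents_weaken_left[OF presQ Hc(2)])

  \<comment> \<open>Right inverses of the presenting matrices: put zero into the input and a section
    of \<open>p\<close> or \<open>q\<close> into the output. The weakened versions \<open>R'\<close>
    and \<open>S'\<close> add a zero block for the ignored variable.\<close>
  let ?R = "0\<^sub>m l k @\<^sub>r p'" and ?S = "0\<^sub>m m k' @\<^sub>r q'"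
  have R: "?R \<in> carrier_mat (l + m) k" "?H * ?R = 1\<^sub>m k"
  proof -
    show "?R \<in> carrier_mat (l + m) k" by (rule carrier_matI) (use p' in simp_all)
    show "?H * ?R = 1\<^sub>m k"
      by (rule mat_eq_by_action)
         (use k p' pp' zero in \<open>simp_all add: mat_action_simps uminus_zero_rvec left_zero_vec[OF carrier_vecI]\<close>)
  qed
  have S: "?S \<in> carrier_mat (m + n) k'" "?K * ?S = 1\<^sub>m k'"
  proof -
    show "?S \<in> carrier_mat (m + n) k'" by (rule carrier_matI) (use q' in simp_all)
    show "?K * ?S = 1\<^sub>m k'"
      by (rule mat_eq_by_action)
         (use k' q' qq' zero in \<open>simp_all add: mat_action_simps uminus_zero_rvec left_zero_vec[OF carrier_vecI]\<close>)
  qed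
  have R': "?R @\<^sub>r 0\<^sub>m n k \<in> carrier_mat (l + m + n) k" "?H' * (?R @\<^sub>r 0\<^sub>m n k) = 1\<^sub>m k"
  proof -
    show "?R @\<^sub>r 0\<^sub>m n k \<in> carrier_mat (l + m + n) k" by (rule carrier_matI) (use p' in simp_all)
    show "?H' * (?R @\<^sub>r 0\<^sub>m n k) = 1\<^sub>m k"
      by (rule mat_eq_by_action) (use k p' pp' zero in \<open>simp_all add: mat_action_simps uminus_zero_rvec
        left_zero_vec[OF carrier_vecI] right_zero_vec[OF carrier_vecI]\<close>)
  qed
  have S': "0\<^sub>m l k' @\<^sub>r ?S \<in> carrier_mat (l + (m + n)) k'" "?K' * (0\<^sub>m l k' @\<^sub>r ?S) = 1\<^sub>m k'"
  proof -
    show "0\<^sub>m l k' @\<^sub>r ?S \<in> carrier_mat (l + (m + n)) k'" by (rule carrier_matI) (use q' in simp_all)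
    show "?K' * (0\<^sub>m l k' @\<^sub>r ?S) = 1\<^sub>m k'"
      by (rule mat_eq_by_action) (use k' q' qq' zero in \<open>simp_all add: mat_action_simps uminus_zero_rvec
        left_zero_vec[OF carrier_vecI] right_zero_vec[OF carrier_vecI]\<close>)
  qed

  have sysP: "gaussian_system (l + m)
      {x @\<^sub>v y | x y. x \<in> carrier_vec l \<and> y \<in> carrier_vec m \<and> f *\<^sub>v x = p *\<^sub>v y} P"
    unfolding kernel[OF k(1,2)] by (rule presents_gaussian_system[OF presP Hc(1) R k(4)])
  have sysQ: "gaussian_system (m + n)
      {y @\<^sub>v z | y z. y \<in> carrier_vec m \<and> z \<in> carrier_vec n \<and> g *\<^sub>v y = q *\<^sub>v z} Q"
    unfolding kernel[OF k'(1,2)] by (rule presents_gaussian_system[OF presQ Hc(2) S k'(4)])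
  have DP: "{x @\<^sub>v y @\<^sub>v z | x y z. x \<in> carrier_vec l \<and> y \<in> carrier_vec m \<and> z \<in> carrier_vec n \<and>
      f *\<^sub>v x = p *\<^sub>v y} = {v \<in> carrier_vec (l + m + n). ?H' *\<^sub>v v = 0\<^sub>v k}" (is "?DP = _")
  proof (intro Set.set_eqI iffI)
    fix v assume "v \<in> ?DP"
    then obtain x y z where v: "v = x @\<^sub>v y @\<^sub>v z" "x \<in> carrier_vec l" "y \<in> carrier_vec m"
      "z \<in> carrier_vec n" "f *\<^sub>v x = p *\<^sub>v y" by blast
    then have "x @\<^sub>v y \<in> {v \<in> carrier_vec (l + m). ?H *\<^sub>v v = 0\<^sub>v k}"
      unfolding kernel[OF k(1,2), symmetric] by blast
    then show "v \<in> {v \<in> carrier_vec (l + m + n). ?H' *\<^sub>v v = 0\<^sub>v k}"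
      using v k unfolding v(1) append_vec_assoc[symmetric]
      by (simp add: append_cols_mult_vec[of "x @\<^sub>v y"] zero_mat_mult_vec)
  next
    fix v assume "v \<in> {v \<in> carrier_vec (l + m + n). ?H' *\<^sub>v v = 0\<^sub>v k}"
    then have v: "v \<in> carrier_vec (l + m + n)" "?H' *\<^sub>v v = 0\<^sub>v k" by auto
    obtain xy z where xyz: "v = xy @\<^sub>v z" "dim_vec xy = l + m" "dim_vec z = n"
      by (rule carrier_vec_appendE[OF v(1)])
    have "?H *\<^sub>v xy = 0\<^sub>v k"
      using v(2) xyz k by (simp add: append_cols_mult_vec[of xy] zero_mat_mult_vec right_zero_vec[OF carrier_vecI])
    then have "xy \<in> {v \<in> carrier_vec (l + m). ?H *\<^sub>v v = 0\<^sub>v k}" using carrier_vecI[OF xyz(2)] by simp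
    then obtain x y where "xy = x @\<^sub>v y" "x \<in> carrier_vec l" "y \<in> carrier_vec m" "f *\<^sub>v x = p *\<^sub>v y"
      unfolding kernel[OF k(1,2), symmetric] by blast
    then show "v \<in> ?DP" using xyz carrier_vecI[OF xyz(3)] append_vec_assoc by blast
  qed
  have DQ: "{x @\<^sub>v y @\<^sub>v z | x y z. x \<in> carrier_vec l \<and> y \<in> carrier_vec m \<and> z \<in> carrier_vec n \<and>
      g *\<^sub>v y = q *\<^sub>v z} = {v \<in> carrier_vec (l + (m + n)). ?K' *\<^sub>v v = 0\<^sub>v k'}" (is "?DQ = _")
  proof (intro Set.set_eqI iffI)
    fix v assume "v \<in> ?DQ"
    then obtain x y z where v: "v = x @\<^sub>v y @\<^sub>v z" "x \<in> carrier_vec l" "y \<in> carrier_vec m"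
      "z \<in> carrier_vec n" "g *\<^sub>v y = q *\<^sub>v z" by blast
    then have "y @\<^sub>v z \<in> {v \<in> carrier_vec (m + n). ?K *\<^sub>v v = 0\<^sub>v k'}"
      unfolding kernel[OF k'(1,2), symmetric] by blast
    then show "v \<in> {v \<in> carrier_vec (l + (m + n)). ?K' *\<^sub>v v = 0\<^sub>v k'}"
      using v k' unfolding v(1)
      by (simp add: append_cols_mult_vec[of x _ "y @\<^sub>v z"] zero_mat_mult_vec)
  next
    fix v assume "v \<in> {v \<in> carrier_vec (l + (m + n)). ?K' *\<^sub>v v = 0\<^sub>v k'}"
    then have v: "v \<in> carrier_vec (l + (m + n))" "?K' *\<^sub>v v = 0\<^sub>v k'" by auto
    obtain x yz where xyz: "v = x @\<^sub>v yz" "dim_vec x = l" "dim_vec yz = m + n"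
      by (rule carrier_vec_appendE[OF v(1)])
    have "?K *\<^sub>v yz = 0\<^sub>v k'"
      using v(2) xyz k' by (simp add: append_cols_mult_vec[of x _ yz] zero_mat_mult_vec left_zero_vec[OF carrier_vecI])
    then have "yz \<in> {v \<in> carrier_vec (m + n). ?K *\<^sub>v v = 0\<^sub>v k'}" using carrier_vecI[OF xyz(3)] by simp
    then obtain y z where "yz = y @\<^sub>v z" "y \<in> carrier_vec m" "z \<in> carrier_vec n" "g *\<^sub>v y = q *\<^sub>v z"
      unfolding kernel[OF k'(1,2), symmetric] by blast
    then show "v \<in> ?DQ" using xyz carrier_vecI[OF xyz(2)] by blast
  qed
  have sysP': "linear_system (l + m + n) ?DP P'"
    unfolding DP by (rule presents_linear_system[OF presP' Hc(3) R' k(4)])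
  have sysQ': "linear_system (l + m + n) ?DQ Q'"
    unfolding DQ using presents_linear_system[OF presQ' Hc(4) S' k'(4)] by (simp add: add.assoc)

  have compl: "complementary P' Q'"
  proof (rule presents_complementary[OF presP' presQ'[folded add.assoc] gaussianD(2)[OF k(4)] gaussianD(2)[OF k'(4)]])
    fix u w :: rvec assume uw: "u \<in> carrier_vec k" "w \<in> carrier_vec k'"
    \<comment> \<open>With x = 0, the first equation is solved by a preimage of \<open>u\<close>
      under \<open>p\<close>. Then z has to compensate for g y, so it is a preimage of w + g y under
      \<open>q\<close>.\<close>
    let ?y = "p' *\<^sub>v u" and ?z = "q' *\<^sub>v (w + g *\<^sub>v (p' *\<^sub>v u))"
    have "?H' *\<^sub>v ((0\<^sub>v l @\<^sub>v ?y) @\<^sub>v ?z) = u"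
      using uw k p' q' pp' zero
      by (simp add: mat_action_simps uminus_zero_rvec left_zero_vec[OF carrier_vecI] right_zero_vec[OF carrier_vecI])
    moreover have "?K' *\<^sub>v (0\<^sub>v l @\<^sub>v (?y @\<^sub>v ?z)) = w"
    proof -
      have "?K' *\<^sub>v (0\<^sub>v l @\<^sub>v (?y @\<^sub>v ?z)) = 0\<^sub>v k' + (- (g *\<^sub>v (p' *\<^sub>v u)) + (w + g *\<^sub>v (p' *\<^sub>v u)))"
        using uw k' p' q' qq'[of "w + g *\<^sub>v (p' *\<^sub>v u)"]
        by (simp add: append_cols_mult_vec zero_mat_mult_vec)
      also have "\<dots> = w" by (rule eq_vecI) (use uw k' in simp_all)
      finally show ?thesis .
    qed
    moreover have "(0\<^sub>v l @\<^sub>v ?y) @\<^sub>v ?z \<in> carrier_vec (l + m + n)"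
      by (rule carrier_vecI) (use p' q' in simp)
    ultimately show "\<exists>v\<in>carrier_vec (l + m + n). ?H' *\<^sub>v v = u \<and> ?K' *\<^sub>v v = w"
      unfolding append_vec_assoc by blast
  qed

  let ?U = "- (f @\<^sub>r 0\<^sub>m k' l)" and ?V = "p @\<^sub>r (- g)" and ?W = "0\<^sub>m k n @\<^sub>r q"
  let ?I = "gx_name (F ;; gx_copy m ;; (gx_id m \<otimes>\<^sub>g G))"
  have presI: "presents (l + (m + n)) (?U @\<^sub>c ?V @\<^sub>c ?W) (product_dist k k' \<psi> \<chi>) ?I"
    unfolding s(2) t(2) gx_comp_copy(1)[OF s(1) t(1) k(2) k'(1)]
      gx_name_class[OF gx_comp_copy(2)[OF s(1) t(1) k(2) k'(1)]]
    by (rule presents_name[OF gx_comp_copy(2)[OF s(1) t(1) k(2) k'(1)]])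
  \<comment> \<open>The same map cut in two ways: into columns by the variables x, y, z, as
    elimination needs it, and into rows by the two systems, as interconnection needs it.\<close>
  have blocks: "?U @\<^sub>c ?V @\<^sub>c ?W = ?H' @\<^sub>r ?K'"
  proof (rule mat_eq_by_action)
    fix v :: rvec assume "v \<in> carrier_vec (dim_col (?H' @\<^sub>r ?K'))"
    then have "v \<in> carrier_vec (l + m + n)" using k by simp
    then obtain xy z where v: "v = xy @\<^sub>v z" "dim_vec xy = l + m" "dim_vec z = n"
      by (rule carrier_vec_appendE)
    obtain x y where xy: "xy = x @\<^sub>v y" "dim_vec x = l" "dim_vec y = m"
      by (rule carrier_vec_appendE[OF carrier_vecI[OF v(2)]])
    have a: "(?U @\<^sub>c ?V @\<^sub>c ?W) *\<^sub>v (x @\<^sub>v y @\<^sub>v z) =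
        (p *\<^sub>v y - f *\<^sub>v x) @\<^sub>v (q *\<^sub>v z - g *\<^sub>v y)"
      using xy(2,3) v(3) k k' by (simp add: mat_action_simps) (auto intro!: eq_vecI)
    have b: "?H' *\<^sub>v ((x @\<^sub>v y) @\<^sub>v z) = p *\<^sub>v y - f *\<^sub>v x"
      using xy(2,3) v(3) k by (simp add: mat_action_simps) (auto intro!: eq_vecI)
    have c: "?K' *\<^sub>v (x @\<^sub>v y @\<^sub>v z) = q *\<^sub>v z - g *\<^sub>v y"
      using xy(2,3) v(3) k' by (simp add: mat_action_simps) (auto intro!: eq_vecI)
    show "(?U @\<^sub>c ?V @\<^sub>c ?W) *\<^sub>v v = (?H' @\<^sub>r ?K') *\<^sub>v v"
      unfolding v(1) xy(1) using a b c xy(2,3) v(3) k k'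
      by (simp add: append_rows_mult_vec append_vec_assoc)
  qed (use k k' in auto)
  have inter: "is_interconnection P' Q' ?I"
    by (rule presents_interconnection[OF presP' presQ'[folded add.assoc] _ Hc(3) Hc(4)[folded add.assoc] k(4) k'(4)])
       (use presI blocks in \<open>simp add: add.assoc\<close>)
  have "space P' = space Q'" using presP' presQ' by (simp add: presents_def add.assoc)
  then have inter_eq: "interconnection P' Q' = ?I"
    by (rule interconnection_eqI[OF _ inter])

  \<comment> \<open>The column block of y is \<open>?V\<close>, and its cokernel is the pushout of
    \<open>p\<close> and \<open>g\<close>. Hence one matrix \<open>?C\<close> serves both for
    eliminating y and for computing \<open>F ;; G\<close>.\<close>
  obtain w i\<^sub>1 i\<^sub>2 C' where i: "i\<^sub>1 \<in> carrier_mat w k" "i\<^sub>2 \<in> carrier_mat w k'"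
    and coker: "split_cokernel ?V (i\<^sub>1 @\<^sub>c i\<^sub>2) C'"
    by (rule split_pushout_exists[OF k(2) k'(1)])
  let ?C = "i\<^sub>1 @\<^sub>c i\<^sub>2"
  have i': "i\<^sub>1 \<in> carrier_mat w (dim_row p)" "i\<^sub>2 \<in> carrier_mat w (dim_row g)" using i k k' by auto
  have comp: "gx_comp_along i\<^sub>1 i\<^sub>2 (f, \<psi>, p) (g, \<chi>, q) =
      (i\<^sub>1 * f, push ?C (product_dist k k' \<psi> \<chi>), i\<^sub>2 * q)"
    using conv_dist_push[OF k(4) k'(4) i] i by simp
  note comp_triple = gx_comp_along_triples[OF s(1) t(1) i' coker, unfolded comp]
  have "F ;; G = gx_class (i\<^sub>1 * f, push ?C (product_dist k k' \<psi> \<chi>), i\<^sub>2 * q)"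
    unfolding s(2) t(2) gx_comp_class[OF s(1) t(1) i' coker] comp ..
  then have presFG: "presents (l + n) ((- (i\<^sub>1 * f)) @\<^sub>c (i\<^sub>2 * q)) (push ?C (product_dist k k' \<psi> \<chi>)) (gx_name (F ;; G))"
    using presents_name[OF comp_triple] gx_name_class[OF comp_triple] by simp
  have "presents (l + n) ((?C * ?U) @\<^sub>c (?C * ?W)) (push ?C (product_dist k k' \<psi> \<chi>)) (eliminate l m n ?I)"
  proof (rule presents_eliminate[OF presI _ _ _ _ coker])
    show "?U \<in> carrier_mat (k + k') l" "?V \<in> carrier_mat (k + k') m" "?W \<in> carrier_mat (k + k') n"
      "?C \<in> carrier_mat w (k + k')"
      by (rule carrier_matI; use k k' i in simp)+
    show "sets (product_dist k k' \<psi> \<chi>) = sets (borel_vec (k + k'))" by (simp add: product_dist_def)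
  qed
  moreover have "?C * ?U = - (i\<^sub>1 * f)"
  proof (rule mat_eq_by_action)
    fix x :: rvec assume "x \<in> carrier_vec (dim_col (- (i\<^sub>1 * f)))"
    then have x: "dim_vec x = l" using k by simp
    have "(?C * ?U) *\<^sub>v x = ?C *\<^sub>v (?U *\<^sub>v x)"
      by (rule mult_mat_mult_vec) (use x k k' i in simp_all)
    also have "\<dots> = ?C *\<^sub>v ((- (f *\<^sub>v x)) @\<^sub>v 0\<^sub>v k')"
      using x k by (simp add: mat_action_simps uminus_zero_rvec)
    also have "\<dots> = - (i\<^sub>1 *\<^sub>v (f *\<^sub>v x))"
      using x k i mult_mat_vec_zero[of i\<^sub>2]
      by (simp add: append_cols_mult_vec mult_mat_vec_uminus right_zero_vec[OF carrier_vecI])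
    also have "\<dots> = (- (i\<^sub>1 * f)) *\<^sub>v x"
      using x k i by (simp add: mult_mat_mult_vec)
    finally show "(?C * ?U) *\<^sub>v x = (- (i\<^sub>1 * f)) *\<^sub>v x" .
  qed (use k i in auto)
  moreover have "?C * ?W = i\<^sub>2 * q"
  proof (rule mat_eq_by_action)
    fix x :: rvec assume "x \<in> carrier_vec (dim_col (i\<^sub>2 * q))"
    then show "(?C * ?W) *\<^sub>v x = (i\<^sub>2 * q) *\<^sub>v x"
      using k' i mult_mat_vec_zero[of i\<^sub>1]
      by (simp add: mat_action_simps left_zero_vec[OF carrier_vecI])
  qed (use k' i in auto)
  ultimately have elim: "eliminate l m n ?I = gx_name (F ;; G)"
    using presents_unique[OF presFG] by simp
  show ?thesis
    using sysP sysQ sysP' sysQ' compl inter elim unfolding inter_eq by simp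
qed

end
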